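(* Let $H$ be a cycle of length $k$, let $n$ be a positive integer, $p\in[0,1]$ and $L_p=(\log(2/p))^{-1/2}$. Then for every $t>0$, $$\mathbb{P}\big(|Y_H(n,p)-\mathbb{E}Y_H(n,p)|\ge t\big)\le2\exp\Big(-\frac{1}{C_k}\Big(\frac{t^2}{L_p^{2k}n^k}\wedge\min_{\substack{1\le l\le d\le k\colon\\ d<k\text{ or }l>1}}\Big(\frac{t^{2/l}}{L_p^{2d/l}p^{2(k-d)/l}n^{(2k-d-l)/l}}\Big)\Big)\Big).$$ In particular, for every $\varepsilon>0$ and $p\ge n^{-\frac{k-2}{2(k-1)}}\log^{-1/2}n$, $$\mathbb{P}\big(Y_H(n,p)\ge(1+\varepsilon)\mathbb{E}Y_H(n,p)\big)\le2\exp\Big(-\frac{1}{C_k}(\varepsilon^2\wedge\varepsilon^{2/k})\,n^2p^2\log(2/p)\Big).$$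
   Context: $G(n,p)$ is the Erdős–Rényi random graph: the undirected graph with vertex set $\{1,\dots,n\}$ in which each two-element subset of the vertex set is an edge independently with probability $p$. $Y_H(n,p)$ is the number of (not necessarily induced) subgraphs of $G(n,p)$ which are isomorphic to $H$. A subgraph of $G$ is a graph whose vertex set and edge set are contained in those of $G$. $a\wedge b=\min(a,b)$. $C_k$ denotes a positive constant depending only on $k$, whose value may differ between occurrences.
   Formalization: The second display is proved for n ≥ k; for n < k there are no copies of H, so the probability is 1 for every ε while the stated bound tends to 0 as ε grows (e.g. k = 4, n = 3, p = 1), so the claim fails there. *)

theory Defs
  imports "HOL-Probability.Probability"
begin

type_synonym 'a graph = "'a set \<times> 'a set set"

abbreviation verts :: "'a graph \<Rightarrow> 'a set" where
  "verts \<equiv> fst"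

abbreviation edges :: "'a graph \<Rightarrow> 'a set set" where
  "edges \<equiv> snd"

definition all_pairs :: "'a set \<Rightarrow> 'a set set" where
  "all_pairs V = {e. e \<subseteq> V \<and> card e = 2}"

definition simple_graph :: "'a graph \<Rightarrow> bool" where
  "simple_graph G \<longleftrightarrow> edges G \<subseteq> all_pairs (verts G)"

definition subgraph :: "'a graph \<Rightarrow> 'a graph \<Rightarrow> bool" where
  "subgraph K G \<longleftrightarrow> simple_graph K \<and> verts K \<subseteq> verts G \<and> edges K \<subseteq> edges G"

definition isomorphic :: "'a graph \<Rightarrow> 'b graph \<Rightarrow> bool" where
  "isomorphic G H \<longleftrightarrow> (\<exists>\<phi>. bij_betw \<phi> (verts G) (verts H) \<and>
     (\<forall>u\<in>verts G. \<forall>v\<in>verts G. {u, v} \<in> edges G \<longleftrightarrow> {\<phi> u, \<phi> v} \<in> edges H))"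

definition cycle_graph :: "nat \<Rightarrow> nat graph" where
  "cycle_graph k = ({..<k}, (\<lambda>i. {i, Suc i mod k}) ` {..<k})"

text \<open>For \<open>k < 3\<close> the graph \<^const>\<open>cycle_graph\<close> is degenerate, so these lengths are excluded.\<close>

definition is_cycle :: "nat \<Rightarrow> 'a graph \<Rightarrow> bool" where
  "is_cycle k H \<longleftrightarrow> 3 \<le> k \<and> simple_graph H \<and> isomorphic H (cycle_graph k)"

definition random_graph :: "nat \<Rightarrow> real \<Rightarrow> nat graph pmf" where
  "random_graph n p =
     map_pmf (\<lambda>present. ({1..n}, {e \<in> all_pairs {1..n}. present e}))
       (Pi_pmf (all_pairs {1..n}) False (\<lambda>_. bernoulli_pmf p))"

definition copies :: "'a graph \<Rightarrow> 'b graph \<Rightarrow> nat" where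
  "copies H G = card {K. subgraph K G \<and> isomorphic K H}"

definition expected_copies :: "'a graph \<Rightarrow> nat \<Rightarrow> real \<Rightarrow> real" where
  "expected_copies H n p = measure_pmf.expectation (random_graph n p) (\<lambda>G. real (copies H G))"

text \<open>Meaningful for \<open>0 < p \<le> 1\<close> only; the informal limit value at \<open>p = 0\<close> is \<open>0\<close>.\<close>

definition Lp :: "real \<Rightarrow> real" where
  "Lp p = ln (2 / p) powr (- 1 / 2)"

definition tail_exponent :: "nat \<Rightarrow> nat \<Rightarrow> real \<Rightarrow> real \<Rightarrow> real" where
  "tail_exponent k n p t =
     min (t\<^sup>2 / (Lp p ^ (2 * k) * real n ^ k))
         (MIN (l, d) \<in> {(l, d). 1 \<le> l \<and> l \<le> d \<and> d \<le> k \<and> (d < k \<or> l > 1)}.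
            t powr (2 / real l) /
              (Lp p powr (2 * real d / real l) *
               p powr (2 * (real k - real d) / real l) *
               real n powr ((2 * real k - real d - real l) / real l)))"

text \<open>At \<open>p = 0\<close> every denominator in the exponent vanishes (as \<open>Lp 0 = 0\<close>), so the exponent is
  infinite and the bound is \<open>2 exp (-\<infinity>) = 0\<close>. Division by zero in HOL would instead give the
  exponent \<open>0\<close> and a void bound, hence the case distinction.\<close>

definition tail_bound :: "real \<Rightarrow> nat \<Rightarrow> nat \<Rightarrow> real \<Rightarrow> real \<Rightarrow> real" where
  "tail_bound C k n p t = (if p = 0 then 0 else 2 * exp (- (1 / C) * tail_exponent k n p t))"

end

(* Write each indicator as p + xi, where xi is subgaussian with variance proxy Lp p ^ 2. Averaging
   over all colourings of the vertices with k colours, and by Jensen's inequality, it is enough to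
   bound the moments of the number of cycles whose i-th vertex has colour i. This number is the
   trace of a product of k independent random matrices. Replacing the random factors by their means
   one at a time from the right splits its deviation into k terms, each linear in the noise of one
   matrix with coefficients depending on the earlier matrices only, so conditionally its 2r-th
   moment is at most (C r Lp^2 HS^2)^r, where HS is the Hilbert-Schmidt norm of the coefficient
   matrix. That norm is controlled by operator norms of the single factors (a lattice net) and, for
   the last term, by a recursion over the factors in which a Hanson-Wright moment inequality bounds
   the Hilbert-Schmidt norm of a fixed matrix times a noise matrix. Markov's inequality then gives
   both tails; only the first term of the exponent and the terms with (l, d) among (1, 1),
   (1, k - 1), (k - 1, k - 1), (2, 2), (2, k), (k, k) are needed. *)

theory Submission
  imports Defs
begin

text \<open>The trace of a power of one adjacency matrix also counts closed walks with repeated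
  vertices, and all its factors share the same noise. Prescribing the colour of each vertex of the
  walk removes both obstacles at once: only injective walks survive, and for length at least three
  the factors use disjoint sets of edges, hence are independent. Replacing from the right leaves
  only random factors to the left of the noise and only constant ones to its right, so conditioning
  on the left yields a linear form. A mean matrix has entries at most \<open>p\<close>, so its
  Hilbert-Schmidt norm obeys the same bound \<open>p * n\<close> as its operator norm; one mean
  factor in the coefficient matrix is therefore enough. The last term has none. There the crude
  estimate, \<open>sqrt n\<close> times the operator norm, would put a factor \<open>sqrt n\<close>
  on the terms containing \<open>p * n\<close>; the recursion confines it to the product of pure
  noise. Moments have order \<open>4 * r\<close>, because the quadratic estimate concerns the square
  of a Hilbert-Schmidt norm and needs an even power \<open>2 * r\<close> of it. Numerical constants
  are crude throughout.\<close>

section \<open>Random subsets of a finite set\<close>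

text \<open>The expectation of \<open>F S\<close> for a random subset \<open>S\<close> of \<open>A\<close> that contains each element
  independently with probability \<open>p\<close>.\<close>

definition bexp :: "real \<Rightarrow> 'e set \<Rightarrow> ('e set \<Rightarrow> real) \<Rightarrow> real" where
  "bexp p A F = (\<Sum>S\<in>Pow A. p ^ card S * (1 - p) ^ card (A - S) * F S)"

lemma bexp_cong: "(\<And>S. S \<subseteq> A \<Longrightarrow> F S = G S) \<Longrightarrow> bexp p A F = bexp p A G"
  unfolding bexp_def by (intro sum.cong) auto

lemma bexp_empty [simp]: "bexp p {} F = F {}"
  by (simp add: bexp_def)

lemma bexp_insert:
  assumes "finite A" "e \<notin> A"
  shows "bexp p (insert e A) F = p * bexp p A (\<lambda>S. F (insert e S)) + (1 - p) * bexp p A F"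
proof -
  have inj: "inj_on (insert e) (Pow A)"
    using assms(2) by (auto simp: inj_on_def)
  have disj: "Pow A \<inter> insert e ` Pow A = {}"
    using assms(2) by auto
  have "bexp p (insert e A) F = (\<Sum>S\<in>Pow A. p ^ card S * (1 - p) ^ card (insert e A - S) * F S)
      + (\<Sum>S\<in>Pow A. p ^ card (insert e S) * (1 - p) ^ card (insert e A - insert e S) * F (insert e S))"
    unfolding bexp_def Pow_insert using assms(1) disj
    by (subst sum.union_disjoint) (auto simp: sum.reindex[OF inj])
  also have "(\<Sum>S\<in>Pow A. p ^ card S * (1 - p) ^ card (insert e A - S) * F S) = (1 - p) * bexp p A F"
    unfolding bexp_def sum_distrib_left
  proof (intro sum.cong refl)
    fix S assume "S \<in> Pow A"
    then have "card (insert e A - S) = Suc (card (A - S))"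
      using assms by (subst insert_Diff_if) auto
    then show "p ^ card S * (1 - p) ^ card (insert e A - S) * F S =
        (1 - p) * (p ^ card S * (1 - p) ^ card (A - S) * F S)" by simp
  qed
  also have "(\<Sum>S\<in>Pow A. p ^ card (insert e S) * (1 - p) ^ card (insert e A - insert e S) * F (insert e S))
      = p * bexp p A (\<lambda>S. F (insert e S))"
    unfolding bexp_def sum_distrib_left
  proof (intro sum.cong refl)
    fix S assume "S \<in> Pow A"
    then have "card (insert e S) = Suc (card S)" "insert e A - insert e S = A - S"
      using assms by (auto simp: finite_subset intro!: card_insert_disjoint)
    then show "p ^ card (insert e S) * (1 - p) ^ card (insert e A - insert e S) * F (insert e S) =
        p * (p ^ card S * (1 - p) ^ card (A - S) * F (insert e S))" by simp
  qed
  finally show ?thesis by simp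
qed

lemma bexp_add: "bexp p A (\<lambda>S. F S + G S) = bexp p A F + bexp p A G"
  by (simp add: bexp_def distrib_left sum.distrib)

lemma bexp_cmult: "bexp p A (\<lambda>S. c * F S) = c * bexp p A F"
  unfolding bexp_def sum_distrib_left by (intro sum.cong) (auto simp: mult_ac)

lemma bexp_diff: "bexp p A (\<lambda>S. F S - G S) = bexp p A F - bexp p A G"
  by (simp add: bexp_def right_diff_distrib sum_subtractf)

lemma bexp_sum: "bexp p A (\<lambda>S. \<Sum>i\<in>I. F i S) = (\<Sum>i\<in>I. bexp p A (F i))"
  unfolding bexp_def sum_distrib_left by (rule sum.swap)

lemma bexp_prod_coord:
  assumes "finite A"
  shows "bexp p A (\<lambda>S. \<Prod>e\<in>A. g e (e \<in> S)) = (\<Prod>e\<in>A. p * g e True + (1 - p) * g e False)"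
  using assms
proof (induction A)
  case (insert x A)
  have "bexp p A (\<lambda>S. \<Prod>e\<in>A. g e (e \<in> insert x S)) = bexp p A (\<lambda>S. \<Prod>e\<in>A. g e (e \<in> S))"
    using insert.hyps by (intro bexp_cong prod.cong refl arg_cong2[where f=g]) auto
  moreover have "bexp p A (\<lambda>S. g x (x \<in> S) * (\<Prod>e\<in>A. g e (e \<in> S)))
      = bexp p A (\<lambda>S. g x False * (\<Prod>e\<in>A. g e (e \<in> S)))"
  proof (intro bexp_cong)
    fix S assume "S \<subseteq> A"
    with insert.hyps have "x \<notin> S" by auto
    then show "g x (x \<in> S) * (\<Prod>e\<in>A. g e (e \<in> S)) = g x False * (\<Prod>e\<in>A. g e (e \<in> S))"
      by simp
  qed
  ultimately show ?case
    using insert by (simp add: bexp_insert bexp_cmult distrib_right)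
qed simp

lemma bexp_const [simp]: "finite A \<Longrightarrow> bexp p A (\<lambda>_. c) = c"
proof (induction A rule: finite_induct)
  case (insert x A)
  then show ?case by (simp add: bexp_insert algebra_simps)
qed simp

lemma bexp_Un:
  assumes "finite A" "finite B" "A \<inter> B = {}"
  shows "bexp p (A \<union> B) F = bexp p A (\<lambda>S. bexp p B (\<lambda>T. F (S \<union> T)))"
  using assms
proof (induction A arbitrary: F rule: finite_induct)
  case (insert x A)
  then show ?case by (simp add: bexp_insert)
qed simp

lemma bexp_mono:
  assumes "0 \<le> p" "p \<le> 1" "\<And>S. S \<subseteq> A \<Longrightarrow> F S \<le> G S"
  shows "bexp p A F \<le> bexp p A G"
  unfolding bexp_def using assms by (intro sum_mono mult_left_mono) auto

lemma bexp_nonneg: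
  assumes "0 \<le> p" "p \<le> 1" "\<And>S. S \<subseteq> A \<Longrightarrow> 0 \<le> F S"
  shows "0 \<le> bexp p A F"
  unfolding bexp_def using assms by (intro sum_nonneg mult_nonneg_nonneg) auto

lemma bexp_split:
  assumes "finite A" "B \<subseteq> A"
  shows "bexp p A F = bexp p B (\<lambda>S. bexp p (A - B) (\<lambda>T. F (S \<union> T)))"
proof -
  have "A = B \<union> (A - B)" using assms by auto
  then have "bexp p A F = bexp p (B \<union> (A - B)) F" by simp
  also have "\<dots> = bexp p B (\<lambda>S. bexp p (A - B) (\<lambda>T. F (S \<union> T)))"
    using assms by (intro bexp_Un) (auto simp: finite_subset)
  finally show ?thesis .
qed

text \<open>Plays the role of conditional expectation: the coordinates in \<open>B\<close> are
  frozen, so whatever depends on them alone becomes a constant in the comparison over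
  \<open>A - B\<close>.\<close>

lemma bexp_cond_mono:
  assumes "finite A" "B \<subseteq> A" "0 \<le> p" "p \<le> 1"
    and "\<And>S. S \<subseteq> B \<Longrightarrow> bexp p (A - B) (\<lambda>T. F (S \<union> T)) \<le> bexp p (A - B) (\<lambda>T. G (S \<union> T))"
  shows "bexp p A F \<le> bexp p A G"
  unfolding bexp_split[OF assms(1,2)] by (rule bexp_mono[OF assms(3-5)])

lemma bexp_indep:
  assumes "finite A" "B \<subseteq> A"
    and F: "\<And>S. S \<subseteq> A \<Longrightarrow> F S = F (S \<inter> B)" and G: "\<And>S. S \<subseteq> A \<Longrightarrow> G S = G (S - B)"
  shows "bexp p A (\<lambda>S. F S * G S) = bexp p A F * bexp p A G"
proof -
  have fin: "finite B" "finite (A - B)" using assms by (auto simp: finite_subset)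
  have eqF: "F (S \<union> T) = F S" if "S \<subseteq> B" "T \<subseteq> A - B" for S T
  proof -
    have "S \<union> T \<subseteq> A" "(S \<union> T) \<inter> B = S" using that assms by auto
    then show ?thesis using F by metis
  qed
  have eqG: "G (S \<union> T) = G T" if "S \<subseteq> B" "T \<subseteq> A - B" for S T
  proof -
    have "S \<union> T \<subseteq> A" "(S \<union> T) - B = T" using that assms by auto
    then show ?thesis using G by metis
  qed
  have 1: "bexp p A (\<lambda>S. F S * G S) = bexp p B (\<lambda>S. bexp p (A - B) (\<lambda>T. F S * G T))"
    unfolding bexp_split[OF assms(1,2)] by (intro bexp_cong) (simp add: eqF eqG)
  have 2: "bexp p A F = bexp p B F"
    unfolding bexp_split[OF assms(1,2), of _ F]
    by (intro bexp_cong) (simp add: eqF fin cong: bexp_cong)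
  have 3: "bexp p A G = bexp p (A - B) G"
  proof -
    have "bexp p A G = bexp p B (\<lambda>S. bexp p (A - B) G)"
      unfolding bexp_split[OF assms(1,2)] by (intro bexp_cong) (simp add: eqG cong: bexp_cong)
    then show ?thesis using fin by simp
  qed
  show ?thesis
    unfolding 1 2 3 bexp_cmult
    using bexp_cmult[of p B "bexp p (A - B) G" F] by (simp add: mult.commute)
qed

text \<open>The tangent line of a convex function. With \<open>a\<close> a mean, the linear term
  averages to zero, which gives Jensen's inequality for \<open>bexp\<close> and the power mean
  inequality for finite sums alike.\<close>

lemma even_power_tangent:
  fixes x a :: real
  assumes "even m"
  shows "a ^ m + real m * a ^ (m - 1) * (x - a) \<le> x ^ m"
proof -
  have "real m * a ^ (m - 1) * (x - a) \<le> x ^ m - a ^ m"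
    using assms
    by (intro convex_on_imp_above_tangent[OF convex_power_even[OF assms]])
      (auto intro!: derivative_eq_intros)
  then show ?thesis by simp
qed

lemma bexp_jensen_even:
  assumes "finite A" "0 \<le> p" "p \<le> 1" "even m"
  shows "bexp p A F ^ m \<le> bexp p A (\<lambda>S. F S ^ m)"
proof -
  define a where "a = bexp p A F"
  have "bexp p A (\<lambda>S. a ^ m + real m * a ^ (m - 1) * (F S - a)) \<le> bexp p A (\<lambda>S. F S ^ m)"
    using assms by (intro bexp_mono even_power_tangent)
  moreover have "bexp p A (\<lambda>S. a ^ m + real m * a ^ (m - 1) * (F S - a)) = a ^ m"
    using assms by (simp add: bexp_add bexp_cmult bexp_diff a_def)
  ultimately show ?thesis by (simp add: a_def)
qed

lemma sum_power_le_card: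
  fixes x :: "'i \<Rightarrow> real"
  assumes "finite I" "even m" "m \<noteq> 0"
  shows "(\<Sum>i\<in>I. x i) ^ m \<le> real (card I) ^ (m - 1) * (\<Sum>i\<in>I. x i ^ m)"
proof (cases "I = {}")
  case False
  define N where "N = real (card I)"
  have N: "N > 0" using False assms by (simp add: N_def card_gt_0_iff)
  define a where "a = (\<Sum>i\<in>I. x i) / N"
  have "(\<Sum>i\<in>I. a ^ m + real m * a ^ (m - 1) * (x i - a)) \<le> (\<Sum>i\<in>I. x i ^ m)"
    using assms by (intro sum_mono even_power_tangent)
  moreover have "(\<Sum>i\<in>I. a ^ m + real m * a ^ (m - 1) * (x i - a)) = N * a ^ m"
    using N by (simp add: sum.distrib sum_distrib_left[symmetric] sum_subtractf N_def[symmetric] a_def)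
  ultimately have "N * a ^ m * N ^ (m - 1) \<le> (\<Sum>i\<in>I. x i ^ m) * N ^ (m - 1)"
    using N by (intro mult_right_mono) auto
  moreover have "N * a ^ m * N ^ (m - 1) = (\<Sum>i\<in>I. x i) ^ m"
    using N assms(3) by (cases m) (auto simp: a_def power_divide)
  ultimately show ?thesis by (simp add: N_def mult.commute)
qed (use assms in \<open>auto simp: zero_power\<close>)

lemma add_power_even_le:
  fixes x y :: real
  assumes "even m"
  shows "(x + y) ^ m \<le> 2 ^ m * (x ^ m + y ^ m)"
proof (cases "m = 0")
  case False
  have "(\<Sum>b\<in>(UNIV::bool set). if b then x else y) ^ m
     \<le> real (card (UNIV::bool set)) ^ (m - 1) * (\<Sum>b\<in>(UNIV::bool set). (if b then x else y) ^ m)"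
    using False assms by (intro sum_power_le_card) auto
  then have "(x + y) ^ m \<le> 2 ^ (m - 1) * (x ^ m + y ^ m)"
    by (simp add: UNIV_bool add.commute)
  also have "\<dots> \<le> 2 ^ m * (x ^ m + y ^ m)"
    using assms by (intro mult_right_mono power_increasing) (auto simp: zero_le_even_power)
  finally show ?thesis .
qed simp

lemma power_even_diff: "even m \<Longrightarrow> (c - x) ^ m = (x - c :: real) ^ m"
  by (metis minus_diff_eq power_minus_even)

text \<open>By Jensen's inequality the mean itself is as close to \<open>c\<close> as the moment on
  the right allows, so moving the centre costs only a constant in the base. Later \<open>c\<close>
  is the trace of the product of the mean matrices.\<close>

lemma bexp_center:
  assumes "finite A" "0 \<le> p" "p \<le> 1" "even m"
  shows "bexp p A (\<lambda>S. (F S - bexp p A F) ^ m) \<le> 4 ^ m * bexp p A (\<lambda>S. (F S - c) ^ m)"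
proof -
  have jen: "(bexp p A F - c) ^ m \<le> bexp p A (\<lambda>S. (F S - c) ^ m)"
    using bexp_jensen_even[OF assms, of "\<lambda>S. F S - c"] assms by (simp add: bexp_diff)
  have "bexp p A (\<lambda>S. (F S - bexp p A F) ^ m)
      \<le> bexp p A (\<lambda>S. 2 ^ m * ((F S - c) ^ m + (c - bexp p A F) ^ m))"
  proof (intro bexp_mono assms)
    fix S
    show "(F S - bexp p A F) ^ m \<le> 2 ^ m * ((F S - c) ^ m + (c - bexp p A F) ^ m)"
      using add_power_even_le[OF assms(4), of "F S - c" "c - bexp p A F"] by simp
  qed
  also have "\<dots> = 2 ^ m * (bexp p A (\<lambda>S. (F S - c) ^ m) + (bexp p A F - c) ^ m)"
    using assms by (simp add: bexp_cmult bexp_add power_even_diff)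
  also have "\<dots> \<le> 2 ^ m * (2 * bexp p A (\<lambda>S. (F S - c) ^ m))"
    using jen by simp
  also have "\<dots> \<le> 2 ^ m * (2 ^ m * bexp p A (\<lambda>S. (F S - c) ^ m))" if "m \<noteq> 0"
  proof -
    have "(2::real) ^ 1 \<le> 2 ^ m" using that by (intro power_increasing) auto
    then show ?thesis using assms
      by (intro mult_left_mono mult_right_mono bexp_nonneg) (auto simp: zero_le_even_power)
  qed
  finally show ?thesis using assms
    by (cases "m = 0") (auto simp flip: power_mult_distrib simp: mult.assoc[symmetric])
qed

section \<open>Moments of linear and quadratic forms\<close>

definition xi :: "real \<Rightarrow> 'e \<Rightarrow> 'e set \<Rightarrow> real" where
  "xi p e S = of_bool (e \<in> S) - p"

lemma ln_two_div_ge: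
  fixes p :: real
  assumes "0 < p" "p \<le> 1"
  shows "ln 2 \<le> ln (2 / p)" "0 < ln (2 / p)" "p\<^sup>2 * ln (2 / p) \<le> 1"
proof -
  show 1: "ln 2 \<le> ln (2 / p)" using assms by (subst ln_le_cancel_iff) (auto simp: field_simps)
  show "0 < ln (2 / p)" using 1 by (rule less_le_trans[rotated]) simp
  have "ln (2 / p) \<le> 2 / p - 1" using assms by (intro ln_le_minus_one) auto
  then have "p\<^sup>2 * ln (2 / p) \<le> p\<^sup>2 * (2 / p - 1)" by (intro mult_left_mono) auto
  also have "\<dots> = 1 - (1 - p)\<^sup>2" using assms by (simp add: field_simps power2_eq_square)
  finally show "p\<^sup>2 * ln (2 / p) \<le> 1" by (smt (verit) zero_le_power2)
qed

lemma exp_chord_le: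
  fixes x y :: real
  assumes "0 \<le> x" "x \<le> y" "0 < y"
  shows "exp x - 1 \<le> x / y * (exp y - 1)"
proof -
  define t where "t = x / y"
  have t: "0 \<le> t" "t \<le> 1" "x = t * y" using assms by (auto simp: t_def)
  have "exp ((1 - t) *\<^sub>R 0 + t *\<^sub>R y) \<le> (1 - t) * exp 0 + t * exp y"
    using t by (intro convex_onD[OF exp_convex]) auto
  then have "exp x - 1 \<le> t * (exp y - 1)" using t by (simp add: algebra_simps)
  then show ?thesis by (simp add: t_def)
qed

text \<open>The origin of \<open>ln (2 / p)\<close>: at \<open>\<mu> = ln (2 / p)\<close> the rare
  outcome contributes \<open>p * exp \<mu> = 2\<close>, still a constant, and convexity of
  \<open>exp\<close> turns this into a bound linear in \<open>\<mu> / ln (2 / p)\<close> on the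
  whole range. The common outcome contributes about \<open>\<mu> * p\<^sup>2\<close>, which has the
  same size because \<open>p\<^sup>2 * ln (2 / p) \<le> 1\<close>.\<close>

lemma bernoulli_mgf_square:
  fixes p \<mu> :: real
  assumes p: "0 < p" "p \<le> 1" and mu: "0 \<le> \<mu>" "\<mu> \<le> ln (2 / p)"
  shows "p * exp (\<mu> * (1 - p)\<^sup>2) + (1 - p) * exp (\<mu> * p\<^sup>2) \<le> exp (4 * \<mu> / ln (2 / p))"
proof -
  define La where "La = ln (2 / p)"
  have La: "0 < La" "p\<^sup>2 * La \<le> 1" "\<mu> \<le> La"
    using ln_two_div_ge[OF p] mu by (auto simp: La_def)
  have eLa: "p * exp La = 2" using p by (simp add: La_def)
  have "exp (\<mu> * (1 - p)\<^sup>2) \<le> exp \<mu>"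
    using p mu by (simp add: mult_left_le power_le_one)
  then have "p * (exp (\<mu> * (1 - p)\<^sup>2) - 1) \<le> p * (exp \<mu> - 1)"
    using p by (intro mult_left_mono) auto
  also have "\<dots> \<le> p * (\<mu> / La * (exp La - 1))"
    using exp_chord_le[of \<mu> La] mu La p by (intro mult_left_mono) auto
  also have "\<dots> = \<mu> / La * (p * exp La - p)" by (simp add: algebra_simps)
  also have "\<dots> \<le> \<mu> / La * 2"
    unfolding eLa using p mu La by (intro mult_left_mono) auto
  finally have 1: "p * (exp (\<mu> * (1 - p)\<^sup>2) - 1) \<le> 2 * \<mu> / La" by (simp add: field_simps)
  define y where "y = \<mu> * p\<^sup>2"
  have y0: "0 \<le> y" using mu by (simp add: y_def)
  have "y \<le> La * p\<^sup>2" unfolding y_def using La by (intro mult_right_mono) auto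
  then have y1: "y \<le> 1" using La by (simp add: mult.commute)
  have "exp y \<le> 1 + y + y\<^sup>2" using y0 y1 by (rule exp_bound)
  moreover have "y\<^sup>2 \<le> y" using y0 y1 by (simp add: power2_eq_square mult_left_le)
  ultimately have "exp y - 1 \<le> 2 * y" by linarith
  moreover have "(1 - p) * (exp y - 1) \<le> 1 * (exp y - 1)"
    using p y0 by (intro mult_right_mono) auto
  ultimately have "(1 - p) * (exp y - 1) \<le> 2 * y" by (metis mult_1 order_trans)
  also have "y \<le> \<mu> / La"
  proof -
    have "p\<^sup>2 \<le> 1 / La" using La by (simp add: field_simps)
    then have "\<mu> * p\<^sup>2 \<le> \<mu> * (1 / La)" using mu by (intro mult_left_mono) auto
    then show ?thesis by (simp add: y_def)
  qed
  finally have 2: "(1 - p) * (exp (\<mu> * p\<^sup>2) - 1) \<le> 2 * \<mu> / La" by (simp add: y_def)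
  have "p * exp (\<mu> * (1 - p)\<^sup>2) + (1 - p) * exp (\<mu> * p\<^sup>2)
      = 1 + p * (exp (\<mu> * (1 - p)\<^sup>2) - 1) + (1 - p) * (exp (\<mu> * p\<^sup>2) - 1)"
    by (simp add: algebra_simps)
  also have "\<dots> \<le> 1 + 4 * \<mu> / La" using 1 2 by simp
  also have "\<dots> \<le> exp (4 * \<mu> / La)" by (rule exp_ge_add_one_self)
  finally show ?thesis by (simp add: La_def)
qed

text \<open>For a centred variable the term \<open>x\<close> drops out under the mean, so an
  exponential moment of the square bounds the exponential moment of the variable.\<close>

lemma exp_le_add_exp_square:
  fixes x :: real
  shows "exp x \<le> x + exp (x\<^sup>2)"
proof -
  have e: "1 + x\<^sup>2 \<le> exp (x\<^sup>2)" by (rule exp_ge_add_one_self)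
  consider "0 \<le> x" "x \<le> 1" | "1 < x" | "- 1 \<le> x" "x < 0" | "x < - 1" by linarith
  then show ?thesis
  proof cases
    case 1
    then show ?thesis using exp_bound[OF 1] e by linarith
  next
    case 2
    then have "exp x \<le> exp (x\<^sup>2)" by (simp add: power2_eq_square)
    then show ?thesis using 2 by linarith
  next
    case 3
    define u where "u = - x"
    have u: "0 < u" "u \<le> 1" using 3 by (auto simp: u_def)
    have "1 \<le> (1 - u + u\<^sup>2) * (1 + u)"
      using u by (simp add: algebra_simps power2_eq_square)
    also have "\<dots> \<le> (1 - u + u\<^sup>2) * exp u"
    proof (intro mult_left_mono exp_ge_add_one_self)
      show "0 \<le> 1 - u + u\<^sup>2" using u by simp
    qed
    finally have "exp (- u) \<le> 1 - u + u\<^sup>2"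
      by (simp add: exp_minus field_simps)
    then have "exp x \<le> 1 + x + x\<^sup>2" by (simp add: u_def)
    then show ?thesis using e by linarith
  next
    case 4
    then have "exp x \<le> 1" "- x \<le> x\<^sup>2" by (auto simp: power2_eq_square)
      (smt (verit) mult_le_cancel_right1 mult_minus_left)
    then show ?thesis using e by linarith
  qed
qed

text \<open>For \<open>l\<^sup>2 \<le> ln (2 / p)\<close> the bound for the square applies with
  parameter \<open>l\<^sup>2\<close>. Beyond that range the arithmetic-geometric inequality splits
  \<open>l * x\<close> so that the square appears with the extreme admissible parameter
  \<open>ln (2 / p)\<close>; the resulting constant \<open>exp 4\<close> is absorbed because
  \<open>l\<^sup>2 / ln (2 / p)\<close> exceeds 1.\<close>

lemma bernoulli_mgf:
  fixes p l :: real
  assumes p: "0 < p" "p \<le> 1"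
  shows "p * exp (l * (1 - p)) + (1 - p) * exp (l * (- p)) \<le> exp (5 * l\<^sup>2 / ln (2 / p))"
proof -
  define La where "La = ln (2 / p)"
  have La: "0 < La" using ln_two_div_ge[OF p] by (auto simp: La_def)
  show ?thesis
  proof (cases "l\<^sup>2 \<le> La")
    case True
    have alg: "p * (l * (1 - p) + x) + (1 - p) * (l * (- p) + y) = p * x + (1 - p) * y" for x y
      by (simp add: algebra_simps)
    have "p * exp (l * (1 - p)) + (1 - p) * exp (l * (- p))
      \<le> p * (l * (1 - p) + exp ((l * (1 - p))\<^sup>2)) + (1 - p) * (l * (- p) + exp ((l * (- p))\<^sup>2))"
      using p by (intro add_mono mult_left_mono exp_le_add_exp_square) auto
    also have "\<dots> = p * exp (l\<^sup>2 * (1 - p)\<^sup>2) + (1 - p) * exp (l\<^sup>2 * p\<^sup>2)"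
      unfolding alg by (simp add: power_mult_distrib)
    also have "\<dots> \<le> exp (4 * l\<^sup>2 / La)"
      using bernoulli_mgf_square[OF p, of "l\<^sup>2"] True by (simp add: La_def)
    also have "\<dots> \<le> exp (5 * l\<^sup>2 / La)"
      using La by (auto simp: field_simps)
    finally show ?thesis by (simp add: La_def)
  next
    case False
    have amgm: "l * x \<le> l\<^sup>2 / (4 * La) + La * x\<^sup>2" for x
    proof -
      have "0 \<le> (l - 2 * La * x)\<^sup>2 / (4 * La)" using La by simp
      also have "\<dots> = l\<^sup>2 / (4 * La) + La * x\<^sup>2 - l * x"
        using La by (simp add: field_simps power2_eq_square)
      finally show ?thesis by simp
    qed
    have "p * exp (l * (1 - p)) + (1 - p) * exp (l * (- p))
      \<le> p * exp (l\<^sup>2 / (4 * La) + La * (1 - p)\<^sup>2) + (1 - p) * exp (l\<^sup>2 / (4 * La) + La * (- p)\<^sup>2)"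
      using p by (intro add_mono mult_left_mono iffD2[OF exp_le_cancel_iff] amgm) auto
    also have "\<dots> = exp (l\<^sup>2 / (4 * La)) * (p * exp (La * (1 - p)\<^sup>2) + (1 - p) * exp (La * p\<^sup>2))"
      by (simp add: exp_add algebra_simps)
    also have "\<dots> \<le> exp (l\<^sup>2 / (4 * La)) * exp 4"
      using bernoulli_mgf_square[OF p, of La] La by (intro mult_left_mono) (auto simp: La_def)
    also have "\<dots> = exp (l\<^sup>2 / (4 * La) + 4)" by (simp add: exp_add)
    also have "\<dots> \<le> exp (5 * l\<^sup>2 / La)"
    proof -
      have "1 \<le> l\<^sup>2 / La" using False La by (simp add: field_simps)
      then show ?thesis by simp
    qed
    finally show ?thesis by (simp add: La_def)
  qed
qed

text \<open>Matrix entries are indexed by ordered pairs, the random set consists of unordered edges;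
  \<open>\<eta>\<close> translates, and its injectivity keeps the factors independent. Coordinates
  outside the image receive the factor 1.\<close>

lemma bexp_prod_inj:
  fixes \<eta> :: "'i \<Rightarrow> 'e"
  assumes "finite A" "inj_on \<eta> R" "\<eta> ` R \<subseteq> A"
  shows "bexp p A (\<lambda>S. \<Prod>i\<in>R. g i (\<eta> i \<in> S)) = (\<Prod>i\<in>R. p * g i True + (1 - p) * g i False)"
proof -
  define g' where "g' e b = (if e \<in> \<eta> ` R then g (the_inv_into R \<eta> e) b else 1)" for e b
  have fin: "finite R" using assms finite_subset finite_imageD by metis
  have ext: "(\<Prod>e\<in>A. f e) = (\<Prod>i\<in>R. f (\<eta> i))" if "\<And>e. e \<notin> \<eta> ` R \<Longrightarrow> f e = 1" for f :: "'e \<Rightarrow> real"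
  proof -
    have "(\<Prod>e\<in>A. f e) = (\<Prod>e\<in>\<eta> ` R. f e)"
      using assms that by (intro prod.mono_neutral_right) auto
    then show ?thesis using assms(2) by (simp add: prod.reindex)
  qed
  have g': "g' (\<eta> i) b = g i b" if "i \<in> R" for i b
    using that assms(2) by (simp add: g'_def the_inv_into_f_f)
  have "bexp p A (\<lambda>S. \<Prod>i\<in>R. g i (\<eta> i \<in> S)) = bexp p A (\<lambda>S. \<Prod>e\<in>A. g' e (e \<in> S))"
    by (intro bexp_cong, subst ext) (simp add: g'_def, simp add: g')
  also have "\<dots> = (\<Prod>e\<in>A. p * g' e True + (1 - p) * g' e False)"
    by (rule bexp_prod_coord[OF assms(1)])
  also have "\<dots> = (\<Prod>i\<in>R. p * g i True + (1 - p) * g i False)"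
    by (subst ext) (simp add: g'_def, simp add: g')
  finally show ?thesis .
qed

lemma power_le_fact_exp:
  fixes y :: real
  assumes "0 \<le> y"
  shows "y ^ n \<le> fact n * exp y"
proof -
  have s: "summable (\<lambda>n. y ^ n /\<^sub>R fact n)" by (rule summable_exp_generic)
  have "(\<Sum>i\<in>{n}. y ^ i /\<^sub>R fact i) \<le> exp y"
    unfolding exp_def using assms by (intro sum_le_suminf[OF s]) auto
  then show ?thesis by (simp add: field_simps)
qed

lemma fact_le_power_self: "(fact n :: real) \<le> real n ^ n"
  using fact_le_power[of n, where ?'a = real] by simp

text \<open>The form is sub-Gaussian because exponential moments multiply over independent
  coordinates. A single term of the exponential series then converts the exponential moment into a
  power moment.\<close>

lemma linear_moment:
  fixes a :: "'i \<Rightarrow> real"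
  assumes p: "0 < p" "p \<le> 1" and A: "finite A" "inj_on \<eta> R" "\<eta> ` R \<subseteq> A" and r: "1 \<le> r"
  shows "bexp p A (\<lambda>S. (\<Sum>i\<in>R. a i * xi p (\<eta> i) S) ^ (2 * r))
    \<le> (120 * real r * (\<Sum>i\<in>R. (a i)\<^sup>2) / ln (2 / p)) ^ r"
proof -
  define La where "La = ln (2 / p)"
  have La: "0 < La" using ln_two_div_ge[OF p] by (auto simp: La_def)
  define sg where "sg = (\<Sum>i\<in>R. (a i)\<^sup>2) / La"
  define X where "X S = (\<Sum>i\<in>R. a i * xi p (\<eta> i) S)" for S
  have fin: "finite R" using A finite_subset finite_imageD by metis
  have mgf: "bexp p A (\<lambda>S. exp (l * X S)) \<le> exp (5 * l\<^sup>2 * sg)" for l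
  proof -
    have "bexp p A (\<lambda>S. exp (l * X S))
        = bexp p A (\<lambda>S. \<Prod>i\<in>R. (\<lambda>i b. exp (l * a i * (of_bool b - p))) i (\<eta> i \<in> S))"
      by (intro bexp_cong) (simp add: X_def xi_def sum_distrib_left exp_sum[OF fin] mult.assoc)
    also have "\<dots> = (\<Prod>i\<in>R. p * exp (l * a i * (1 - p)) + (1 - p) * exp (l * a i * (- p)))"
      by (subst bexp_prod_inj[OF A]) simp
    also have "\<dots> \<le> (\<Prod>i\<in>R. exp (5 * (l * a i)\<^sup>2 / La))"
      using p bernoulli_mgf[OF p] by (intro prod_mono) (auto simp: La_def)
    also have "\<dots> = exp (5 * l\<^sup>2 * sg)"
      by (simp add: exp_sum[OF fin, symmetric] sg_def sum_distrib_left sum_divide_distrib power_mult_distrib mult.assoc)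
    finally show ?thesis .
  qed
  have sg0: "0 \<le> sg" using La by (simp add: sg_def sum_nonneg)
  show ?thesis
  proof (cases "sg = 0")
    case True
    then have "\<forall>i\<in>R. a i = 0"
      using La fin by (auto simp: sg_def sum_nonneg_eq_0_iff)
    then have "bexp p A (\<lambda>S. (\<Sum>i\<in>R. a i * xi p (\<eta> i) S) ^ (2 * r)) = bexp p A (\<lambda>S. 0)"
      using r by (intro bexp_cong) simp
    also have "\<dots> \<le> (120 * real r * (\<Sum>i\<in>R. (a i)\<^sup>2) / ln (2 / p)) ^ r"
      using A La by (simp add: La_def[symmetric] sum_nonneg)
    finally show ?thesis .
  next
    case False
    with sg0 have sg: "0 < sg" by simp
    \<comment> \<open>This choice makes the exponent \<open>5 * l\<^sup>2 * sg\<close> equal to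
      \<open>r\<close>. The constant 120 is \<open>4 * 5\<close> from
      \<open>(2 * r)\<^sup>2 / l\<^sup>2\<close> times the 6 that covers
      \<open>2 * exp 1 ^ r\<close>.\<close>
    define l where "l = sqrt (real r / (5 * sg))"
    have l0: "0 < l" using sg r by (simp add: l_def)
    have l2: "l\<^sup>2 = real r / (5 * sg)" using sg by (simp add: l_def)
    have pt: "X S ^ (2 * r) \<le> fact (2 * r) / l ^ (2 * r) * (exp (l * X S) + exp ((- l) * X S))" for S
    proof -
      have "(l * \<bar>X S\<bar>) ^ (2 * r) \<le> fact (2 * r) * exp (l * \<bar>X S\<bar>)"
        using l0 by (intro power_le_fact_exp) auto
      also have "exp (l * \<bar>X S\<bar>) \<le> exp (l * X S) + exp ((- l) * X S)"
        by (cases "0 \<le> X S") auto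
      finally have "l ^ (2 * r) * X S ^ (2 * r) \<le> fact (2 * r) * (exp (l * X S) + exp ((- l) * X S))"
        by (simp add: power_mult_distrib power_even_abs)
      then show ?thesis using l0 by (simp add: field_simps)
    qed
    have "bexp p A (\<lambda>S. X S ^ (2 * r))
      \<le> bexp p A (\<lambda>S. fact (2 * r) / l ^ (2 * r) * (exp (l * X S) + exp ((- l) * X S)))"
      using p by (intro bexp_mono pt) auto
    also have "\<dots> = fact (2 * r) / l ^ (2 * r) *
        (bexp p A (\<lambda>S. exp (l * X S)) + bexp p A (\<lambda>S. exp ((- l) * X S)))"
      unfolding bexp_cmult bexp_add ..
    also have "\<dots> \<le> fact (2 * r) / l ^ (2 * r) * (exp (5 * l\<^sup>2 * sg) + exp (5 * (- l)\<^sup>2 * sg))"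
      using l0 by (intro mult_left_mono add_mono mgf) auto
    also have "\<dots> = fact (2 * r) / (l\<^sup>2) ^ r * (2 * exp 1 ^ r)"
      using sg by (simp add: l2 power_mult exp_of_nat_mult[of r 1, symmetric])
    also have "\<dots> \<le> real (2 * r) ^ (2 * r) / (l\<^sup>2) ^ r * (2 ^ r * 3 ^ r)"
    proof (intro mult_mono divide_right_mono fact_le_power_self)
      show "(2::real) \<le> 2 ^ r" using r by (cases r) auto
      show "exp (1::real) ^ r \<le> 3 ^ r" using exp_le by (intro power_mono) auto
    qed auto
    also have "\<dots> = ((real (2 * r))\<^sup>2 / l\<^sup>2 * (2 * 3)) ^ r"
      by (simp only: power_mult power_mult_distrib power_divide)
    also have "(real (2 * r))\<^sup>2 / l\<^sup>2 * (2 * 3) = 120 * real r * sg"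
      unfolding l2 using r sg by (simp add: field_simps power2_eq_square)
    finally show ?thesis by (simp add: X_def sg_def La_def)
  qed
qed

lemma square_weight_moment:
  fixes g :: "'i \<Rightarrow> real"
  assumes p: "0 < p" "p \<le> 1" and A: "finite A" "inj_on \<eta> R" "\<eta> ` R \<subseteq> A" and s: "1 \<le> s"
    and g: "\<And>i. i \<in> R \<Longrightarrow> 0 \<le> g i" "\<And>i. i \<in> R \<Longrightarrow> g i \<le> w" and w: "0 \<le> w"
  shows "bexp p A (\<lambda>S. (\<Sum>i\<in>R. g i * (xi p (\<eta> i) S)\<^sup>2) ^ s)
    \<le> (81 * ((\<Sum>i\<in>R. g i) + real s * w) / ln (2 / p)) ^ s"
proof -
  define La where "La = ln (2 / p)"
  have La: "0 < La" using ln_two_div_ge[OF p] by (auto simp: La_def)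
  define X where "X S = (\<Sum>i\<in>R. g i * (xi p (\<eta> i) S)\<^sup>2)" for S
  have X0: "0 \<le> X S" for S using g by (auto simp: X_def intro!: sum_nonneg)
  have fin: "finite R" using A finite_subset finite_imageD by metis
  define G where "G = (\<Sum>i\<in>R. g i)"
  have G0: "0 \<le> G" using g by (auto simp: G_def intro!: sum_nonneg)
  have mgf: "bexp p A (\<lambda>S. exp (l * X S)) \<le> exp (4 * l * G / La)" if l: "0 \<le> l" "l * w \<le> La" for l
  proof -
    have "bexp p A (\<lambda>S. exp (l * X S))
        = bexp p A (\<lambda>S. \<Prod>i\<in>R. (\<lambda>i b. exp (l * g i * (of_bool b - p)\<^sup>2)) i (\<eta> i \<in> S))"
      by (intro bexp_cong) (simp add: X_def xi_def sum_distrib_left exp_sum[OF fin] mult.assoc)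
    also have "\<dots> = (\<Prod>i\<in>R. p * exp (l * g i * (1 - p)\<^sup>2) + (1 - p) * exp (l * g i * p\<^sup>2))"
      by (subst bexp_prod_inj[OF A]) simp
    also have "\<dots> \<le> (\<Prod>i\<in>R. exp (4 * (l * g i) / La))"
    proof (intro prod_mono conjI)
      fix i assume i: "i \<in> R"
      have "l * g i \<le> l * w" using g(2)[OF i] l by (intro mult_left_mono) auto
      then show "p * exp (l * g i * (1 - p)\<^sup>2) + (1 - p) * exp (l * g i * p\<^sup>2) \<le> exp (4 * (l * g i) / La)"
        using bernoulli_mgf_square[OF p, of "l * g i"] l g(1)[OF i] by (simp add: La_def)
    qed (use p in auto)
    also have "\<dots> = exp (4 * l * G / La)"
      by (simp add: exp_sum[OF fin, symmetric] G_def sum_distrib_left sum_divide_distrib mult.assoc)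
    finally show ?thesis .
  qed
  define H where "H = G + real s * w"
  have H0: "0 \<le> H" using G0 w by (simp add: H_def)
  show ?thesis
  proof (cases "H = 0")
    case True
    then have "G = 0" using G0 w by (simp add: H_def add_nonneg_eq_0_iff)
    then have "\<forall>i\<in>R. g i = 0"
      using fin g by (auto simp: G_def sum_nonneg_eq_0_iff)
    then have "bexp p A (\<lambda>S. (\<Sum>i\<in>R. g i * (xi p (\<eta> i) S)\<^sup>2) ^ s) = bexp p A (\<lambda>S. 0)"
      using s by (intro bexp_cong) simp
    then show ?thesis using True A s by (simp add: H_def G_def)
  next
    case False
    with H0 have H: "0 < H" by simp
    \<comment> \<open>Since \<open>H\<close> is at least \<open>s * w\<close>, every
      \<open>l * g i\<close> stays in the range where the bound for the square is valid; since
      \<open>H\<close> is at least \<open>G\<close>, the exponent is at most \<open>4 * s\<close>,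
      whence \<open>81 = 3 ^ 4\<close>.\<close>
    define l where "l = La * real s / H"
    have l0: "0 < l" using H La s by (simp add: l_def)
    have lw: "l * w \<le> La"
    proof -
      have "real s * w \<le> H" using G0 by (simp add: H_def)
      then have "La * (real s * w) \<le> La * H" using La by (intro mult_left_mono) auto
      then show ?thesis using H by (simp add: l_def field_simps)
    qed
    have lG: "4 * l * G / La \<le> real s * 4"
    proof -
      have "real s * G \<le> real s * H" using w by (intro mult_left_mono) (auto simp: H_def)
      then show ?thesis using H La by (simp add: l_def field_simps)
    qed
    have pt: "X S ^ s \<le> fact s / l ^ s * exp (l * X S)" for S
    proof -
      have "(l * X S) ^ s \<le> fact s * exp (l * X S)"
        using l0 X0 by (intro power_le_fact_exp) auto
      then show ?thesis using l0 by (simp add: field_simps)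
    qed
    have "bexp p A (\<lambda>S. X S ^ s) \<le> bexp p A (\<lambda>S. fact s / l ^ s * exp (l * X S))"
      using p by (intro bexp_mono pt) auto
    also have "\<dots> = fact s / l ^ s * bexp p A (\<lambda>S. exp (l * X S))"
      by (rule bexp_cmult)
    also have "\<dots> \<le> fact s / l ^ s * exp (real s * 4)"
      using l0 lw lG by (intro mult_left_mono order_trans[OF mgf]) auto
    also have "\<dots> \<le> real s ^ s / l ^ s * 81 ^ s"
    proof (intro mult_mono divide_right_mono fact_le_power_self)
      have "exp (4::real) = exp 1 ^ 4" by (simp add: exp_of_nat_mult[symmetric])
      also have "\<dots> \<le> 3 ^ 4" using exp_le by (intro power_mono) auto
      finally show "exp (real s * 4) \<le> 81 ^ s"
        unfolding exp_of_nat_mult by (intro power_mono) auto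
    qed (use l0 in auto)
    also have "\<dots> = (real s / l * 81) ^ s"
      by (simp only: power_mult_distrib power_divide)
    also have "real s / l * 81 = 81 * H / La"
      using s H La by (simp add: l_def field_simps)
    finally show ?thesis by (simp add: X_def H_def G_def La_def)
  qed
qed

section \<open>Conditioning, decoupling and quadratic forms\<close>

lemma bexp_swap: "bexp p A (\<lambda>S. bexp q B (\<lambda>T. F S T)) = bexp q B (\<lambda>T. bexp p A (\<lambda>S. F S T))"
proof -
  have "bexp p A (\<lambda>S. bexp q B (\<lambda>T. F S T)) =
      (\<Sum>T\<in>Pow B. bexp p A (\<lambda>S. q ^ card T * (1 - q) ^ card (B - T) * F S T))"
    unfolding bexp_def[of q B] by (rule bexp_sum)
  then show ?thesis by (simp add: bexp_cmult bexp_def[of q B])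
qed

lemma power_sum_le_sum_power:
  fixes x y :: real
  assumes "0 \<le> x" "0 \<le> y" "1 \<le> n"
  shows "x ^ n + y ^ n \<le> (x + y) ^ n"
  using assms(3)
proof (induction n rule: dec_induct)
  case (step n)
  have "x ^ Suc n + y ^ Suc n \<le> (x + y) * (x ^ n + y ^ n)"
    using assms by (simp add: algebra_simps)
  also have "\<dots> \<le> (x + y) * (x + y) ^ n"
    using step assms by (intro mult_left_mono) auto
  finally show ?case by simp
qed simp

text \<open>The coefficients may be random as long as they are determined by coordinates
  \<open>B\<close> disjoint from those of the noise: once \<open>B\<close> is frozen this is the
  bound for constant coefficients. Both the decoupled quadratic form and the telescoping terms of
  the trace have this shape.\<close>

lemma cond_linear_moment:
  assumes p: "0 < p" "p \<le> 1" and A: "finite A" "inj_on \<eta> R" "\<eta> ` R \<subseteq> A - B" "B \<subseteq> A" and r: "1 \<le> r"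
    and dep: "\<And>S i. S \<subseteq> A \<Longrightarrow> i \<in> R \<Longrightarrow> a S i = a (S \<inter> B) i"
  shows "bexp p A (\<lambda>S. (\<Sum>i\<in>R. a S i * xi p (\<eta> i) S) ^ (2 * r))
    \<le> bexp p A (\<lambda>S. (120 * real r * (\<Sum>i\<in>R. (a S i)\<^sup>2) / ln (2 / p)) ^ r)"
proof (rule bexp_cond_mono[OF A(1) A(4)])
  fix S assume S: "S \<subseteq> B"
  have a: "a (S \<union> T) i = a S i" if "T \<subseteq> A - B" "i \<in> R" for T i
  proof -
    have "S \<union> T \<subseteq> A" "(S \<union> T) \<inter> B = S \<inter> B" "S \<subseteq> A" using S that A by auto
    then show ?thesis using dep that(2) by metis
  qed
  have "bexp p (A - B) (\<lambda>T. (\<Sum>i\<in>R. a (S \<union> T) i * xi p (\<eta> i) (S \<union> T)) ^ (2 * r))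
      = bexp p (A - B) (\<lambda>T. (\<Sum>i\<in>R. a S i * xi p (\<eta> i) T) ^ (2 * r))"
    using S A(3) by (intro bexp_cong arg_cong[where f = "\<lambda>x. x ^ _"] sum.cong) (auto simp: a xi_def)
  also have "\<dots> \<le> (120 * real r * (\<Sum>i\<in>R. (a S i)\<^sup>2) / ln (2 / p)) ^ r"
    using A r by (intro linear_moment p) auto
  also have "\<dots> = bexp p (A - B) (\<lambda>T. (120 * real r * (\<Sum>i\<in>R. (a S i)\<^sup>2) / ln (2 / p)) ^ r)"
    using A by simp
  also have "\<dots> = bexp p (A - B) (\<lambda>T. (120 * real r * (\<Sum>i\<in>R. (a (S \<union> T) i)\<^sup>2) / ln (2 / p)) ^ r)"
    by (intro bexp_cong) (simp add: a)
  finally show "bexp p (A - B) (\<lambda>T. (\<Sum>i\<in>R. a (S \<union> T) i * xi p (\<eta> i) (S \<union> T)) ^ (2 * r))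
      \<le> bexp p (A - B) (\<lambda>T. (120 * real r * (\<Sum>i\<in>R. (a (S \<union> T) i)\<^sup>2) / ln (2 / p)) ^ r)" .
qed (use p in auto)

text \<open>The decoupling device: a uniformly random set separates two distinct indices, in a given
  order, with probability 1/4. This is why the off-diagonal part is 4 times an average of bilinear
  forms.\<close>

lemma bexp_half_separate:
  assumes "finite T" "i \<in> T" "j \<in> T"
  shows "bexp (1 / 2) T (\<lambda>U. of_bool (i \<in> U) * of_bool (j \<notin> U)) = of_bool (i \<noteq> j) / 4"
proof (cases "i = j")
  case True
  then have "(\<lambda>U. of_bool (i \<in> U) * of_bool (j \<notin> U) :: real) = (\<lambda>U. 0)" by auto
  then show ?thesis using assms True by simp
next
  case False
  define T' where "T' = T - {i, j}"
  have T: "T = insert i (insert j T')" "i \<notin> insert j T'" "j \<notin> T'" "finite T'"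
    using assms False by (auto simp: T'_def)
  have "bexp (1 / 2) T' (\<lambda>U. of_bool (i \<in> U) * of_bool (j \<notin> U)) = bexp (1 / 2) T' (\<lambda>U. 0)"
    using T by (intro bexp_cong) auto
  moreover have "bexp (1 / 2) T' (\<lambda>U. of_bool (j \<notin> U)) = bexp (1 / 2) T' (\<lambda>U. 1)"
    using T by (intro bexp_cong) auto
  moreover have "bexp (1 / 2) T' (\<lambda>U. of_bool (i \<in> U)) = bexp (1 / 2) T' (\<lambda>U. 0)"
    using T by (intro bexp_cong) auto
  ultimately show ?thesis using T False by (simp add: T(1) bexp_insert)
qed

text \<open>The off-diagonal part of the quadratic form is an average of forms bilinear in two disjoint
  sets of variables. Conditioning on one of the sets bounds such a form by the square root of the
  quantity to be estimated, so the maximum over all subfamilies bounds itself.\<close>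

lemma quadratic_moment:
  fixes b :: "'i \<Rightarrow> 'y \<Rightarrow> real"
  assumes p: "0 < p" "p \<le> 1" and A: "finite A" "inj_on \<eta> R" "\<eta> ` R \<subseteq> A" and r: "1 \<le> r"
    and om: "0 \<le> \<omega>" "\<And>z. (\<Sum>i\<in>R. (\<Sum>y\<in>Y. b i y * z y)\<^sup>2) \<le> \<omega> * (\<Sum>y\<in>Y. (z y)\<^sup>2)"
    and tau: "(\<Sum>i\<in>R. \<Sum>y\<in>Y. (b i y)\<^sup>2) \<le> \<tau>"
  shows "bexp p A (\<lambda>S. (\<Sum>y\<in>Y. (\<Sum>i\<in>R. xi p (\<eta> i) S * b i y)\<^sup>2) ^ (2 * r))
    \<le> (8500 * (\<tau> + real r * \<omega>) / ln (2 / p)) ^ (2 * r)"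
proof -
  define La where "La = ln (2 / p)"
  have La: "0 < La" using ln_two_div_ge[OF p] by (auto simp: La_def)
  have fin: "finite R" using A finite_subset finite_imageD by metis
  define v where "v T S = (\<Sum>y\<in>Y. (\<Sum>i\<in>T. xi p (\<eta> i) S * b i y)\<^sup>2)" for T S
  define g where "g i = (\<Sum>y\<in>Y. (b i y)\<^sup>2)" for i
  define c where "c U S j = (\<Sum>y\<in>Y. b j y * (\<Sum>i\<in>U. xi p (\<eta> i) S * b i y))" for U S j
  define x where "x T U S = (\<Sum>j\<in>T - U. c U S j * xi p (\<eta> j) S)" for T U S
  define h where "h T = bexp p A (\<lambda>S. v T S ^ (2 * r))" for T
  define H where "H = Max (h ` Pow R)"
  define \<kappa> where "\<kappa> = 120 * real r * \<omega> / La"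
  define D where "D = (81 * (\<tau> + real (2 * r) * \<omega>) / La) ^ (2 * r)"
  have v0: "0 \<le> v T S" for T S by (simp add: v_def sum_nonneg)
  have tau0: "0 \<le> \<tau>" using tau by (rule order_trans[rotated]) (simp add: sum_nonneg)
  have kap0: "0 \<le> \<kappa>" using om La by (simp add: \<kappa>_def)
  \<comment> \<open>The bound \<open>om\<close> is tested on the vector \<open>b i\<close> itself;
    keeping only row \<open>i\<close> on its left side gives
    \<open>(g i)\<^sup>2 \<le> \<omega> * g i\<close>.\<close>
  have g_le: "g i \<le> \<omega>" if "i \<in> R" for i
  proof (cases "g i = 0")
    case False
    have g0: "0 < g i" using False by (simp add: g_def sum_nonneg less_le)
    have "(g i)\<^sup>2 = (\<Sum>y\<in>Y. b i y * b i y)\<^sup>2" by (simp add: g_def power2_eq_square)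
    also have "\<dots> \<le> (\<Sum>i'\<in>R. (\<Sum>y\<in>Y. b i' y * b i y)\<^sup>2)"
      using that fin by (intro member_le_sum[where f = "\<lambda>i'. (\<Sum>y\<in>Y. b i' y * b i y)\<^sup>2"]) auto
    also have "\<dots> \<le> \<omega> * g i" using om(2)[of "b i"] by (simp add: g_def)
    finally show ?thesis using g0 by (simp add: power2_eq_square)
  qed (use om in simp)
  have h_le_H: "h T \<le> H" if "T \<subseteq> R" for T
    unfolding H_def using that fin by (intro Max_ge) auto
  have main: "h T \<le> 4 ^ r * D + (64 * \<kappa>) ^ (2 * r) / 2 + H / 2" if T: "T \<subseteq> R" for T
  proof -
    have finT: "finite T" using T fin finite_subset by auto
    have injT: "inj_on \<eta> T" "\<eta> ` T \<subseteq> A" using T A by (auto intro: inj_on_subset)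
    define diag where "diag S = (\<Sum>i\<in>T. g i * (xi p (\<eta> i) S)\<^sup>2)" for S
    have off: "v T S - diag S = 4 * bexp (1 / 2) T (\<lambda>U. x T U S)" for S
    proof -
      define w where "w i j = xi p (\<eta> i) S * xi p (\<eta> j) S * (\<Sum>y\<in>Y. b i y * b j y)" for i j
      have v_eq: "v T S = (\<Sum>i\<in>T. \<Sum>j\<in>T. w i j)"
      proof -
        have "v T S = (\<Sum>y\<in>Y. \<Sum>i\<in>T. \<Sum>j\<in>T. xi p (\<eta> i) S * b i y * (xi p (\<eta> j) S * b j y))"
          by (simp add: v_def power2_eq_square sum_product)
        also have "\<dots> = (\<Sum>i\<in>T. \<Sum>y\<in>Y. \<Sum>j\<in>T. xi p (\<eta> i) S * b i y * (xi p (\<eta> j) S * b j y))"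
          by (rule sum.swap)
        also have "\<dots> = (\<Sum>i\<in>T. \<Sum>j\<in>T. \<Sum>y\<in>Y. xi p (\<eta> i) S * b i y * (xi p (\<eta> j) S * b j y))"
          by (intro sum.cong refl sum.swap)
        finally show ?thesis by (simp add: w_def sum_distrib_left mult_ac)
      qed
      have diag_eq: "diag S = (\<Sum>i\<in>T. \<Sum>j\<in>T. of_bool (i = j) * w i j)"
      proof -
        have "(\<Sum>j\<in>T. of_bool (i = j) * w i j) = w i i" if "i \<in> T" for i
        proof -
          have "(\<Sum>j\<in>T. of_bool (i = j) * w i j) = (\<Sum>j\<in>T. if i = j then w i j else 0)"
            by (intro sum.cong) auto
          then show ?thesis using finT that by simp
        qed
        then show ?thesis
          by (simp add: diag_def g_def w_def power2_eq_square sum_distrib_left mult_ac)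
      qed
      have x_eq: "x T U S = (\<Sum>i\<in>T. \<Sum>j\<in>T. w i j * (of_bool (i \<in> U) * of_bool (j \<notin> U)))" if "U \<subseteq> T" for U
      proof -
        have c_eq: "c U S j * xi p (\<eta> j) S = (\<Sum>i\<in>U. w i j)" for j
        proof -
          have "c U S j * xi p (\<eta> j) S = (\<Sum>y\<in>Y. \<Sum>i\<in>U. xi p (\<eta> i) S * xi p (\<eta> j) S * (b i y * b j y))"
            by (simp add: c_def sum_distrib_left sum_distrib_right mult_ac)
          also have "\<dots> = (\<Sum>i\<in>U. \<Sum>y\<in>Y. xi p (\<eta> i) S * xi p (\<eta> j) S * (b i y * b j y))"
            by (rule sum.swap)
          finally show ?thesis by (simp add: w_def sum_distrib_left)
        qed
        have "x T U S = (\<Sum>j\<in>T - U. \<Sum>i\<in>U. w i j)"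
          by (simp add: x_def c_eq)
        also have "\<dots> = (\<Sum>i\<in>U. \<Sum>j\<in>T - U. w i j)" by (rule sum.swap)
        also have "\<dots> = (\<Sum>i\<in>T. if i \<in> U then (\<Sum>j\<in>T. if j \<notin> U then w i j else 0) else 0)"
        proof -
          have "(\<Sum>i\<in>T. if i \<in> U then f i else 0) = (\<Sum>i\<in>U. f i)" for f :: "'i \<Rightarrow> real"
            using that finT by (simp add: sum.If_cases Int_absorb1)
          moreover have "(\<Sum>j\<in>T. if j \<notin> U then f j else 0) = (\<Sum>j\<in>T - U. f j)" for f :: "'i \<Rightarrow> real"
            using finT by (simp add: sum.If_cases Diff_eq Collect_neg_eq)
          ultimately show ?thesis by simp
        qed
        also have "\<dots> = (\<Sum>i\<in>T. \<Sum>j\<in>T. w i j * (of_bool (i \<in> U) * of_bool (j \<notin> U)))"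
          by (intro sum.cong refl) (auto intro!: sum.cong)
        finally show ?thesis .
      qed
      have "bexp (1 / 2) T (\<lambda>U. x T U S)
          = bexp (1 / 2) T (\<lambda>U. \<Sum>i\<in>T. \<Sum>j\<in>T. w i j * (of_bool (i \<in> U) * of_bool (j \<notin> U)))"
        by (intro bexp_cong x_eq)
      also have "\<dots> = (\<Sum>i\<in>T. \<Sum>j\<in>T. w i j * (of_bool (i \<noteq> j) / 4))"
        unfolding bexp_sum bexp_cmult by (intro sum.cong refl) (simp add: bexp_half_separate finT)
      finally have "4 * bexp (1 / 2) T (\<lambda>U. x T U S) = (\<Sum>i\<in>T. \<Sum>j\<in>T. of_bool (i \<noteq> j) * w i j)"
        by (simp add: sum_distrib_left mult_ac)
      also have "\<dots> = v T S - diag S"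
        unfolding v_eq diag_eq sum_subtractf[symmetric] by (intro sum.cong refl) auto
      finally show ?thesis by simp
    qed
    \<comment> \<open>The factor \<open>64 ^ r\<close> is \<open>4 ^ r\<close> from splitting off
      the diagonal times \<open>16 ^ r\<close> from the factor 4 in \<open>off\<close>.
      Conditionally on \<open>U\<close>, the coefficient \<open>c U S j\<close> is row
      \<open>j\<close> of \<open>b\<close> applied to a vector with squared norm
      \<open>v U S\<close>, so \<open>om\<close> applies once more.\<close>
    have xU: "64 ^ r * bexp p A (\<lambda>S. x T U S ^ (2 * r)) \<le> (64 * \<kappa>) ^ (2 * r) / 2 + H / 2" if U: "U \<subseteq> T" for U
    proof -
      have pt: "64 ^ r * (120 * real r * (\<Sum>j\<in>T - U. (c U S j)\<^sup>2) / La) ^ r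
          \<le> (64 * \<kappa>) ^ (2 * r) / 2 + v U S ^ (2 * r) / 2" for S
      proof -
        have "(\<Sum>j\<in>T - U. (c U S j)\<^sup>2) \<le> (\<Sum>j\<in>R. (c U S j)\<^sup>2)"
          using T fin by (intro sum_mono2) auto
        also have "\<dots> \<le> \<omega> * v U S"
          unfolding c_def v_def by (rule om(2))
        finally have "120 * real r * (\<Sum>j\<in>T - U. (c U S j)\<^sup>2) / La \<le> 120 * real r * (\<omega> * v U S) / La"
          using La by (intro divide_right_mono mult_left_mono) auto
        also have "\<dots> = \<kappa> * v U S" by (simp add: \<kappa>_def)
        finally have "(120 * real r * (\<Sum>j\<in>T - U. (c U S j)\<^sup>2) / La) ^ r \<le> (\<kappa> * v U S) ^ r"
          using La by (intro power_mono divide_nonneg_nonneg mult_nonneg_nonneg sum_nonneg) auto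
        then have "64 ^ r * (120 * real r * (\<Sum>j\<in>T - U. (c U S j)\<^sup>2) / La) ^ r \<le> 64 ^ r * (\<kappa> * v U S) ^ r"
          by (intro mult_left_mono) auto
        also have "\<dots> = (64 * \<kappa>) ^ r * v U S ^ r" by (simp add: power_mult_distrib)
        \<comment> \<open>This inequality leaves only half of \<open>v U S ^ (2 * r)\<close>, which
          is what permits \<open>H / 2\<close> to be absorbed into the maximum \<open>H\<close> at
          the end.\<close>
        also have "\<dots> \<le> ((64 * \<kappa>) ^ r)\<^sup>2 / 2 + (v U S ^ r)\<^sup>2 / 2"
          using sum_squares_bound[of "(64 * \<kappa>) ^ r" "v U S ^ r"] by simp
        also have "\<dots> = (64 * \<kappa>) ^ (2 * r) / 2 + v U S ^ (2 * r) / 2"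
          by (simp only: power_even_eq)
        finally show ?thesis .
      qed
      have "bexp p A (\<lambda>S. x T U S ^ (2 * r))
        \<le> bexp p A (\<lambda>S. (120 * real r * (\<Sum>j\<in>T - U. (c U S j)\<^sup>2) / ln (2 / p)) ^ r)"
        unfolding x_def
      proof (rule cond_linear_moment[OF p A(1) _ _ _ r, where B = "\<eta> ` U"])
        show "inj_on \<eta> (T - U)" using injT(1) by (rule inj_on_subset) auto
        show "\<eta> ` (T - U) \<subseteq> A - \<eta> ` U" using injT U by (auto dest: inj_onD[OF injT(1)])
        show "\<eta> ` U \<subseteq> A" using U injT by auto
        show "c U S j = c U (S \<inter> \<eta> ` U) j" for S j
          unfolding c_def xi_def by (intro sum.cong refl arg_cong2[where f = "(*)"]) auto
      qed
      then have "64 ^ r * bexp p A (\<lambda>S. x T U S ^ (2 * r))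
        \<le> 64 ^ r * bexp p A (\<lambda>S. (120 * real r * (\<Sum>j\<in>T - U. (c U S j)\<^sup>2) / ln (2 / p)) ^ r)"
        by (intro mult_left_mono) auto
      also have "\<dots> \<le> bexp p A (\<lambda>S. (64 * \<kappa>) ^ (2 * r) / 2 + v U S ^ (2 * r) / 2)"
        unfolding bexp_cmult[symmetric] using p pt by (intro bexp_mono) (auto simp: La_def)
      also have "\<dots> = (64 * \<kappa>) ^ (2 * r) / 2 + h U / 2"
        using A bexp_cmult[of p A "1 / 2" "\<lambda>S. v U S ^ (2 * r)"] by (simp add: bexp_add h_def)
      finally have "64 ^ r * bexp p A (\<lambda>S. x T U S ^ (2 * r)) \<le> (64 * \<kappa>) ^ (2 * r) / 2 + h U / 2" .
      moreover have "h U \<le> H" using U T by (intro h_le_H) auto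
      ultimately show ?thesis by linarith
    qed
    have D: "bexp p A (\<lambda>S. diag S ^ (2 * r)) \<le> D"
    proof -
      have "bexp p A (\<lambda>S. diag S ^ (2 * r))
          \<le> (81 * ((\<Sum>i\<in>T. g i) + real (2 * r) * \<omega>) / ln (2 / p)) ^ (2 * r)"
        unfolding diag_def
        using r om g_le T by (intro square_weight_moment p A(1) injT) (auto simp: g_def sum_nonneg)
      also have "\<dots> \<le> D"
      proof -
        have "(\<Sum>i\<in>T. g i) \<le> (\<Sum>i\<in>R. g i)"
          using T fin by (intro sum_mono2) (auto simp: g_def sum_nonneg)
        also have "\<dots> \<le> \<tau>" using tau by (simp add: g_def)
        finally show ?thesis unfolding D_def La_def[symmetric] using La om
          by (intro power_mono divide_right_mono mult_left_mono add_mono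
              divide_nonneg_nonneg mult_nonneg_nonneg add_nonneg_nonneg) (auto simp: g_def sum_nonneg)
      qed
      finally show ?thesis .
    qed
    have pt: "v T S ^ (2 * r) \<le> 4 ^ r * diag S ^ (2 * r) + bexp (1 / 2) T (\<lambda>U. 64 ^ r * x T U S ^ (2 * r))" for S
    proof -
      have "v T S ^ (2 * r) \<le> 2 ^ (2 * r) * (diag S ^ (2 * r) + (v T S - diag S) ^ (2 * r))"
        using add_power_even_le[of "2 * r" "diag S" "v T S - diag S"] by simp
      also have "(v T S - diag S) ^ (2 * r) = 16 ^ r * bexp (1 / 2) T (\<lambda>U. x T U S) ^ (2 * r)"
        unfolding off power_mult_distrib by (simp add: power_mult)
      also have "\<dots> \<le> 16 ^ r * bexp (1 / 2) T (\<lambda>U. x T U S ^ (2 * r))"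
        using finT by (intro mult_left_mono bexp_jensen_even) auto
      finally have "v T S ^ (2 * r) \<le> 2 ^ (2 * r) * (diag S ^ (2 * r) + 16 ^ r * bexp (1 / 2) T (\<lambda>U. x T U S ^ (2 * r)))"
        by simp
      also have "\<dots> = 4 ^ r * diag S ^ (2 * r) + 64 ^ r * bexp (1 / 2) T (\<lambda>U. x T U S ^ (2 * r))"
      proof -
        have "(2::real) ^ (2 * r) = 4 ^ r" by (simp add: power_mult)
        moreover have "(64::real) ^ r = 4 ^ r * 16 ^ r" by (simp flip: power_mult_distrib)
        ultimately show ?thesis by (simp add: distrib_left)
      qed
      finally show ?thesis by (simp add: bexp_cmult)
    qed
    have "h T \<le> bexp p A (\<lambda>S. 4 ^ r * diag S ^ (2 * r) + bexp (1 / 2) T (\<lambda>U. 64 ^ r * x T U S ^ (2 * r)))"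
      unfolding h_def using p pt by (intro bexp_mono) auto
    also have "\<dots> = 4 ^ r * bexp p A (\<lambda>S. diag S ^ (2 * r))
        + bexp (1 / 2) T (\<lambda>U. 64 ^ r * bexp p A (\<lambda>S. x T U S ^ (2 * r)))"
      unfolding bexp_add bexp_swap[of p A "1 / 2" T] bexp_cmult ..
    also have "\<dots> \<le> 4 ^ r * D + bexp (1 / 2) T (\<lambda>U. (64 * \<kappa>) ^ (2 * r) / 2 + H / 2)"
      using D xU by (intro add_mono mult_left_mono bexp_mono) auto
    also have "\<dots> = 4 ^ r * D + (64 * \<kappa>) ^ (2 * r) / 2 + H / 2"
      using finT by simp
    finally show ?thesis .
  qed
  have "H \<in> h ` Pow R" unfolding H_def using fin by (intro Max_in) auto
  then obtain T where "T \<subseteq> R" "H = h T" by auto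
  with main[of T] have "H \<le> 4 ^ r * D + (64 * \<kappa>) ^ (2 * r) / 2 + H / 2" by simp
  then have H: "H \<le> 2 * 4 ^ r * D + (64 * \<kappa>) ^ (2 * r)" by simp
  define W where "W = (\<tau> + real r * \<omega>) / La"
  have W0: "0 \<le> W" using tau0 om La by (simp add: W_def)
  have "h R \<le> 2 * 4 ^ r * D + (64 * \<kappa>) ^ (2 * r)" using H h_le_H[of R] by simp
  \<comment> \<open>Here \<open>648 = 2 * 4 * 81\<close> and \<open>7680 = 64 * 120\<close>; their
    sum 8328 is rounded up to 8500.\<close>
  also have "\<dots> \<le> (648 * W) ^ (2 * r) + (7680 * W) ^ (2 * r)"
  proof (intro add_mono)
    have "(2::real) * 4 ^ r \<le> 4 ^ r * 4 ^ r"
    proof (intro mult_right_mono)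
      have "(2::real) \<le> 4 ^ 1" by simp
      also have "\<dots> \<le> 4 ^ r" using r by (intro power_increasing) auto
      finally show "(2::real) \<le> 4 ^ r" .
    qed auto
    also have "\<dots> = 4 ^ (2 * r)" by (simp add: power_add[symmetric] mult_2)
    finally have "2 * 4 ^ r * D \<le> 4 ^ (2 * r) * D"
      by (intro mult_right_mono) (auto simp: D_def)
    also have "\<dots> = (324 * (\<tau> + real (2 * r) * \<omega>) / La) ^ (2 * r)"
      unfolding D_def power_mult_distrib[symmetric] by (simp add: mult_ac)
    also have "\<dots> \<le> (648 * W) ^ (2 * r)"
    proof (intro power_mono)
      have "324 * (\<tau> + real (2 * r) * \<omega>) \<le> 648 * (\<tau> + real r * \<omega>)"
        using tau0 by (simp add: algebra_simps)
      then show "324 * (\<tau> + real (2 * r) * \<omega>) / La \<le> 648 * W"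
        using La by (simp add: W_def divide_right_mono)
      show "0 \<le> 324 * (\<tau> + real (2 * r) * \<omega>) / La"
        using tau0 om La by (intro divide_nonneg_nonneg mult_nonneg_nonneg add_nonneg_nonneg) auto
    qed
    finally show "2 * 4 ^ r * D \<le> (648 * W) ^ (2 * r)" .
    have "64 * \<kappa> \<le> 7680 * W"
      using tau0 La by (simp add: \<kappa>_def W_def field_simps)
    then show "(64 * \<kappa>) ^ (2 * r) \<le> (7680 * W) ^ (2 * r)"
      using kap0 by (intro power_mono) auto
  qed
  also have "\<dots> \<le> (648 * W + 7680 * W) ^ (2 * r)"
    using W0 r by (intro power_sum_le_sum_power) auto
  also have "\<dots> \<le> (8500 * W) ^ (2 * r)"
    using W0 by (intro power_mono) auto
  finally show ?thesis by (simp add: h_def v_def W_def La_def)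
qed

section \<open>Matrix norms\<close>

type_synonym 'v mat = "'v \<Rightarrow> 'v \<Rightarrow> real"

definition vmul :: "'v set \<Rightarrow> ('v \<Rightarrow> real) \<Rightarrow> 'v mat \<Rightarrow> 'v \<Rightarrow> real" where
  "vmul V x A b = (\<Sum>a\<in>V. x a * A a b)"

definition mmul :: "'v set \<Rightarrow> 'v mat \<Rightarrow> 'v mat \<Rightarrow> 'v mat" where
  "mmul V A B a b = (\<Sum>c\<in>V. A a c * B c b)"

definition hs_norm :: "'v set \<Rightarrow> 'v mat \<Rightarrow> real" where
  "hs_norm V A = L2_set (\<lambda>(a, b). A a b) (V \<times> V)"

text \<open>A predicate on upper bounds, so that random quantities with accessible moments can stand
  for the operator norm. Vectors act as rows from the left, which matches products that grow by
  appending a factor on the right.\<close>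

definition op_bound :: "'v set \<Rightarrow> 'v mat \<Rightarrow> real \<Rightarrow> bool" where
  "op_bound V A \<rho> \<longleftrightarrow> 0 \<le> \<rho> \<and> (\<forall>x. L2_set (vmul V x A) V \<le> \<rho> * L2_set x V)"

lemma L2_set_square: "(L2_set f A)\<^sup>2 = (\<Sum>i\<in>A. (f i)\<^sup>2)"
  by (simp add: L2_set_def sum_nonneg)

lemma hs_norm_square: "(hs_norm V A)\<^sup>2 = (\<Sum>a\<in>V. \<Sum>b\<in>V. (A a b)\<^sup>2)"
  by (simp add: hs_norm_def L2_set_square sum.cartesian_product case_prod_unfold)

lemma hs_norm_nonneg [simp]: "0 \<le> hs_norm V A"
  by (simp add: hs_norm_def L2_set_nonneg)

lemma hs_norm_triangle: "hs_norm V (\<lambda>a b. A a b + B a b) \<le> hs_norm V A + hs_norm V B"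
  unfolding hs_norm_def
  using L2_set_triangle_ineq[of "\<lambda>(a, b). A a b" "\<lambda>(a, b). B a b" "V \<times> V"]
  by (simp add: case_prod_unfold)

lemma hs_norm_cong: "(\<And>a b. a \<in> V \<Longrightarrow> b \<in> V \<Longrightarrow> A a b = B a b) \<Longrightarrow> hs_norm V A = hs_norm V B"
  unfolding hs_norm_def by (intro L2_set_cong) auto

lemma hs_norm_le_const:
  assumes "finite V" "\<And>a b. a \<in> V \<Longrightarrow> b \<in> V \<Longrightarrow> \<bar>A a b\<bar> \<le> c" "0 \<le> c"
  shows "hs_norm V A \<le> c * real (card V)"
proof (rule power2_le_imp_le)
  have "(hs_norm V A)\<^sup>2 \<le> (\<Sum>a\<in>V. \<Sum>b\<in>V. c\<^sup>2)"
    unfolding hs_norm_square using assms by (intro sum_mono) (metis abs_le_square_iff abs_of_nonneg)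
  then show "(hs_norm V A)\<^sup>2 \<le> (c * real (card V))\<^sup>2"
    by (simp add: power2_eq_square mult_ac)
qed (use assms in auto)

lemma op_bound_square:
  assumes "op_bound V A \<rho>"
  shows "(\<Sum>b\<in>V. (vmul V x A b)\<^sup>2) \<le> \<rho>\<^sup>2 * (\<Sum>a\<in>V. (x a)\<^sup>2)"
proof -
  have "(L2_set (vmul V x A) V)\<^sup>2 \<le> (\<rho> * L2_set x V)\<^sup>2"
    using assms by (intro power_mono) (auto simp: op_bound_def L2_set_nonneg)
  then show ?thesis by (simp add: L2_set_square power_mult_distrib)
qed

lemma op_boundI:
  assumes "0 \<le> \<rho>" "\<And>x. (\<Sum>b\<in>V. (vmul V x A b)\<^sup>2) \<le> \<rho>\<^sup>2 * (\<Sum>a\<in>V. (x a)\<^sup>2)"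
  shows "op_bound V A \<rho>"
  unfolding op_bound_def
proof (intro conjI allI)
  fix x
  show "L2_set (vmul V x A) V \<le> \<rho> * L2_set x V"
    using assms(2)[of x] assms(1) by (rule_tac power2_le_imp_le) (auto simp: L2_set_square power_mult_distrib L2_set_nonneg)
qed (fact assms)

lemma op_bound_bilinear:
  assumes "op_bound V A \<rho>"
  shows "(\<Sum>b\<in>V. vmul V x A b * y b) \<le> \<rho> * L2_set x V * L2_set y V"
proof -
  have "(\<Sum>b\<in>V. vmul V x A b * y b) \<le> (\<Sum>b\<in>V. \<bar>vmul V x A b\<bar> * \<bar>y b\<bar>)"
    by (intro sum_mono) (simp add: abs_mult[symmetric])
  also have "\<dots> \<le> L2_set (vmul V x A) V * L2_set y V" by (rule L2_set_mult_ineq)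
  also have "\<dots> \<le> \<rho> * L2_set x V * L2_set y V"
    using assms by (intro mult_right_mono) (auto simp: op_bound_def L2_set_nonneg)
  finally show ?thesis .
qed

lemma op_bound_hs_norm: "op_bound V A (hs_norm V A)"
proof (rule op_boundI)
  fix x
  have "(\<Sum>b\<in>V. (vmul V x A b)\<^sup>2) \<le> (\<Sum>b\<in>V. (\<Sum>a\<in>V. (x a)\<^sup>2) * (\<Sum>a\<in>V. (A a b)\<^sup>2))"
    unfolding vmul_def by (intro sum_mono Cauchy_Schwarz_ineq_sum)
  also have "\<dots> = (\<Sum>a\<in>V. (x a)\<^sup>2) * (hs_norm V A)\<^sup>2"
    unfolding hs_norm_square sum_distrib_left[symmetric] by (subst sum.swap) simp
  finally show "(\<Sum>b\<in>V. (vmul V x A b)\<^sup>2) \<le> (hs_norm V A)\<^sup>2 * (\<Sum>a\<in>V. (x a)\<^sup>2)"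
    by (simp add: mult.commute)
qed simp

lemma op_bound_mono: "op_bound V A \<rho> \<Longrightarrow> \<rho> \<le> \<sigma> \<Longrightarrow> op_bound V A \<sigma>"
  unfolding op_bound_def by (meson L2_set_nonneg mult_right_mono order_trans)

lemma op_bound_add:
  assumes "op_bound V A \<rho>" "op_bound V B \<sigma>"
  shows "op_bound V (\<lambda>a b. A a b + B a b) (\<rho> + \<sigma>)"
  unfolding op_bound_def
proof (intro conjI allI)
  fix x
  have "vmul V x (\<lambda>a b. A a b + B a b) = (\<lambda>b. vmul V x A b + vmul V x B b)"
    by (auto simp: vmul_def distrib_left sum.distrib)
  then have "L2_set (vmul V x (\<lambda>a b. A a b + B a b)) V \<le> L2_set (vmul V x A) V + L2_set (vmul V x B) V"
    by (simp add: L2_set_triangle_ineq)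
  also have "\<dots> \<le> \<rho> * L2_set x V + \<sigma> * L2_set x V"
    using assms by (intro add_mono) (auto simp: op_bound_def)
  finally show "L2_set (vmul V x (\<lambda>a b. A a b + B a b)) V \<le> (\<rho> + \<sigma>) * L2_set x V"
    by (simp add: distrib_right)
qed (use assms in \<open>auto simp: op_bound_def\<close>)

lemma vmul_mmul: "vmul V x (mmul V A B) b = vmul V (vmul V x A) B b"
proof -
  have "vmul V x (mmul V A B) b = (\<Sum>a\<in>V. \<Sum>c\<in>V. x a * A a c * B c b)"
    by (simp add: vmul_def mmul_def sum_distrib_left mult.assoc)
  also have "\<dots> = (\<Sum>c\<in>V. \<Sum>a\<in>V. x a * A a c * B c b)" by (rule sum.swap)
  finally show ?thesis by (simp add: vmul_def sum_distrib_right)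
qed

lemma op_bound_mmul:
  assumes "op_bound V A \<rho>" "op_bound V B \<sigma>"
  shows "op_bound V (mmul V A B) (\<rho> * \<sigma>)"
  unfolding op_bound_def
proof (intro conjI allI)
  fix x
  have "L2_set (vmul V x (mmul V A B)) V = L2_set (vmul V (vmul V x A) B) V"
    by (simp add: vmul_mmul[abs_def])
  also have "\<dots> \<le> \<sigma> * L2_set (vmul V x A) V"
    using assms(2) by (simp add: op_bound_def)
  also have "\<dots> \<le> \<sigma> * (\<rho> * L2_set x V)"
    using assms by (intro mult_left_mono) (auto simp: op_bound_def)
  finally show "L2_set (vmul V x (mmul V A B)) V \<le> \<rho> * \<sigma> * L2_set x V"
    by (simp add: mult_ac)
qed (use assms in \<open>auto simp: op_bound_def\<close>)

lemma hs_norm_mmul_left: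
  assumes "op_bound V B \<rho>"
  shows "hs_norm V (mmul V A B) \<le> hs_norm V A * \<rho>"
proof (rule power2_le_imp_le)
  have "(hs_norm V (mmul V A B))\<^sup>2 = (\<Sum>a\<in>V. \<Sum>b\<in>V. (vmul V (A a) B b)\<^sup>2)"
    by (simp add: hs_norm_square mmul_def vmul_def)
  also have "\<dots> \<le> (\<Sum>a\<in>V. \<rho>\<^sup>2 * (\<Sum>c\<in>V. (A a c)\<^sup>2))"
    by (intro sum_mono op_bound_square assms)
  also have "\<dots> = (hs_norm V A * \<rho>)\<^sup>2"
    by (simp add: power_mult_distrib hs_norm_square sum_distrib_left mult.commute)
  finally show "(hs_norm V (mmul V A B))\<^sup>2 \<le> (hs_norm V A * \<rho>)\<^sup>2" .
qed (use assms in \<open>auto simp: op_bound_def\<close>)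

text \<open>The transposed matrix has the same operator norm: the bilinear bound is tested with
  \<open>z\<close>, the image of \<open>y\<close>, and one factor \<open>L2_set z V\<close> is
  cancelled.\<close>

lemma op_bound_column:
  assumes "op_bound V A \<rho>"
  shows "(\<Sum>a\<in>V. (\<Sum>c\<in>V. A a c * y c)\<^sup>2) \<le> \<rho>\<^sup>2 * (\<Sum>c\<in>V. (y c)\<^sup>2)"
proof -
  define z where "z a = (\<Sum>c\<in>V. A a c * y c)" for a
  have "(L2_set z V)\<^sup>2 = (\<Sum>a\<in>V. \<Sum>c\<in>V. z a * A a c * y c)"
  proof -
    have "(z a)\<^sup>2 = (\<Sum>c\<in>V. z a * A a c * y c)" for a
      by (subst power2_eq_square, subst (2) z_def) (simp add: sum_distrib_left mult.assoc)
    then show ?thesis by (simp add: L2_set_square)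
  qed
  also have "\<dots> = (\<Sum>c\<in>V. vmul V z A c * y c)"
    unfolding vmul_def sum_distrib_right by (rule sum.swap)
  also have "\<dots> \<le> \<rho> * L2_set z V * L2_set y V" by (rule op_bound_bilinear[OF assms])
  finally have "L2_set z V * L2_set z V \<le> L2_set z V * (\<rho> * L2_set y V)"
    by (simp add: power2_eq_square mult_ac)
  moreover have "0 \<le> \<rho> * L2_set y V" using assms by (simp add: op_bound_def L2_set_nonneg)
  ultimately have "L2_set z V \<le> \<rho> * L2_set y V"
    by (cases "L2_set z V = 0") (auto simp: L2_set_nonneg less_le mult_le_cancel_left)
  then have "(L2_set z V)\<^sup>2 \<le> (\<rho> * L2_set y V)\<^sup>2"
    by (intro power_mono) (auto simp: L2_set_nonneg)
  then show ?thesis by (simp add: L2_set_square power_mult_distrib z_def)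
qed

lemma hs_norm_mmul_right:
  assumes "op_bound V A \<rho>"
  shows "hs_norm V (mmul V A B) \<le> \<rho> * hs_norm V B"
proof (rule power2_le_imp_le)
  have "(hs_norm V (mmul V A B))\<^sup>2 = (\<Sum>b\<in>V. \<Sum>a\<in>V. (\<Sum>c\<in>V. A a c * B c b)\<^sup>2)"
    unfolding hs_norm_square mmul_def by (rule sum.swap)
  also have "\<dots> \<le> (\<Sum>b\<in>V. \<rho>\<^sup>2 * (\<Sum>c\<in>V. (B c b)\<^sup>2))"
    by (intro sum_mono op_bound_column assms)
  also have "\<dots> = (\<rho> * hs_norm V B)\<^sup>2"
    unfolding power_mult_distrib hs_norm_square sum_distrib_left[symmetric] by (subst sum.swap) simp
  finally show "(hs_norm V (mmul V A B))\<^sup>2 \<le> (\<rho> * hs_norm V B)\<^sup>2" .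
qed (use assms in \<open>auto simp: op_bound_def\<close>)

section \<open>A lattice net for the operator norm\<close>

definition lattice_net :: "'v set \<Rightarrow> ('v \<Rightarrow> int) set" where
  "lattice_net V = {u \<in> V \<rightarrow>\<^sub>E {- 2 * int (card V)..2 * int (card V)}. (\<Sum>a\<in>V. (u a)\<^sup>2) \<le> 4 * int (card V)}"

lemma finite_lattice_net: "finite V \<Longrightarrow> finite (lattice_net V)"
  unfolding lattice_net_def by (rule finite_subset[of _ "V \<rightarrow>\<^sub>E {- 2 * int (card V)..2 * int (card V)}"])
    (auto intro: finite_PiE)

lemma sum_half_power_abs: "(\<Sum>z\<in>{- int N..int N}. (1 / 2 :: real) ^ nat \<bar>z\<bar>) = 3 - 2 * (1 / 2) ^ N"
proof (induction N)
  case (Suc N)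
  have "{- int (Suc N)..int (Suc N)} = insert (- int (Suc N)) (insert (int (Suc N)) {- int N..int N})"
    by auto
  moreover have "nat \<bar>- int (Suc N)\<bar> = Suc N" "nat \<bar>int (Suc N)\<bar> = Suc N" by auto
  moreover have "- int (Suc N) \<notin> insert (int (Suc N)) {- int N..int N}" "int (Suc N) \<notin> {- int N..int N}" by auto
  ultimately show ?case using Suc by (simp del: of_nat_Suc)
qed simp

text \<open>Counting by weights: for integers the sum of absolute values is at most the sum of
  squares, so each point of the net has weight at least \<open>(1 / 2) ^ (4 * card V)\<close> under
  the product of the weights \<open>(1 / 2) ^ nat \<bar>u a\<bar>\<close>, whereas the total weight
  is at most \<open>3 ^ card V\<close>. Hence \<open>48 = 3 * 2 ^ 4\<close>.\<close>

lemma card_lattice_net_le: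
  assumes V: "finite V"
  shows "real (card (lattice_net V)) \<le> 48 ^ card V"
proof -
  define n where "n = card V"
  define B where "B = {- int (2 * n)..int (2 * n)}"
  have "real (card (lattice_net V)) * (1 / 2) ^ (4 * n) = (\<Sum>u\<in>lattice_net V. (1 / 2) ^ (4 * n))" by simp
  also have "\<dots> \<le> (\<Sum>u\<in>lattice_net V. \<Prod>a\<in>V. (1 / 2) ^ nat \<bar>u a\<bar>)"
  proof (intro sum_mono)
    fix u assume u: "u \<in> lattice_net V"
    have "int (\<Sum>a\<in>V. nat \<bar>u a\<bar>) \<le> (\<Sum>a\<in>V. (u a)\<^sup>2)"
      unfolding of_nat_sum
    proof (intro sum_mono)
      fix a
      show "int (nat \<bar>u a\<bar>) \<le> (u a)\<^sup>2"
      proof (cases "u a = 0")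
        case False
        then have "\<bar>u a\<bar> * 1 \<le> \<bar>u a\<bar> * \<bar>u a\<bar>" by (intro mult_left_mono) auto
        then show ?thesis by (simp add: power2_eq_square)
      qed simp
    qed
    also have "\<dots> \<le> int (4 * n)" using u by (simp add: lattice_net_def n_def)
    finally have "(\<Sum>a\<in>V. nat \<bar>u a\<bar>) \<le> 4 * n" by linarith
    then have "(1 / 2 :: real) ^ (4 * n) \<le> (1 / 2) ^ (\<Sum>a\<in>V. nat \<bar>u a\<bar>)"
      by (intro power_decreasing) auto
    then show "(1 / 2 :: real) ^ (4 * n) \<le> (\<Prod>a\<in>V. (1 / 2) ^ nat \<bar>u a\<bar>)"
      by (simp add: power_sum)
  qed
  also have "\<dots> \<le> (\<Sum>u\<in>V \<rightarrow>\<^sub>E B. \<Prod>a\<in>V. (1 / 2) ^ nat \<bar>u a\<bar>)"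
    using V by (intro sum_mono2) (auto simp: lattice_net_def B_def n_def intro!: finite_PiE prod_nonneg)
  also have "\<dots> = (\<Prod>a\<in>V. \<Sum>z\<in>B. (1 / 2) ^ nat \<bar>z\<bar>)"
    using V by (subst prod_sum_PiE) (auto simp: B_def)
  also have "\<dots> \<le> (\<Prod>a\<in>V. 3)"
    unfolding B_def sum_half_power_abs by (intro prod_mono) (auto simp: power_le_one intro: order_trans[of "2 * (1/2) ^ (2 * n)" 2])
  finally have "real (card (lattice_net V)) * (1 / 2) ^ (4 * n) \<le> 3 ^ n" by (simp add: n_def)
  then have "real (card (lattice_net V)) \<le> 3 ^ n * 2 ^ (4 * n)"
    by (simp add: power_one_over field_simps)
  also have "\<dots> = 48 ^ n" by (simp add: power_mult power_mult_distrib[symmetric])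
  finally show ?thesis by (simp add: n_def)
qed

text \<open>A linear form on the box of points lying between the coordinatewise floor and ceiling of
  \<open>x\<close> is maximal at a vertex, so no approximation error arises.\<close>

lemma lattice_net_dominates:
  fixes x c :: "'v \<Rightarrow> real"
  assumes V: "finite V" and x: "(\<Sum>a\<in>V. (x a)\<^sup>2) \<le> real (card V)"
  obtains u where "u \<in> lattice_net V" "(\<Sum>a\<in>V. x a * c a) \<le> (\<Sum>a\<in>V. real_of_int (u a) * c a)"
proof
  define n where "n = card V"
  define u where "u = restrict (\<lambda>a. if 0 \<le> c a then \<lceil>x a\<rceil> else \<lfloor>x a\<rfloor>) V"
  have sq: "(real_of_int (u a))\<^sup>2 \<le> 2 * (x a)\<^sup>2 + 2" if "a \<in> V" for a
  proof -
    have "\<bar>real_of_int (u a)\<bar> \<le> \<bar>\<bar>x a\<bar> + 1\<bar>"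
      using that by (simp add: u_def) linarith
    then have "(real_of_int (u a))\<^sup>2 \<le> (\<bar>x a\<bar> + 1)\<^sup>2" by (rule abs_le_square_iff[THEN iffD1])
    also have "\<dots> \<le> 2 * (x a)\<^sup>2 + 2"
      using zero_le_power2[of "\<bar>x a\<bar> - 1"] by (simp add: power2_sum power2_diff)
    finally show ?thesis .
  qed
  have "real_of_int (\<Sum>a\<in>V. (u a)\<^sup>2) \<le> (\<Sum>a\<in>V. 2 * (x a)\<^sup>2 + 2)"
    using sq by (simp add: sum_mono)
  also have "\<dots> = 2 * (\<Sum>a\<in>V. (x a)\<^sup>2) + 2 * real n"
    by (simp add: sum.distrib sum_distrib_left n_def)
  also have "\<dots> \<le> 4 * real n" using x by (simp add: n_def)
  finally have sum4: "(\<Sum>a\<in>V. (u a)\<^sup>2) \<le> 4 * int n" by linarith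
  have "u a \<in> {- 2 * int n..2 * int n}" if "a \<in> V" for a
  proof -
    have "(u a)\<^sup>2 \<le> (\<Sum>a\<in>V. (u a)\<^sup>2)" using that V by (intro member_le_sum) auto
    also have "\<dots> \<le> 4 * int n" by (rule sum4)
    also have "\<dots> \<le> 4 * (int n * int n)" using le_square[of n] by (simp flip: of_nat_mult)
    finally have "(u a)\<^sup>2 \<le> (2 * int n)\<^sup>2" by (simp add: power2_eq_square)
    then have "\<bar>u a\<bar> \<le> \<bar>2 * int n\<bar>" by (simp only: abs_le_square_iff)
    then show ?thesis by auto
  qed
  then show "u \<in> lattice_net V"
    using sum4 by (auto simp: lattice_net_def n_def u_def PiE_def extensional_def)
  show "(\<Sum>a\<in>V. x a * c a) \<le> (\<Sum>a\<in>V. real_of_int (u a) * c a)"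
  proof (intro sum_mono)
    fix a assume "a \<in> V"
    then show "x a * c a \<le> real_of_int (u a) * c a"
      by (cases "0 \<le> c a") (auto simp: u_def intro: mult_right_mono mult_right_mono_neg)
  qed
qed

definition net_form :: "'v set \<Rightarrow> 'v mat \<Rightarrow> ('v \<Rightarrow> int) \<Rightarrow> ('v \<Rightarrow> int) \<Rightarrow> real" where
  "net_form V A u v = (\<Sum>a\<in>V. \<Sum>b\<in>V. real_of_int (u a) * A a b * real_of_int (v b))"

text \<open>The net stands for the ball of radius \<open>sqrt (card V)\<close> in both arguments, hence the division
  by \<open>card V\<close>.\<close>

definition net_norm :: "'v set \<Rightarrow> 'v mat \<Rightarrow> real" where
  "net_norm V A = Max ((\<lambda>(u, v). \<bar>net_form V A u v\<bar>) ` (lattice_net V \<times> lattice_net V)) / real (card V)"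

lemma zero_in_lattice_net: "restrict (\<lambda>_. 0) V \<in> lattice_net V"
  by (auto simp: lattice_net_def)

lemma net_form_le:
  assumes "finite V" "V \<noteq> {}" "u \<in> lattice_net V" "v \<in> lattice_net V"
  shows "\<bar>net_form V A u v\<bar> \<le> net_norm V A * real (card V)"
  using assms finite_lattice_net[of V] by (auto simp: net_norm_def card_gt_0_iff intro!: Max_ge)

lemma net_norm_nonneg: "finite V \<Longrightarrow> V \<noteq> {} \<Longrightarrow> 0 \<le> net_norm V A"
  using net_form_le[OF _ _ zero_in_lattice_net zero_in_lattice_net, of V A]
  by (auto simp: card_gt_0_iff zero_le_mult_iff dest: order_trans[OF abs_ge_zero])

text \<open>For fixed \<open>y\<close> the bilinear form is linear in \<open>x\<close>, so
  \<open>x\<close> may be replaced by a net point without decreasing it, and then \<open>y\<close>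
  likewise. Scaling passes from the ball of radius \<open>sqrt (card V)\<close> to all vectors, and
  \<open>y\<close> equal to the image of \<open>x\<close> yields the norm.\<close>

lemma op_bound_net_norm:
  assumes V: "finite V" "V \<noteq> {}"
  shows "op_bound V A (net_norm V A)"
proof -
  define n where "n = real (card V)"
  have n: "0 < n" using V by (simp add: n_def card_gt_0_iff)
  have core: "(\<Sum>a\<in>V. \<Sum>b\<in>V. x a * A a b * y b) \<le> net_norm V A * n"
    if x: "(\<Sum>a\<in>V. (x a)\<^sup>2) \<le> n" and y: "(\<Sum>a\<in>V. (y a)\<^sup>2) \<le> n" for x y
  proof -
    obtain u where u: "u \<in> lattice_net V" "(\<Sum>a\<in>V. x a * (\<Sum>b\<in>V. A a b * y b)) \<le> (\<Sum>a\<in>V. real_of_int (u a) * (\<Sum>b\<in>V. A a b * y b))"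
      using lattice_net_dominates[OF V(1), of x "\<lambda>a. \<Sum>b\<in>V. A a b * y b"] x by (auto simp: n_def)
    obtain v where v: "v \<in> lattice_net V" "(\<Sum>b\<in>V. y b * (\<Sum>a\<in>V. real_of_int (u a) * A a b)) \<le> (\<Sum>b\<in>V. real_of_int (v b) * (\<Sum>a\<in>V. real_of_int (u a) * A a b))"
      using lattice_net_dominates[OF V(1), of y "\<lambda>b. \<Sum>a\<in>V. real_of_int (u a) * A a b"] y by (auto simp: n_def)
    have sw: "(\<Sum>b\<in>V. f b * (\<Sum>a\<in>V. g a * A a b)) = (\<Sum>a\<in>V. \<Sum>b\<in>V. g a * A a b * f b)" for f g :: "'a \<Rightarrow> real"
      unfolding sum_distrib_left by (subst sum.swap) (simp add: mult_ac)
    have "(\<Sum>a\<in>V. \<Sum>b\<in>V. x a * A a b * y b) \<le> net_form V A u v"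
      using u(2) v(2) unfolding sw net_form_def by (simp add: sum_distrib_left mult.assoc)
    also have "\<dots> \<le> net_norm V A * n"
      using net_form_le[OF V u(1) v(1), of A] by (simp add: n_def)
    finally show ?thesis .
  qed
  have bil: "(\<Sum>a\<in>V. \<Sum>b\<in>V. x a * A a b * y b) \<le> net_norm V A * (L2_set x V * L2_set y V)" for x y
  proof (cases "L2_set x V = 0 \<or> L2_set y V = 0")
    case True
    then have "(\<forall>a\<in>V. x a = 0) \<or> (\<forall>a\<in>V. y a = 0)"
      using V by (auto simp: L2_set_eq_0_iff)
    then show ?thesis using True by auto
  next
    case False
    define s where "s = L2_set x V"
    define t where "t = L2_set y V"
    have st: "0 < s" "0 < t" using False by (auto simp: s_def t_def L2_set_nonneg less_le)
    have "(\<Sum>a\<in>V. (sqrt n * x a / s)\<^sup>2) = n / s\<^sup>2 * s\<^sup>2"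
      unfolding s_def L2_set_square using n by (simp add: power_mult_distrib power_divide sum_distrib_left L2_set_square)
    then have x1: "(\<Sum>a\<in>V. (sqrt n * x a / s)\<^sup>2) \<le> n" using st by simp
    have "(\<Sum>a\<in>V. (sqrt n * y a / t)\<^sup>2) = n / t\<^sup>2 * t\<^sup>2"
      unfolding t_def L2_set_square using n by (simp add: power_mult_distrib power_divide sum_distrib_left L2_set_square)
    then have y1: "(\<Sum>a\<in>V. (sqrt n * y a / t)\<^sup>2) \<le> n" using st by simp
    have "(\<Sum>a\<in>V. \<Sum>b\<in>V. (sqrt n * x a / s) * A a b * (sqrt n * y b / t)) \<le> net_norm V A * n"
      by (rule core[OF x1 y1])
    moreover have "(\<Sum>a\<in>V. \<Sum>b\<in>V. (sqrt n * x a / s) * A a b * (sqrt n * y b / t))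
        = n / (s * t) * (\<Sum>a\<in>V. \<Sum>b\<in>V. x a * A a b * y b)"
      using n st by (simp add: sum_distrib_left) (intro sum.cong refl, simp add: field_simps)
    ultimately have le: "n / (s * t) * (\<Sum>a\<in>V. \<Sum>b\<in>V. x a * A a b * y b) \<le> net_norm V A * n"
      by (simp only:)
    have scale: "T \<le> N * (s * t)" if "n / (s * t) * T \<le> N * n" for T N :: real
      using that n st by (simp add: field_simps)
    show ?thesis using scale[OF le] by (simp only: s_def t_def)
  qed
  show ?thesis
    unfolding op_bound_def
  proof (intro conjI allI net_norm_nonneg V)
    fix x
    define z where "z = vmul V x A"
    have "(L2_set z V)\<^sup>2 = (\<Sum>b\<in>V. \<Sum>a\<in>V. x a * A a b * z b)"
    proof -
      have "(z b)\<^sup>2 = (\<Sum>a\<in>V. x a * A a b * z b)" for b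
        by (subst power2_eq_square, subst (1) z_def) (simp add: vmul_def sum_distrib_right)
      then show ?thesis by (simp add: L2_set_square)
    qed
    also have "\<dots> = (\<Sum>a\<in>V. \<Sum>b\<in>V. x a * A a b * z b)" by (rule sum.swap)
    also have "\<dots> \<le> net_norm V A * (L2_set x V * L2_set z V)" by (rule bil)
    finally have "L2_set z V * L2_set z V \<le> L2_set z V * (net_norm V A * L2_set x V)"
      by (simp add: power2_eq_square mult_ac)
    moreover have "0 \<le> net_norm V A * L2_set x V" using net_norm_nonneg[OF V] by (simp add: L2_set_nonneg)
    ultimately show "L2_set (vmul V x A) V \<le> net_norm V A * L2_set x V"
      unfolding z_def[symmetric]
      by (cases "L2_set z V = 0") (auto simp: L2_set_nonneg less_le mult_le_cancel_left)
  qed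
qed

text \<open>The moment form of a union bound: a maximum of even powers is at most their sum.\<close>

lemma net_norm_power_le:
  assumes V: "finite V" "V \<noteq> {}"
  shows "net_norm V A ^ (2 * s) \<le> (\<Sum>u\<in>lattice_net V. \<Sum>v\<in>lattice_net V. net_form V A u v ^ (2 * s)) / real (card V) ^ (2 * s)"
proof -
  let ?I = "lattice_net V \<times> lattice_net V"
  have "Max ((\<lambda>(u, v). \<bar>net_form V A u v\<bar>) ` ?I) \<in> (\<lambda>(u, v). \<bar>net_form V A u v\<bar>) ` ?I"
    using zero_in_lattice_net[of V] finite_lattice_net[OF V(1)] by (intro Max_in) auto
  then obtain u v where uv: "u \<in> lattice_net V" "v \<in> lattice_net V"
    "Max ((\<lambda>(u, v). \<bar>net_form V A u v\<bar>) ` ?I) = \<bar>net_form V A u v\<bar>" by auto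
  have "net_form V A u v ^ (2 * s) \<le> (\<Sum>v\<in>lattice_net V. net_form V A u v ^ (2 * s))"
    using uv finite_lattice_net[OF V(1)]
    by (intro member_le_sum[where f = "\<lambda>v. net_form V A u v ^ (2 * s)"]) auto
  also have "\<dots> \<le> (\<Sum>u\<in>lattice_net V. \<Sum>v\<in>lattice_net V. net_form V A u v ^ (2 * s))"
    using uv finite_lattice_net[OF V(1)]
    by (intro member_le_sum[where f = "\<lambda>u. \<Sum>v\<in>lattice_net V. net_form V A u v ^ (2 * s)"])
      (auto intro!: sum_nonneg)
  finally show ?thesis
    unfolding net_norm_def uv(3) power_divide by (intro divide_right_mono) (auto simp: power_even_abs)
qed

section \<open>Moments of a noise matrix and of its products\<close>

definition noise :: "real \<Rightarrow> ('v \<times> 'v) set \<Rightarrow> ('v \<times> 'v \<Rightarrow> 'e) \<Rightarrow> 'e set \<Rightarrow> 'v mat" where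
  "noise p R \<eta> S a b = of_bool ((a, b) \<in> R) * xi p (\<eta> (a, b)) S"

lemma sum_rel:
  fixes f :: "'v \<Rightarrow> 'v \<Rightarrow> real"
  assumes "finite V" "R \<subseteq> V \<times> V"
  shows "(\<Sum>a\<in>V. \<Sum>b\<in>V. of_bool ((a, b) \<in> R) * f a b) = (\<Sum>(a, b)\<in>R. f a b)"
proof -
  have "(\<Sum>a\<in>V. \<Sum>b\<in>V. of_bool ((a, b) \<in> R) * f a b) = (\<Sum>e\<in>V \<times> V. of_bool (e \<in> R) * f (fst e) (snd e))"
    by (simp add: sum.cartesian_product case_prod_unfold)
  also have "\<dots> = (\<Sum>e\<in>R. of_bool (e \<in> R) * f (fst e) (snd e))"
    using assms by (intro sum.mono_neutral_right) auto
  finally show ?thesis by (simp add: case_prod_unfold)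
qed

text \<open>The union bound over pairs of net points costs \<open>2304 ^ card V\<close>, which is
  harmless only for moments of order at least \<open>card V\<close>. The estimate is therefore made
  at order \<open>2 * s\<close> with \<open>s = 2 * r + card V\<close> and transferred back to order
  \<open>4 * r\<close>.\<close>

lemma net_norm_moment:
  assumes p: "0 < p" "p \<le> 1" and A: "finite A" "inj_on \<eta> R" "\<eta> ` R \<subseteq> A"
    and V: "finite V" "V \<noteq> {}" "R \<subseteq> V \<times> V" and r: "1 \<le> r"
  shows "bexp p A (\<lambda>S. net_norm V (noise p R \<eta> S) ^ (4 * r))
    \<le> (20000000 * (real (card V) + real r) / ln (2 / p)) ^ (2 * r)"
proof -
  define n where "n = card V"
  define La where "La = ln (2 / p)"
  define s where "s = 2 * r + n"
  \<comment> \<open>The constant is \<open>1920 * 2304\<close>, with \<open>1920 = 120 * 16\<close>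
    from the linear moment of a form whose squared coefficients sum to at most
    \<open>16 * n\<^sup>2\<close>, and \<open>2304 = 48\<^sup>2\<close> from the number of
    pairs.\<close>
  define Q where "Q = 4423680 * real s / La"
  have La: "0 < La" using ln_two_div_ge[OF p] by (auto simp: La_def)
  have n: "0 < n" using V by (simp add: n_def card_gt_0_iff)
  have s: "1 \<le> s" "n \<le> s" using n by (auto simp: s_def)
  have Q: "0 < Q" using La s by (simp add: Q_def)
  let ?N = "lattice_net V" and ?X = "\<lambda>S. net_norm V (noise p R \<eta> S)"
  let ?F = "\<lambda>S. net_form V (noise p R \<eta> S)"
  let ?c = "\<lambda>u v e. real_of_int (u (fst e)) * real_of_int (v (snd e))"
  have form: "bexp p A (\<lambda>S. ?F S u v ^ (2 * s)) \<le> (1920 * real s / La) ^ s * real n ^ (2 * s)"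
    if u: "u \<in> ?N" and v: "v \<in> ?N" for u v
  proof -
    have sq: "(\<Sum>a\<in>V. (real_of_int (u a))\<^sup>2) \<le> 4 * real n" if "u \<in> ?N" for u
    proof -
      have "real_of_int (\<Sum>a\<in>V. (u a)\<^sup>2) \<le> real_of_int (4 * int n)"
        unfolding of_int_le_iff using that by (simp add: lattice_net_def n_def)
      then show ?thesis by simp
    qed
    have nf: "?F S u v = (\<Sum>e\<in>R. ?c u v e * xi p (\<eta> e) S)" for S
    proof -
      have "?F S u v
          = (\<Sum>a\<in>V. \<Sum>b\<in>V. of_bool ((a, b) \<in> R) * (real_of_int (u a) * real_of_int (v b) * xi p (\<eta> (a, b)) S))"
        by (simp add: net_form_def noise_def mult_ac)
      also have "\<dots> = (\<Sum>(a, b)\<in>R. real_of_int (u a) * real_of_int (v b) * xi p (\<eta> (a, b)) S)"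
        by (rule sum_rel[OF V(1,3)])
      finally show ?thesis by (simp add: case_prod_unfold)
    qed
    have "(\<Sum>e\<in>R. (?c u v e)\<^sup>2)
        \<le> (\<Sum>e\<in>V \<times> V. (?c u v e)\<^sup>2)"
      using V by (intro sum_mono2) auto
    also have "\<dots> = (\<Sum>a\<in>V. (real_of_int (u a))\<^sup>2) * (\<Sum>b\<in>V. (real_of_int (v b))\<^sup>2)"
      by (simp add: sum_product sum.cartesian_product power_mult_distrib case_prod_unfold)
    also have "\<dots> \<le> (4 * real n) * (4 * real n)"
      using sq[OF u] sq[OF v] by (intro mult_mono) (auto simp: sum_nonneg)
    finally have coef: "(\<Sum>e\<in>R. (?c u v e)\<^sup>2) \<le> 16 * (real n)\<^sup>2"
      by (simp add: power2_eq_square)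
    have "bexp p A (\<lambda>S. ?F S u v ^ (2 * s))
        \<le> (120 * real s * (\<Sum>e\<in>R. (?c u v e)\<^sup>2) / La) ^ s"
      unfolding nf La_def by (rule linear_moment[OF p A s(1)])
    also have "\<dots> \<le> (120 * real s * (16 * (real n)\<^sup>2) / La) ^ s"
      using La coef by (intro power_mono divide_right_mono mult_left_mono divide_nonneg_nonneg mult_nonneg_nonneg sum_nonneg) auto
    also have "\<dots> = (1920 * real s / La * (real n)\<^sup>2) ^ s" by (simp add: mult.assoc)
    also have "\<dots> = (1920 * real s / La) ^ s * real n ^ (2 * s)"
      by (simp only: power_mult_distrib power_mult)
    finally show ?thesis .
  qed
  have big: "bexp p A (\<lambda>S. ?X S ^ (2 * s)) \<le> Q ^ s"
  proof -
    have "bexp p A (\<lambda>S. ?X S ^ (2 * s))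
      \<le> bexp p A (\<lambda>S. 1 / real n ^ (2 * s) * (\<Sum>u\<in>?N. \<Sum>v\<in>?N. ?F S u v ^ (2 * s)))"
      using p net_norm_power_le[OF V(1,2)] by (intro bexp_mono) (auto simp: n_def)
    also have "\<dots> = 1 / real n ^ (2 * s) * (\<Sum>u\<in>?N. \<Sum>v\<in>?N. bexp p A (\<lambda>S. ?F S u v ^ (2 * s)))"
      by (simp only: bexp_cmult bexp_sum)
    also have "\<dots> \<le> 1 / real n ^ (2 * s) * (\<Sum>u\<in>?N. \<Sum>v\<in>?N. (1920 * real s / La) ^ s * real n ^ (2 * s))"
      by (intro mult_left_mono sum_mono form) auto
    also have "\<dots> = (real (card ?N))\<^sup>2 * (1920 * real s / La) ^ s"
      using n by (simp add: power2_eq_square)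
    also have "\<dots> \<le> (48 ^ n)\<^sup>2 * (1920 * real s / La) ^ s"
      using card_lattice_net_le[OF V(1)] La by (intro mult_right_mono power_mono) (auto simp: n_def)
    also have "(48 ^ n)\<^sup>2 = (2304 :: real) ^ n"
      by (simp add: power_mult[symmetric] mult.commute[of n] power_mult)
    also have "2304 ^ n * (1920 * real s / La) ^ s \<le> 2304 ^ s * (1920 * real s / La) ^ s"
      using s La by (intro mult_right_mono power_increasing) auto
    also have "\<dots> = Q ^ s" unfolding power_mult_distrib[symmetric] by (simp add: Q_def)
    finally show ?thesis .
  qed
  \<comment> \<open>Passage between the two orders: below the threshold \<open>Q\<close> the power
    is bounded outright, and above it the excess \<open>x ^ (2 * n)\<close> is at least
    \<open>Q ^ n\<close>, with \<open>4 * r + 2 * n = 2 * s\<close>.\<close>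
  have pt: "x ^ (4 * r) \<le> Q ^ (2 * r) + 1 / Q ^ n * x ^ (2 * s)" for x :: real
  proof (cases "x\<^sup>2 \<le> Q")
    case True
    have "x ^ (4 * r) = (x\<^sup>2) ^ (2 * r)" by (simp flip: power_mult)
    also have "\<dots> \<le> Q ^ (2 * r)" using True by (intro power_mono) auto
    finally show ?thesis using Q by (simp add: add_increasing2)
  next
    case False
    have "Q ^ n * x ^ (4 * r) \<le> (x\<^sup>2) ^ n * x ^ (4 * r)"
      using Q False by (intro mult_right_mono power_mono) (auto simp: zero_le_even_power)
    also have "\<dots> = x ^ (2 * s)" by (simp add: s_def power_add[symmetric] power_mult[symmetric] add.commute)
    finally have "x ^ (4 * r) \<le> 1 / Q ^ n * x ^ (2 * s)" using Q by (simp add: field_simps)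
    then show ?thesis using Q by (simp add: add_increasing)
  qed
  have "bexp p A (\<lambda>S. ?X S ^ (4 * r))
    \<le> bexp p A (\<lambda>S. Q ^ (2 * r) + 1 / Q ^ n * ?X S ^ (2 * s))"
    using p pt by (intro bexp_mono) auto
  also have "\<dots> = Q ^ (2 * r) + 1 / Q ^ n * bexp p A (\<lambda>S. ?X S ^ (2 * s))"
    using A by (simp only: bexp_add bexp_cmult bexp_const)
  also have "\<dots> \<le> Q ^ (2 * r) + 1 / Q ^ n * Q ^ s"
    using big Q by (intro add_left_mono mult_left_mono) auto
  also have "\<dots> = 2 * Q ^ (2 * r)" using Q by (simp add: s_def power_add)
  also have "\<dots> \<le> 2 ^ (2 * r) * Q ^ (2 * r)"
    using Q r by (intro mult_right_mono) (auto intro: order_trans[OF _ power_increasing[of 1 "2 * r"]])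
  also have "\<dots> = (2 * Q) ^ (2 * r)" by (rule power_mult_distrib[symmetric])
  also have "\<dots> \<le> (20000000 * (real n + real r) / La) ^ (2 * r)"
  proof (intro power_mono)
    show "2 * Q \<le> 20000000 * (real n + real r) / La"
      using La by (simp add: Q_def s_def field_simps)
  qed (use Q in auto)
  finally show ?thesis by (simp add: n_def La_def)
qed

text \<open>Read as a vector indexed by \<open>V \<times> V\<close>, the product depends linearly on
  the noise entries, and the coefficient map \<open>b\<close> is \<open>P S\<close> tensored with
  the identity. Its operator norm is thus that of \<open>P S\<close>, and its squared
  Hilbert-Schmidt norm acquires only the factor \<open>card V\<close>; these are
  \<open>\<omega>\<close> and \<open>\<tau>\<close> in the quadratic estimate.\<close>

lemma hs_product_moment:
  fixes V :: "'v set" and \<eta> :: "'v \<times> 'v \<Rightarrow> 'e"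
  assumes p: "0 < p" "p \<le> 1" and A: "finite A" "inj_on \<eta> R" "\<eta> ` R \<subseteq> A - B" "B \<subseteq> A"
    and V: "finite V" "R \<subseteq> V \<times> V" and r: "1 \<le> r"
    and dep: "\<And>S. S \<subseteq> A \<Longrightarrow> P S = P (S \<inter> B)" "\<And>S. S \<subseteq> A \<Longrightarrow> \<rho> S = \<rho> (S \<inter> B)"
    and opb: "\<And>S. S \<subseteq> A \<Longrightarrow> op_bound V (P S) (\<rho> S)"
  shows "bexp p A (\<lambda>S. hs_norm V (mmul V (P S) (noise p R \<eta> S)) ^ (4 * r))
    \<le> bexp p A (\<lambda>S. (8500 * (real (card V) * (hs_norm V (P S))\<^sup>2 + real r * (\<rho> S)\<^sup>2) / ln (2 / p)) ^ (2 * r))"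
proof (rule bexp_cond_mono[OF A(1) A(4)])
  let ?lhs = "\<lambda>S. hs_norm V (mmul V (P S) (noise p R \<eta> S)) ^ (4 * r)"
  let ?rhs = "\<lambda>S. (8500 * (real (card V) * (hs_norm V (P S))\<^sup>2 + real r * (\<rho> S)\<^sup>2) / ln (2 / p)) ^ (2 * r)"
  fix S assume S: "S \<subseteq> B"
  then have SA: "S \<subseteq> A" using A by auto
  have eq: "P (S \<union> T) = P S" "\<rho> (S \<union> T) = \<rho> S" if "T \<subseteq> A - B" for T
  proof -
    have "S \<union> T \<subseteq> A" "(S \<union> T) \<inter> B = S \<inter> B" using S SA that by auto
    then show "P (S \<union> T) = P S" "\<rho> (S \<union> T) = \<rho> S" using dep SA by metis+
  qed
  define b where "b e y = P S (fst y) (fst e) * of_bool (snd e = snd y)" for e y :: "'v \<times> 'v"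
  have finR: "finite R" using V finite_subset by blast
  have nz: "?lhs (S \<union> T)
      = (\<Sum>y\<in>V \<times> V. (\<Sum>e\<in>R. xi p (\<eta> e) T * b e y)\<^sup>2) ^ (2 * r)" if T: "T \<subseteq> A - B" for T
  proof -
    have "(\<Sum>e\<in>R. xi p (\<eta> e) T * b e (a, b')) = mmul V (P S) (noise p R \<eta> (S \<union> T)) a b'"
      if ab: "a \<in> V" "b' \<in> V" for a b'
    proof -
      have "(\<Sum>e\<in>R. xi p (\<eta> e) T * b e (a, b')) = (\<Sum>e\<in>R. xi p (\<eta> e) (S \<union> T) * b e (a, b'))"
        using S A(3) by (intro sum.cong refl arg_cong2[where f = "(*)"]) (auto simp: xi_def)
      also have "\<dots> = (\<Sum>(c, d)\<in>R. xi p (\<eta> (c, d)) (S \<union> T) * b (c, d) (a, b'))"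
        by (simp add: case_prod_unfold)
      also have "\<dots> = (\<Sum>c\<in>V. \<Sum>d\<in>V. of_bool ((c, d) \<in> R) * (xi p (\<eta> (c, d)) (S \<union> T) * b (c, d) (a, b')))"
        by (rule sum_rel[OF V, symmetric])
      also have "\<dots> = (\<Sum>c\<in>V. P S a c * noise p R \<eta> (S \<union> T) c b')"
      proof (intro sum.cong refl)
        fix c
        have "(\<Sum>d\<in>V. of_bool ((c, d) \<in> R) * (xi p (\<eta> (c, d)) (S \<union> T) * b (c, d) (a, b')))
            = (\<Sum>d\<in>V. if d = b' then P S a c * noise p R \<eta> (S \<union> T) c d else 0)"
          by (intro sum.cong refl) (auto simp: b_def noise_def)
        then show "(\<Sum>d\<in>V. of_bool ((c, d) \<in> R) * (xi p (\<eta> (c, d)) (S \<union> T) * b (c, d) (a, b')))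
            = P S a c * noise p R \<eta> (S \<union> T) c b'" using V ab by simp
      qed
      finally show ?thesis by (simp add: mmul_def)
    qed
    then have "(\<Sum>y\<in>V \<times> V. (\<Sum>e\<in>R. xi p (\<eta> e) T * b e y)\<^sup>2) = (hs_norm V (mmul V (P S) (noise p R \<eta> (S \<union> T))))\<^sup>2"
      unfolding hs_norm_square sum.cartesian_product by (intro sum.cong refl) auto
    moreover have "4 * r = 2 * (2 * r)" by simp
    ultimately show ?thesis by (simp only: eq[OF T] power_mult)
  qed
  have row: "(\<Sum>y\<in>V \<times> V. b (c, d) y * z y) = vmul V (\<lambda>a. z (a, d)) (P S) c" if "d \<in> V" for c d z
  proof -
    have "(\<Sum>y\<in>V \<times> V. b (c, d) y * z y) = (\<Sum>a\<in>V. \<Sum>b'\<in>V. b (c, d) (a, b') * z (a, b'))"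
      by (simp add: sum.cartesian_product)
    also have "\<dots> = (\<Sum>a\<in>V. \<Sum>b'\<in>V. if b' = d then z (a, d) * P S a c else 0)"
      by (intro sum.cong refl) (auto simp: b_def)
    finally show ?thesis using V that by (simp add: vmul_def)
  qed
  have tau: "(\<Sum>e\<in>R. \<Sum>y\<in>V \<times> V. (b e y)\<^sup>2) \<le> real (card V) * (hs_norm V (P S))\<^sup>2"
  proof -
    have "(\<Sum>e\<in>R. \<Sum>y\<in>V \<times> V. (b e y)\<^sup>2) \<le> (\<Sum>e\<in>V \<times> V. \<Sum>y\<in>V \<times> V. (b e y)\<^sup>2)"
      using V by (intro sum_mono2) (auto simp: sum_nonneg)
    also have "\<dots> = (\<Sum>c\<in>V. \<Sum>d\<in>V. \<Sum>a\<in>V. \<Sum>b'\<in>V. if b' = d then (P S a c)\<^sup>2 else 0)"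
      unfolding sum.cartesian_product[symmetric] b_def
      by (simp add: sum.cartesian_product' power_mult_distrib) (intro sum.cong refl, auto)
    also have "\<dots> = (\<Sum>c\<in>V. \<Sum>d\<in>V. \<Sum>a\<in>V. (P S a c)\<^sup>2)"
      using V by (intro sum.cong refl) simp
    also have "\<dots> = real (card V) * (\<Sum>c\<in>V. \<Sum>a\<in>V. (P S a c)\<^sup>2)"
      by (simp add: sum_distrib_left)
    also have "(\<Sum>c\<in>V. \<Sum>a\<in>V. (P S a c)\<^sup>2) = (hs_norm V (P S))\<^sup>2"
      unfolding hs_norm_square by (rule sum.swap)
    finally show ?thesis .
  qed
  have "bexp p (A - B) (\<lambda>T. ?lhs (S \<union> T))
      = bexp p (A - B) (\<lambda>T. (\<Sum>y\<in>V \<times> V. (\<Sum>e\<in>R. xi p (\<eta> e) T * b e y)\<^sup>2) ^ (2 * r))"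
    by (intro bexp_cong nz)
  also have "\<dots> \<le> ?rhs S"
  proof (rule quadratic_moment[OF p _ A(2,3) r _ _ tau])
    fix z :: "'v \<times> 'v \<Rightarrow> real"
    have "(\<Sum>e\<in>R. (\<Sum>y\<in>V \<times> V. b e y * z y)\<^sup>2) \<le> (\<Sum>e\<in>V \<times> V. (\<Sum>y\<in>V \<times> V. b e y * z y)\<^sup>2)"
      using V by (intro sum_mono2) auto
    also have "\<dots> = (\<Sum>c\<in>V. \<Sum>d\<in>V. (\<Sum>y\<in>V \<times> V. b (c, d) y * z y)\<^sup>2)"
      by (simp add: sum.cartesian_product case_prod_unfold)
    also have "\<dots> = (\<Sum>c\<in>V. \<Sum>d\<in>V. (vmul V (\<lambda>a. z (a, d)) (P S) c)\<^sup>2)"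
      by (intro sum.cong refl) (simp add: row)
    also have "\<dots> = (\<Sum>d\<in>V. \<Sum>c\<in>V. (vmul V (\<lambda>a. z (a, d)) (P S) c)\<^sup>2)" by (rule sum.swap)
    also have "\<dots> \<le> (\<Sum>d\<in>V. (\<rho> S)\<^sup>2 * (\<Sum>a\<in>V. (z (a, d))\<^sup>2))"
      by (intro sum_mono op_bound_square opb SA)
    also have "\<dots> = (\<rho> S)\<^sup>2 * (\<Sum>a\<in>V. \<Sum>d\<in>V. (z (a, d))\<^sup>2)"
      unfolding sum_distrib_left[symmetric] by (subst sum.swap) simp
    also have "(\<Sum>a\<in>V. \<Sum>d\<in>V. (z (a, d))\<^sup>2) = (\<Sum>y\<in>V \<times> V. (z y)\<^sup>2)"
      by (simp add: sum.cartesian_product case_prod_unfold)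
    finally show "(\<Sum>e\<in>R. (\<Sum>y\<in>V \<times> V. b e y * z y)\<^sup>2) \<le> (\<rho> S)\<^sup>2 * (\<Sum>y\<in>V \<times> V. (z y)\<^sup>2)" .
  qed (use A in auto)
  also have "\<dots> = bexp p (A - B) (\<lambda>T. ?rhs S)"
    using A by simp
  also have "\<dots> = bexp p (A - B) (\<lambda>T. ?rhs (S \<union> T))"
    by (intro bexp_cong) (simp add: eq)
  finally show "bexp p (A - B) (\<lambda>T. ?lhs (S \<union> T))
    \<le> bexp p (A - B) (\<lambda>T. ?rhs (S \<union> T))" .
qed (use p in auto)

section \<open>Traces of products of random matrices\<close>

definition idm :: "'v mat" where
  "idm a b = of_bool (a = b)"

definition mtrace :: "'v set \<Rightarrow> 'v mat \<Rightarrow> real" where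
  "mtrace V A = (\<Sum>a\<in>V. A a a)"

lemma mmul_idm_left: "finite V \<Longrightarrow> a \<in> V \<Longrightarrow> mmul V idm A a b = A a b"
  by (simp add: mmul_def idm_def of_bool_def if_distrib[of "\<lambda>x. x * _"] cong: if_cong)

lemma mmul_idm_right: "finite V \<Longrightarrow> b \<in> V \<Longrightarrow> mmul V A idm a b = A a b"
  by (simp add: mmul_def idm_def of_bool_def if_distrib[of "\<lambda>x. _ * x"] cong: if_cong)

lemma mmul_assoc: "mmul V (mmul V A B) C = mmul V A (mmul V B C)"
proof (intro ext)
  fix a b
  have "mmul V (mmul V A B) C a b = (\<Sum>c\<in>V. \<Sum>d\<in>V. A a d * B d c * C c b)"
    by (simp add: mmul_def sum_distrib_right)
  also have "\<dots> = (\<Sum>d\<in>V. \<Sum>c\<in>V. A a d * B d c * C c b)" by (rule sum.swap)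
  finally show "mmul V (mmul V A B) C a b = mmul V A (mmul V B C) a b"
    by (simp add: mmul_def sum_distrib_left mult.assoc)
qed

text \<open>Cyclicity of the trace exhibits a linear form in the entries of \<open>X\<close> whose
  coefficients are those of the transpose of the product of \<open>B\<close> and
  \<open>A\<close>.\<close>

lemma mtrace_mmul_triple:
  "mtrace V (mmul V A (mmul V X B)) = (\<Sum>c\<in>V. \<Sum>b\<in>V. X c b * mmul V B A b c)"
proof -
  have "mtrace V (mmul V A (mmul V X B)) = (\<Sum>a\<in>V. \<Sum>c\<in>V. \<Sum>b\<in>V. X c b * (B b a * A a c))"
    by (simp add: mtrace_def mmul_def sum_distrib_left mult_ac)
  also have "\<dots> = (\<Sum>c\<in>V. \<Sum>a\<in>V. \<Sum>b\<in>V. X c b * (B b a * A a c))" by (rule sum.swap)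
  also have "\<dots> = (\<Sum>c\<in>V. \<Sum>b\<in>V. \<Sum>a\<in>V. X c b * (B b a * A a c))"
    by (intro sum.cong refl sum.swap)
  finally show ?thesis by (simp add: mmul_def sum_distrib_left)
qed

lemma mmul_add_left: "mmul V (\<lambda>a b. A a b + B a b) C = (\<lambda>a b. mmul V A C a b + mmul V B C a b)"
  by (intro ext) (simp add: mmul_def distrib_right sum.distrib)

lemma mmul_add_right: "mmul V A (\<lambda>a b. B a b + C a b) = (\<lambda>a b. mmul V A B a b + mmul V A C a b)"
  by (intro ext) (simp add: mmul_def distrib_left sum.distrib)

lemma op_bound_idm:
  assumes "finite V" shows "op_bound V idm 1"
proof (rule op_boundI)
  fix x
  have "vmul V x idm b = x b" if "b \<in> V" for b
    using assms that by (simp add: vmul_def idm_def of_bool_def if_distrib[of "\<lambda>x. _ * x"] cong: if_cong)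
  then show "(\<Sum>b\<in>V. (vmul V x idm b)\<^sup>2) \<le> 1\<^sup>2 * (\<Sum>a\<in>V. (x a)\<^sup>2)" by simp
qed simp

lemma hs_norm_idm:
  assumes "finite V" shows "hs_norm V idm = sqrt (real (card V))"
proof -
  have "(hs_norm V idm)\<^sup>2 = real (card V)"
    using assms by (simp add: hs_norm_square idm_def of_bool_def if_distrib[of "\<lambda>x. x\<^sup>2"] cong: if_cong)
  then show ?thesis by (metis hs_norm_nonneg real_sqrt_unique)
qed

lemma square_power_double: "(x\<^sup>2) ^ (2 * r) = (x :: real) ^ (4 * r)"
  by (simp flip: power_mult)

text \<open>\<open>R j\<close> holds the ordered pairs on which the \<open>j\<close>-th factor lives
  and \<open>\<eta>\<close> sends a pair to its random coordinate. Independence of the factors is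
  the assumption \<open>disj\<close>.\<close>

locale walk_model =
  fixes p :: real and V :: "'v set" and A :: "'e set" and R :: "nat \<Rightarrow> ('v \<times> 'v) set"
    and \<eta> :: "'v \<times> 'v \<Rightarrow> 'e" and k :: nat
  assumes p: "0 < p" "p \<le> 1" and A: "finite A" and V: "finite V" "V \<noteq> {}" and k: "2 \<le> k"
    and R: "\<And>j. j < k \<Longrightarrow> R j \<subseteq> V \<times> V" "\<And>j. j < k \<Longrightarrow> inj_on \<eta> (R j)" "\<And>j. j < k \<Longrightarrow> \<eta> ` R j \<subseteq> A"
    and disj: "\<And>i j. i < k \<Longrightarrow> j < k \<Longrightarrow> i \<noteq> j \<Longrightarrow> \<eta> ` R i \<inter> \<eta> ` R j = {}"
begin

definition M :: "nat \<Rightarrow> 'e set \<Rightarrow> 'v mat" where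
  "M j S a b = of_bool ((a, b) \<in> R j) * of_bool (\<eta> (a, b) \<in> S)"

definition J :: "nat \<Rightarrow> 'v mat" where
  "J j a b = of_bool ((a, b) \<in> R j) * p"

abbreviation X :: "nat \<Rightarrow> 'e set \<Rightarrow> 'v mat" where
  "X j \<equiv> noise p (R j) \<eta>"

primrec P :: "nat \<Rightarrow> 'e set \<Rightarrow> 'v mat" where
  "P 0 S = idm"
| "P (Suc j) S = mmul V (P j S) (M j S)"

text \<open>Counted from the right end: \<open>Q m\<close> is the product of the last
  \<open>m\<close> mean matrices, \<open>J (k - m)\<close> up to \<open>J (k - 1)\<close>, so that
  \<open>P j\<close> and \<open>Q (k - j)\<close> fit together.\<close>

primrec Q :: "nat \<Rightarrow> 'v mat" where
  "Q 0 = idm"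
| "Q (Suc m) = mmul V (J (k - Suc m)) (Q m)"

text \<open>The change of the trace when factor \<open>j\<close> passes from mean to random, already
  in the form obtained by cyclicity. The coefficients involve only \<open>P j\<close>, hence only
  the coordinates in \<open>B j\<close>.\<close>

definition D :: "nat \<Rightarrow> 'e set \<Rightarrow> real" where
  "D j S = (\<Sum>e\<in>R j. mmul V (Q (k - Suc j)) (P j S) (snd e) (fst e) * xi p (\<eta> e) S)"

definition La where "La = ln (2 / p)"
definition L where "L = 1 / sqrt La"
definition n where "n = real (card V)"

lemma La: "0 < La" using ln_two_div_ge[OF p] by (simp add: La_def)
lemma L: "0 < L" using La by (simp add: L_def)
lemma L2: "L\<^sup>2 = 1 / La" using La by (simp add: L_def power_divide)
lemma n: "0 < n" using V by (simp add: n_def card_gt_0_iff)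

text \<open>One bound per factor, multiplied: a cruder quantity than the operator norm of the
  product, but its moments factor by independence.\<close>

definition \<rho> :: "nat \<Rightarrow> 'e set \<Rightarrow> real" where
  "\<rho> j S = (\<Prod>i<j. p * n + net_norm V (X i S))"

definition B :: "nat \<Rightarrow> 'e set" where
  "B j = (\<Union>i<j. \<eta> ` R i)"

lemma M_eq: "M j S = (\<lambda>a b. J j a b + X j S a b)"
  by (intro ext) (auto simp: M_def J_def noise_def xi_def)

lemma telescope: "mtrace V (P k S) - mtrace V (Q k) = (\<Sum>j<k. D j S)"
proof -
  define t where "t j = mtrace V (mmul V (P j S) (Q (k - j)))" for j
  have step: "t (Suc j) - t j = D j S" if "j < k" for j
  proof -
    have "k - j = Suc (k - Suc j)" "k - Suc (k - Suc j) = j" using that by auto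
    then have "Q (k - j) = mmul V (J j) (Q (k - Suc j))" by (metis Q.simps(2))
    moreover have "mmul V (P (Suc j) S) (Q (k - Suc j)) = mmul V (P j S) (mmul V (M j S) (Q (k - Suc j)))"
      by (simp add: mmul_assoc)
    ultimately have "t (Suc j) - t j = mtrace V (mmul V (P j S) (mmul V (X j S) (Q (k - Suc j))))"
      unfolding t_def M_eq mmul_add_left mmul_add_right by (simp add: mtrace_def sum.distrib)
    also have "\<dots> = (\<Sum>c\<in>V. \<Sum>b\<in>V. of_bool ((c, b) \<in> R j) * (mmul V (Q (k - Suc j)) (P j S) b c * xi p (\<eta> (c, b)) S))"
      unfolding mtrace_mmul_triple noise_def by (simp add: mult_ac)
    also have "\<dots> = D j S"
      by (subst sum_rel[OF V(1) R(1)[OF that]]) (simp add: D_def case_prod_unfold)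
    finally show ?thesis .
  qed
  have "t k - t 0 = (\<Sum>j<k. t (Suc j) - t j)" by (rule sum_lessThan_telescope[symmetric])
  also have "\<dots> = (\<Sum>j<k. D j S)" by (intro sum.cong) (auto simp: step)
  finally show ?thesis
    using V by (simp add: t_def mtrace_def mmul_idm_left mmul_idm_right)
qed

section \<open>Norms of the random and of the mean products\<close>

lemma op_bound_J: "j < k \<Longrightarrow> op_bound V (J j) (p * n)"
  using p V by (intro op_bound_mono[OF op_bound_hs_norm]) (auto simp: n_def J_def intro!: hs_norm_le_const)

lemma hs_norm_J: "hs_norm V (J j) \<le> p * n"
  using p V by (auto simp: n_def J_def intro!: hs_norm_le_const)

lemma rho_nonneg: "0 \<le> \<rho> j S"
  using p n V by (auto simp: \<rho>_def intro!: prod_nonneg add_nonneg_nonneg net_norm_nonneg)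

lemma op_bound_P: "j \<le> k \<Longrightarrow> op_bound V (P j S) (\<rho> j S)"
proof (induction j)
  case (Suc j)
  have "op_bound V (M j S) (p * n + net_norm V (X j S))"
    unfolding M_eq using Suc by (intro op_bound_add op_bound_J op_bound_net_norm V) auto
  then have "op_bound V (P (Suc j) S) (\<rho> j S * (p * n + net_norm V (X j S)))"
    using Suc by (simp add: op_bound_mmul)
  then show ?case by (simp add: \<rho>_def)
qed (simp add: \<rho>_def op_bound_idm V)

lemma op_bound_Q: "m \<le> k \<Longrightarrow> op_bound V (Q m) ((p * n) ^ m)"
proof (induction m)
  case (Suc m)
  then have "op_bound V (Q (Suc m)) (p * n * (p * n) ^ m)"
    unfolding Q.simps by (intro op_bound_mmul op_bound_J) auto
  then show ?case by simp
qed (simp add: op_bound_idm V)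

text \<open>One mean factor carries the Hilbert-Schmidt norm and the others their operator norms,
  all at most \<open>p * n\<close>. The empty product is different: the identity has Hilbert-Schmidt
  norm \<open>sqrt n\<close>.\<close>

lemma hs_norm_Q:
  assumes "1 \<le> m" "m \<le> k"
  shows "hs_norm V (Q m) \<le> (p * n) ^ m"
proof (cases m)
  case (Suc m')
  have "hs_norm V (Q m) \<le> hs_norm V (J (k - Suc m')) * (p * n) ^ m'"
    unfolding Suc Q.simps using assms Suc by (intro hs_norm_mmul_left op_bound_Q) auto
  also have "\<dots> \<le> p * n * (p * n) ^ m'" using p n by (intro mult_right_mono hs_norm_J) auto
  finally show ?thesis by (simp add: Suc)
qed (use assms in auto)

lemma noise_local: "\<eta> ` R i \<subseteq> C \<Longrightarrow> X i S = X i (S \<inter> C)"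
  by (intro ext) (auto simp: noise_def xi_def)

lemma B_sub: "j \<le> k \<Longrightarrow> B j \<subseteq> A"
  unfolding B_def by (intro UN_least R(3)) simp

lemma B_disj:
  assumes "j < k" shows "\<eta> ` R j \<subseteq> A - B j"
proof -
  have "\<eta> ` R j \<inter> B j = {}"
    unfolding B_def Int_UN_distrib using assms disj[of j] by auto
  then show ?thesis using R(3)[OF assms] by blast
qed

lemma P_local: "P j S = P j (S \<inter> B j)"
proof -
  have "P i S = P i (S \<inter> B j)" if "i \<le> j" for i
    using that
  proof (induction i)
    case (Suc i)
    have "M i S = M i (S \<inter> B j)"
      using Suc.prems by (intro ext) (auto simp: M_def B_def intro!: bexI[of _ i])
    then show ?case using Suc by simp
  qed simp
  then show ?thesis by simp
qed

lemma rho_local: "\<rho> j S = \<rho> j (S \<inter> B j)"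
proof -
  have "X i S = X i (S \<inter> B j)" if "i < j" for i
    using that by (intro noise_local) (auto simp: B_def)
  then show ?thesis by (simp add: \<rho>_def)
qed

text \<open>The size of the operator norm of one factor at moment order \<open>4 * r\<close>: mean
  part plus noise part.\<close>

definition op_scale :: "nat \<Rightarrow> real" where
  "op_scale r = p * n + L * (sqrt n + sqrt r)"

lemma op_scale_ge: "0 < op_scale r" "p * n \<le> op_scale r" "L * sqrt n \<le> op_scale r" "L * sqrt r \<le> op_scale r"
proof -
  have pos: "0 < p * n" "0 < L * sqrt n" "0 \<le> L * sqrt r" using p n L by auto
  then show "0 < op_scale r" "p * n \<le> op_scale r" "L * sqrt n \<le> op_scale r" "L * sqrt r \<le> op_scale r"
    unfolding op_scale_def distrib_left by linarith+
qed

lemma net_norm_shift_moment: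
  assumes j: "j < k" and r: "1 \<le> r"
  shows "bexp p A (\<lambda>S. (p * n + net_norm V (X j S)) ^ (4 * r)) \<le> (10000 * op_scale r) ^ (4 * r)"
proof -
  have pos: "0 \<le> p * n" "0 \<le> L * (sqrt n + sqrt r)" using p n L by auto
  have "bexp p A (\<lambda>S. (p * n + net_norm V (X j S)) ^ (4 * r))
      \<le> bexp p A (\<lambda>S. 2 ^ (4 * r) * ((p * n) ^ (4 * r) + net_norm V (X j S) ^ (4 * r)))"
    using p by (intro bexp_mono add_power_even_le) auto
  also have "\<dots> = 2 ^ (4 * r) * ((p * n) ^ (4 * r) + bexp p A (\<lambda>S. net_norm V (X j S) ^ (4 * r)))"
    using A by (simp only: bexp_cmult bexp_add bexp_const)
  also have "\<dots> \<le> 2 ^ (4 * r) * ((p * n) ^ (4 * r) + (20000000 * (n + real r) / La) ^ (2 * r))"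
    unfolding n_def La_def using j r
    by (intro mult_left_mono add_left_mono net_norm_moment p A R V) auto
  \<comment> \<open>\<open>5000\<^sup>2 = 25000000\<close> leaves room for the constant of the net
    estimate; doubling when the two summands were separated turns 5000 into the 10000 of the
    claim.\<close>
  also have "(20000000 * (n + real r) / La) ^ (2 * r) \<le> ((5000 * (L * (sqrt n + sqrt r)))\<^sup>2) ^ (2 * r)"
  proof (intro power_mono)
    have "n + real r \<le> (sqrt n + sqrt r)\<^sup>2" using n by (simp add: power2_sum)
    then have "20000000 * (n + real r) / La \<le> 25000000 * (sqrt n + sqrt r)\<^sup>2 / La"
      using La n by (intro divide_right_mono mult_mono) auto
    also have "\<dots> = (5000 * (L * (sqrt n + sqrt r)))\<^sup>2" by (simp add: power_mult_distrib L2)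
    finally show "20000000 * (n + real r) / La \<le> (5000 * (L * (sqrt n + sqrt r)))\<^sup>2" .
  qed (use n La in auto)
  also have "((5000 * (L * (sqrt n + sqrt r)))\<^sup>2) ^ (2 * r) = (5000 * (L * (sqrt n + sqrt r))) ^ (4 * r)"
    by (rule square_power_double)
  also have "(p * n) ^ (4 * r) + (5000 * (L * (sqrt n + sqrt r))) ^ (4 * r)
      \<le> (p * n + 5000 * (L * (sqrt n + sqrt r))) ^ (4 * r)"
    using pos r by (intro power_sum_le_sum_power) auto
  also have "\<dots> \<le> (5000 * op_scale r) ^ (4 * r)"
    using pos by (intro power_mono) (auto simp: op_scale_def)
  also have "2 ^ (4 * r) * (5000 * op_scale r) ^ (4 * r) = (2 * (5000 * op_scale r)) ^ (4 * r)"
    by (rule power_mult_distrib[symmetric])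
  finally show ?thesis by (simp add: mult.assoc[symmetric] del: power_mult_distrib)
qed

lemma rho_moment:
  assumes "j \<le> k" "1 \<le> r"
  shows "bexp p A (\<lambda>S. \<rho> j S ^ (4 * r)) \<le> ((10000 * op_scale r) ^ j) ^ (4 * r)"
  using assms(1)
proof (induction j)
  case 0
  then show ?case using A by (simp add: \<rho>_def)
next
  case (Suc j)
  let ?g = "\<lambda>S. (p * n + net_norm V (X j S)) ^ (4 * r)"
  have "bexp p A (\<lambda>S. \<rho> (Suc j) S ^ (4 * r)) = bexp p A (\<lambda>S. \<rho> j S ^ (4 * r) * ?g S)"
    by (simp add: \<rho>_def power_mult_distrib)
  also have "\<dots> = bexp p A (\<lambda>S. \<rho> j S ^ (4 * r)) * bexp p A ?g"
  proof (rule bexp_indep[OF A B_sub[of j]])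
    fix S assume S: "S \<subseteq> A"
    show "\<rho> j S ^ (4 * r) = \<rho> j (S \<inter> B j) ^ (4 * r)" using rho_local by metis
    have "X j S = X j (S - B j)"
    proof -
      have "S \<inter> (A - B j) = S - B j" "(S - B j) \<inter> (A - B j) = S - B j" using S by auto
      then show ?thesis
        using noise_local[of j "A - B j"] B_disj[of j] Suc.prems by (metis Suc_le_lessD)
    qed
    then show "?g S = ?g (S - B j)" by simp
  qed (use Suc.prems in auto)
  also have "\<dots> \<le> ((10000 * op_scale r) ^ j) ^ (4 * r) * (10000 * op_scale r) ^ (4 * r)"
    using Suc assms(2) p by (intro mult_mono net_norm_shift_moment bexp_nonneg) (auto simp: zero_le_even_power)
  finally show ?case by (simp add: power_mult_distrib mult.commute)
qed

text \<open>The start is the Hilbert-Schmidt norm of the identity. A further noise factor multiplies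
  the Hilbert-Schmidt norm by \<open>L * sqrt n\<close> and adds \<open>L * sqrt r\<close> times the
  operator norm of the earlier product; a mean factor adds \<open>p * n\<close> times that operator
  norm.\<close>

primrec hs_scale :: "nat \<Rightarrow> nat \<Rightarrow> real" where
  "hs_scale r 0 = sqrt n"
| "hs_scale r (Suc j) = L * sqrt n * hs_scale r j + (p * n + L * sqrt r) * op_scale r ^ j"

lemma hs_scale_nonneg: "0 \<le> hs_scale r j"
  using p n L op_scale_ge[of r] by (induction j) auto

text \<open>Only the history consisting of \<open>L * sqrt n\<close> at every step retains the
  initial \<open>sqrt n\<close>. Any other history contains a summand
  \<open>p * n + L * sqrt r\<close>, and its later factors \<open>L * sqrt n\<close> are at most
  \<open>op_scale r\<close>. At \<open>j = 0\<close> the truncated exponent is multiplied by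
  \<open>real j = 0\<close>.\<close>

lemma hs_scale_le:
  "hs_scale r j \<le> (L * sqrt n) ^ j * sqrt n + real j * ((p * n + L * sqrt r) * op_scale r ^ (j - 1))"
proof (induction j)
  case (Suc j)
  have pos: "0 \<le> p * n + L * sqrt r" "0 \<le> L * sqrt n" using p n L by auto
  have "L * sqrt n * (real j * ((p * n + L * sqrt r) * op_scale r ^ (j - 1)))
      \<le> real j * ((p * n + L * sqrt r) * op_scale r ^ j)"
  proof (cases j)
    case (Suc i)
    have "L * sqrt n * op_scale r ^ i \<le> op_scale r * op_scale r ^ i"
      using op_scale_ge[of r] by (intro mult_right_mono) auto
    then have "(real j * (p * n + L * sqrt r)) * (L * sqrt n * op_scale r ^ i) \<le> (real j * (p * n + L * sqrt r)) * (op_scale r * op_scale r ^ i)"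
      using pos by (intro mult_left_mono mult_nonneg_nonneg) auto
    then show ?thesis by (simp add: Suc mult_ac)
  qed simp
  moreover have "L * sqrt n * hs_scale r j
      \<le> L * sqrt n * ((L * sqrt n) ^ j * sqrt n + real j * ((p * n + L * sqrt r) * op_scale r ^ (j - 1)))"
    using pos Suc by (intro mult_left_mono) auto
  ultimately show ?case by (simp add: algebra_simps)
qed simp

text \<open>The new factor is split into mean and noise. In the mean part the Hilbert-Schmidt norm
  is put on \<open>J j\<close> and the operator norm on \<open>P j S\<close>, in the noise part
  \<open>hs_product_moment\<close> applies; together they reproduce the recursion of
  \<open>hs_scale\<close>.\<close>

lemma hs_P_moment:
  assumes "j \<le> k" and r: "1 \<le> r"
  shows "bexp p A (\<lambda>S. hs_norm V (P j S) ^ (4 * r)) \<le> (10000 ^ j * hs_scale r j) ^ (4 * r)"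
  using assms(1)
proof (induction j)
  case 0
  then show ?case using A V by (simp add: hs_norm_idm n_def)
next
  case (Suc j)
  then have jk: "j < k" by simp
  define c :: real where "c = 10000 ^ j"
  have c: "0 \<le> c" by (simp add: c_def)
  define E\<rho> where "E\<rho> = bexp p A (\<lambda>S. \<rho> j S ^ (4 * r))"
  define EN where "EN = bexp p A (\<lambda>S. hs_norm V (P j S) ^ (4 * r))"
  have pos: "0 \<le> p * n" "0 \<le> L * sqrt n" "0 \<le> L * sqrt r" "0 \<le> op_scale r" "0 \<le> hs_scale r j"
    using p n L op_scale_ge[of r] hs_scale_nonneg[of r j] by auto
  have E\<rho>: "E\<rho> \<le> (c * op_scale r ^ j) ^ (4 * r)"
    using rho_moment[of j r] Suc.prems r by (simp add: E\<rho>_def c_def power_mult_distrib)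
  have EN: "EN \<le> (c * hs_scale r j) ^ (4 * r)" using Suc by (simp add: EN_def c_def)
  have sq: "x * y\<^sup>2 / La = (L * sqrt x * y)\<^sup>2" if "0 \<le> x" for x y
    using that by (simp add: power_mult_distrib L2)
  let ?N = "\<lambda>S. hs_norm V (P j S)" and ?PX = "\<lambda>S. mmul V (P j S) (X j S)"
  let ?Z = "\<lambda>S. 8500 * (real (card V) * (?N S)\<^sup>2 + real r * (\<rho> j S)\<^sup>2) / ln (2 / p)"
  have pt1: "hs_norm V (P (Suc j) S) ^ (4 * r)
      \<le> 2 ^ (4 * r) * ((p * n) ^ (4 * r) * \<rho> j S ^ (4 * r) + hs_norm V (?PX S) ^ (4 * r))" for S
  proof -
    have "hs_norm V (P (Suc j) S) \<le> hs_norm V (mmul V (P j S) (J j)) + hs_norm V (?PX S)"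
      unfolding P.simps M_eq mmul_add_right by (rule hs_norm_triangle)
    also have "hs_norm V (mmul V (P j S) (J j)) \<le> \<rho> j S * hs_norm V (J j)"
      using jk by (intro hs_norm_mmul_right op_bound_P) auto
    also have "\<dots> \<le> \<rho> j S * (p * n)" by (intro mult_left_mono hs_norm_J rho_nonneg)
    finally have "hs_norm V (P (Suc j) S) \<le> p * n * \<rho> j S + hs_norm V (?PX S)"
      by (simp add: mult.commute)
    then have "hs_norm V (P (Suc j) S) ^ (4 * r) \<le> (p * n * \<rho> j S + hs_norm V (?PX S)) ^ (4 * r)"
      by (intro power_mono) auto
    also have "\<dots> \<le> 2 ^ (4 * r) * ((p * n * \<rho> j S) ^ (4 * r) + hs_norm V (?PX S) ^ (4 * r))"
      by (intro add_power_even_le) auto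
    finally show ?thesis by (simp only: power_mult_distrib)
  qed
  have pt2: "?Z S ^ (2 * r)
      \<le> 131 ^ (4 * r) * ((L * sqrt n) ^ (4 * r) * ?N S ^ (4 * r) + (L * sqrt r) ^ (4 * r) * \<rho> j S ^ (4 * r))" for S
  proof -
    define x where "x = (L * sqrt n * ?N S)\<^sup>2"
    define y where "y = (L * sqrt r * \<rho> j S)\<^sup>2"
    have "?Z S = 8500 * (x + y)"
      unfolding x_def y_def using n
      by (subst (1 2) sq[symmetric]) (auto simp: n_def La_def add_divide_distrib)
    then have "?Z S ^ (2 * r)
        = 8500 ^ (2 * r) * (x + y) ^ (2 * r)" by (simp only: power_mult_distrib)
    also have "\<dots> \<le> 8500 ^ (2 * r) * (2 ^ (2 * r) * (x ^ (2 * r) + y ^ (2 * r)))"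
      by (intro mult_left_mono add_power_even_le) auto
    also have "\<dots> = 17000 ^ (2 * r) * (x ^ (2 * r) + y ^ (2 * r))"
      by (simp add: mult.assoc[symmetric] power_mult_distrib[symmetric])
    \<comment> \<open>\<open>131\<^sup>2 = 17161\<close>. The factor per step becomes
      \<open>262 = 2 * 131\<close>, well below the 10000 already required by
      \<open>rho_moment\<close>.\<close>
    also have "(17000::real) ^ (2 * r) \<le> (131\<^sup>2) ^ (2 * r)" by (intro power_mono) auto
    also have "((131::real)\<^sup>2) ^ (2 * r) = 131 ^ (4 * r)" by (rule square_power_double)
    also have "x ^ (2 * r) = (L * sqrt n) ^ (4 * r) * ?N S ^ (4 * r)"
      unfolding x_def power_mult_distrib[symmetric] by (simp flip: power_mult)
    also have "y ^ (2 * r) = (L * sqrt r) ^ (4 * r) * \<rho> j S ^ (4 * r)"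
      unfolding y_def power_mult_distrib[symmetric] by (simp flip: power_mult)
    finally show ?thesis by (simp add: mult_right_mono x_def y_def)
  qed
  have "bexp p A (\<lambda>S. hs_norm V (?PX S) ^ (4 * r))
      \<le> bexp p A (\<lambda>S. ?Z S ^ (2 * r))"
    using jk P_local rho_local
    by (intro hs_product_moment[OF p A R(2) B_disj B_sub V(1) R(1) r] op_bound_P) auto
  also have "\<dots> \<le> bexp p A (\<lambda>S. 131 ^ (4 * r) * ((L * sqrt n) ^ (4 * r) * ?N S ^ (4 * r) + (L * sqrt r) ^ (4 * r) * \<rho> j S ^ (4 * r)))"
    using p pt2 by (intro bexp_mono) auto
  also have "\<dots> = 131 ^ (4 * r) * ((L * sqrt n) ^ (4 * r) * EN + (L * sqrt r) ^ (4 * r) * E\<rho>)"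
    by (simp only: bexp_cmult bexp_add EN_def E\<rho>_def)
  finally have X: "bexp p A (\<lambda>S. hs_norm V (?PX S) ^ (4 * r))
      \<le> 131 ^ (4 * r) * ((L * sqrt n) ^ (4 * r) * EN + (L * sqrt r) ^ (4 * r) * E\<rho>)" .
  have "bexp p A (\<lambda>S. hs_norm V (P (Suc j) S) ^ (4 * r))
      \<le> bexp p A (\<lambda>S. 2 ^ (4 * r) * ((p * n) ^ (4 * r) * \<rho> j S ^ (4 * r) + hs_norm V (?PX S) ^ (4 * r)))"
    using p pt1 by (intro bexp_mono) auto
  also have "\<dots> = 2 ^ (4 * r) * ((p * n) ^ (4 * r) * E\<rho> + bexp p A (\<lambda>S. hs_norm V (?PX S) ^ (4 * r)))"
    by (simp only: bexp_cmult bexp_add E\<rho>_def)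
  also have "\<dots> \<le> 2 ^ (4 * r) * (131 ^ (4 * r) * ((p * n) ^ (4 * r) * E\<rho>) + 131 ^ (4 * r) * ((L * sqrt n) ^ (4 * r) * EN + (L * sqrt r) ^ (4 * r) * E\<rho>))"
  proof (intro mult_left_mono add_mono X)
    have "0 \<le> (p * n) ^ (4 * r) * E\<rho>"
      using p pos by (auto simp: E\<rho>_def zero_le_even_power intro!: mult_nonneg_nonneg bexp_nonneg)
    then show "(p * n) ^ (4 * r) * E\<rho> \<le> 131 ^ (4 * r) * ((p * n) ^ (4 * r) * E\<rho>)"
      by (intro mult_le_cancel_right1[THEN iffD2]) auto
  qed auto
  also have "\<dots> = 262 ^ (4 * r) * ((p * n) ^ (4 * r) * E\<rho> + ((L * sqrt n) ^ (4 * r) * EN + (L * sqrt r) ^ (4 * r) * E\<rho>))"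
  proof -
    have "(262::real) ^ (4 * r) = 2 ^ (4 * r) * 131 ^ (4 * r)" by (simp flip: power_mult_distrib)
    then show ?thesis by (simp only: distrib_left mult.assoc)
  qed
  also have "\<dots> \<le> 262 ^ (4 * r) * ((p * n) ^ (4 * r) * (c * op_scale r ^ j) ^ (4 * r)
      + ((L * sqrt n) ^ (4 * r) * (c * hs_scale r j) ^ (4 * r) + (L * sqrt r) ^ (4 * r) * (c * op_scale r ^ j) ^ (4 * r)))"
    by (intro mult_left_mono add_mono E\<rho> EN) (auto simp: zero_le_even_power)
  also have "\<dots> = 262 ^ (4 * r) * ((p * n * (c * op_scale r ^ j)) ^ (4 * r)
      + ((L * sqrt n * (c * hs_scale r j)) ^ (4 * r) + (L * sqrt r * (c * op_scale r ^ j)) ^ (4 * r)))"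
    by (simp only: power_mult_distrib)
  also have "\<dots> \<le> 262 ^ (4 * r) * ((p * n * (c * op_scale r ^ j)) ^ (4 * r)
      + (L * sqrt n * (c * hs_scale r j) + L * sqrt r * (c * op_scale r ^ j)) ^ (4 * r))"
    using pos c r by (intro mult_left_mono add_left_mono power_sum_le_sum_power) auto
  also have "\<dots> \<le> 262 ^ (4 * r) * (p * n * (c * op_scale r ^ j) + (L * sqrt n * (c * hs_scale r j) + L * sqrt r * (c * op_scale r ^ j))) ^ (4 * r)"
    using pos c r by (intro mult_left_mono power_sum_le_sum_power) auto
  also have "\<dots> = (262 * (c * hs_scale r (Suc j))) ^ (4 * r)"
    unfolding power_mult_distrib[symmetric] by (simp add: algebra_simps)
  also have "\<dots> \<le> (10000 * (c * hs_scale r (Suc j))) ^ (4 * r)"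
    using c hs_scale_nonneg[of r "Suc j"] by (intro power_mono mult_right_mono mult_nonneg_nonneg) auto
  finally show ?case by (simp add: c_def mult.assoc)
qed

definition \<Phi> :: "nat \<Rightarrow> real" where
  "\<Phi> r = L * sqrt r * ((L * sqrt n) ^ (k - 1) * sqrt n + (p * n + L * sqrt r) * op_scale r ^ (k - 2))"

text \<open>Conditionally on \<open>B j\<close> this is a linear form, of size
  \<open>L * sqrt r\<close> times the Hilbert-Schmidt norm of its coefficient matrix. If a mean
  factor is present, that norm is taken on the mean product and only the operator norm of
  \<open>P j S\<close> enters; for \<open>Suc j = k\<close> the recursion for the Hilbert-Schmidt
  norm is required.\<close>

lemma D_moment:
  assumes j: "j < k" and r: "1 \<le> r"
  shows "bexp p A (\<lambda>S. D j S ^ (4 * r)) \<le> (16 * 10000 ^ k * real k * \<Phi> r) ^ (4 * r)"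
proof -
  let ?q = "\<lambda>S e. mmul V (Q (k - Suc j)) (P j S) (snd e) (fst e)"
  define hs where "hs S = hs_norm V (mmul V (Q (k - Suc j)) (P j S))" for S
  define T where "T = (L * sqrt n) ^ (k - 1) * sqrt n"
  define U where "U = (p * n + L * sqrt r) * op_scale r ^ (k - 2)"
  have pos: "0 \<le> p * n" "0 \<le> L * sqrt n" "0 \<le> L * sqrt r" "0 \<le> op_scale r" "0 \<le> T" "0 \<le> U"
    using p n L op_scale_ge[of r] by (auto simp: T_def U_def)
  have "bexp p A (\<lambda>S. D j S ^ (2 * (2 * r))) \<le>
    bexp p A (\<lambda>S. (120 * real (2 * r) * (\<Sum>e\<in>R j. (?q S e)\<^sup>2) / ln (2 / p)) ^ (2 * r))"
    unfolding D_def
  proof (rule cond_linear_moment[OF p A R(2)[OF j] B_disj[OF j] B_sub])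
    show "?q S e = ?q (S \<inter> B j) e" for S e
      using P_local by metis
  qed (use j r in auto)
  also have "\<dots> \<le> bexp p A (\<lambda>S. (16 * (L * sqrt r)) ^ (4 * r) * hs S ^ (4 * r))"
  proof (intro bexp_mono)
    fix S
    have "(\<Sum>e\<in>R j. (?q S e)\<^sup>2)
        \<le> (\<Sum>e\<in>V \<times> V. (?q S e)\<^sup>2)"
      using V R(1)[OF j] by (intro sum_mono2) auto
    also have "\<dots> = (\<Sum>a\<in>V. \<Sum>b\<in>V. (mmul V (Q (k - Suc j)) (P j S) b a)\<^sup>2)"
      by (simp add: sum.cartesian_product case_prod_unfold)
    also have "\<dots> = (hs S)\<^sup>2" unfolding hs_def hs_norm_square by (rule sum.swap)
    \<comment> \<open>The factor \<open>120 * 2 = 240\<close> is rounded up to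
      \<open>256 = 16\<^sup>2\<close>.\<close>
    finally have "(120 * real (2 * r) * (\<Sum>e\<in>R j. (?q S e)\<^sup>2) / La)
        \<le> 256 * real r * (hs S)\<^sup>2 / La"
      using La by (intro divide_right_mono, rule_tac mult_mono) (auto intro!: sum_nonneg)
    also have "\<dots> = (16 * (L * sqrt r) * hs S)\<^sup>2" by (simp add: power_mult_distrib L2)
    finally have "(120 * real (2 * r) * (\<Sum>e\<in>R j. (?q S e)\<^sup>2) / ln (2 / p)) ^ (2 * r)
        \<le> ((16 * (L * sqrt r) * hs S)\<^sup>2) ^ (2 * r)"
      unfolding La_def[symmetric] using La
      by (intro power_mono divide_nonneg_nonneg mult_nonneg_nonneg sum_nonneg) auto
    also have "\<dots> = (16 * (L * sqrt r) * hs S) ^ (4 * r)" by (rule square_power_double)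
    finally show "(120 * real (2 * r) * (\<Sum>e\<in>R j. (?q S e)\<^sup>2) / ln (2 / p)) ^ (2 * r)
      \<le> (16 * (L * sqrt r)) ^ (4 * r) * hs S ^ (4 * r)" by (simp only: power_mult_distrib)
  qed (use p in auto)
  also have "\<dots> = (16 * (L * sqrt r)) ^ (4 * r) * bexp p A (\<lambda>S. hs S ^ (4 * r))" by (rule bexp_cmult)
  finally have lin: "bexp p A (\<lambda>S. D j S ^ (4 * r)) \<le> (16 * (L * sqrt r)) ^ (4 * r) * bexp p A (\<lambda>S. hs S ^ (4 * r))"
    by simp
  have "bexp p A (\<lambda>S. hs S ^ (4 * r)) \<le> (10000 ^ k * real k * (T + U)) ^ (4 * r)"
  proof (cases "Suc j = k")
    case True
    have "hs S = hs_norm V (P j S)" for S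
    proof -
      have "k - Suc j = 0" using True by simp
      then show ?thesis unfolding hs_def using V by (intro hs_norm_cong) (simp add: mmul_idm_left)
    qed
    then have "bexp p A (\<lambda>S. hs S ^ (4 * r)) \<le> (10000 ^ j * hs_scale r j) ^ (4 * r)"
      using hs_P_moment[of j r] j r by simp
    also have "\<dots> \<le> (10000 ^ k * (real k * (T + U))) ^ (4 * r)"
    proof (intro power_mono mult_mono)
      have "hs_scale r j \<le> T + real j * U"
        using hs_scale_le[of r j] True by (auto simp: T_def U_def numeral_2_eq_2)
      also have "\<dots> \<le> real k * T + real k * U"
        using pos k True by (intro add_mono mult_right_mono mult_le_cancel_right1[THEN iffD2]) auto
      finally show "hs_scale r j \<le> real k * (T + U)" by (simp add: distrib_left)
      show "(10000::real) ^ j \<le> 10000 ^ k" using j by (intro power_increasing) auto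
    qed (use hs_scale_nonneg[of r j] in auto)
    finally show ?thesis by (simp add: mult.assoc)
  next
    case False
    define m where "m = k - Suc (Suc j)"
    have m: "k - Suc j = Suc m" "m + j = k - 2" using False j by (auto simp: m_def)
    have "hs S \<le> (p * n) ^ Suc m * \<rho> j S" for S
    proof -
      have "hs S \<le> hs_norm V (Q (k - Suc j)) * \<rho> j S"
        unfolding hs_def using j by (intro hs_norm_mmul_left op_bound_P) auto
      also have "\<dots> \<le> (p * n) ^ Suc m * \<rho> j S"
        unfolding m(1)[symmetric] using j False by (intro mult_right_mono hs_norm_Q rho_nonneg) auto
      finally show ?thesis .
    qed
    then have "bexp p A (\<lambda>S. hs S ^ (4 * r)) \<le> bexp p A (\<lambda>S. ((p * n) ^ Suc m * \<rho> j S) ^ (4 * r))"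
      using p by (intro bexp_mono power_mono) (auto simp: hs_def)
    also have "\<dots> = ((p * n) ^ Suc m) ^ (4 * r) * bexp p A (\<lambda>S. \<rho> j S ^ (4 * r))"
      by (simp only: power_mult_distrib bexp_cmult)
    also have "\<dots> \<le> ((p * n) ^ Suc m) ^ (4 * r) * ((10000 * op_scale r) ^ j) ^ (4 * r)"
      using j r by (intro mult_left_mono rho_moment) (auto simp: zero_le_even_power)
    also have "\<dots> = ((p * n) ^ Suc m * (10000 * op_scale r) ^ j) ^ (4 * r)" by (rule power_mult_distrib[symmetric])
    also have "\<dots> \<le> (10000 ^ k * (real k * (T + U))) ^ (4 * r)"
    proof (intro power_mono)
      have "(p * n) ^ Suc m * (10000 * op_scale r) ^ j = 10000 ^ j * ((p * n) * ((p * n) ^ m * op_scale r ^ j))"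
        by (simp add: power_mult_distrib)
      also have "\<dots> \<le> 10000 ^ k * ((p * n + L * sqrt r) * (op_scale r ^ m * op_scale r ^ j))"
        using pos j p n op_scale_ge[of r] by (intro mult_mono power_mono power_increasing mult_nonneg_nonneg) auto
      also have "\<dots> = 10000 ^ k * U" by (simp add: U_def m(2)[symmetric] power_add)
      also have "\<dots> \<le> 10000 ^ k * (real k * (T + U))"
      proof (intro mult_left_mono)
        have "1 * U \<le> real k * (T + U)" using pos k by (intro mult_mono) auto
        then show "U \<le> real k * (T + U)" by simp
      qed auto
      finally show "(p * n) ^ Suc m * (10000 * op_scale r) ^ j \<le> 10000 ^ k * (real k * (T + U))" .
    qed (use pos in auto)
    finally show ?thesis by (simp add: mult.assoc)
  qed
  then have "(16 * (L * sqrt r)) ^ (4 * r) * bexp p A (\<lambda>S. hs S ^ (4 * r))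
      \<le> (16 * (L * sqrt r)) ^ (4 * r) * (10000 ^ k * real k * (T + U)) ^ (4 * r)"
    by (intro mult_left_mono) (auto simp: zero_le_even_power)
  also have "\<dots> = (16 * 10000 ^ k * real k * \<Phi> r) ^ (4 * r)"
    unfolding power_mult_distrib[symmetric] \<Phi>_def T_def U_def by (simp add: mult_ac)
  finally show ?thesis using lin by simp
qed

lemma trace_moment:
  assumes r: "1 \<le> r"
  shows "bexp p A (\<lambda>S. (mtrace V (P k S) - bexp p A (\<lambda>S. mtrace V (P k S))) ^ (4 * r))
    \<le> (64 * 10000 ^ k * (real k)\<^sup>2 * \<Phi> r) ^ (4 * r)"
proof -
  define K where "K = 16 * 10000 ^ k * real k * \<Phi> r"
  have "bexp p A (\<lambda>S. (mtrace V (P k S) - bexp p A (\<lambda>S. mtrace V (P k S))) ^ (4 * r))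
      \<le> 4 ^ (4 * r) * bexp p A (\<lambda>S. (mtrace V (P k S) - mtrace V (Q k)) ^ (4 * r))"
    using p A by (intro bexp_center) auto
  also have "\<dots> \<le> 4 ^ (4 * r) * bexp p A (\<lambda>S. real k ^ (4 * r - 1) * (\<Sum>j<k. D j S ^ (4 * r)))"
    unfolding telescope using p r sum_power_le_card[of "{..<k}" "4 * r"]
    by (intro mult_left_mono bexp_mono) auto
  also have "\<dots> = 4 ^ (4 * r) * (real k ^ (4 * r - 1) * (\<Sum>j<k. bexp p A (\<lambda>S. D j S ^ (4 * r))))"
    by (simp only: bexp_cmult bexp_sum)
  also have "\<dots> \<le> 4 ^ (4 * r) * (real k ^ (4 * r - 1) * (\<Sum>j<k. K ^ (4 * r)))"
    unfolding K_def using r by (intro mult_left_mono sum_mono D_moment) auto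
  also have "(\<Sum>j<k. K ^ (4 * r)) = real k * K ^ (4 * r)" by simp
  also have "4 ^ (4 * r) * (real k ^ (4 * r - 1) * (real k * K ^ (4 * r))) = 4 ^ (4 * r) * (real k ^ Suc (4 * r - 1) * K ^ (4 * r))"
    by simp
  also have "Suc (4 * r - 1) = 4 * r" using r by simp
  also have "4 ^ (4 * r) * (real k ^ (4 * r) * K ^ (4 * r)) = (4 * (real k * K)) ^ (4 * r)"
    by (simp only: power_mult_distrib)
  also have "4 * (real k * K) = 64 * 10000 ^ k * (real k)\<^sup>2 * \<Phi> r"
    by (simp add: K_def power2_eq_square)
  finally show ?thesis .
qed

end

section \<open>Colourings and cycle embeddings\<close>

lemma sum_PiE_insert:
  assumes "x \<notin> I"
  shows "(\<Sum>\<phi>\<in>insert x I \<rightarrow>\<^sub>E V. f \<phi>) = (\<Sum>\<phi>\<in>I \<rightarrow>\<^sub>E V. \<Sum>b\<in>V. f (\<phi>(x := b)))"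
proof -
  have "(\<Sum>\<phi>\<in>insert x I \<rightarrow>\<^sub>E V. f \<phi>) = (\<Sum>(b, \<phi>)\<in>V \<times> (I \<rightarrow>\<^sub>E V). f (\<phi>(x := b)))"
    unfolding PiE_insert_eq
    by (subst sum.reindex[OF inj_combinator[OF assms]]) (simp add: case_prod_unfold)
  also have "\<dots> = (\<Sum>b\<in>V. \<Sum>\<phi>\<in>I \<rightarrow>\<^sub>E V. f (\<phi>(x := b)))"
    by (simp add: sum.cartesian_product)
  also have "\<dots> = (\<Sum>\<phi>\<in>I \<rightarrow>\<^sub>E V. \<Sum>b\<in>V. f (\<phi>(x := b)))" by (rule sum.swap)
  finally show ?thesis .
qed

context walk_model
begin

text \<open>The weight \<open>g\<close> on the two end points is arbitrary so that the induction can
  absorb the last step into it. Closing the walk is the special case where \<open>g\<close> is the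
  transpose of the last factor.\<close>

lemma walk_sum:
  "(\<Sum>\<phi>\<in>{..<Suc m} \<rightarrow>\<^sub>E V. (\<Prod>j<m. M j S (\<phi> j) (\<phi> (Suc j))) * g (\<phi> 0) (\<phi> m))
    = (\<Sum>a\<in>V. \<Sum>b\<in>V. P m S a b * g a b)"
proof (induction m arbitrary: g)
  case 0
  have "(\<Sum>\<phi>\<in>{..<Suc 0} \<rightarrow>\<^sub>E V. g (\<phi> 0) (\<phi> 0)) = (\<Sum>a\<in>V. g a a)"
    using sum_PiE_insert[of 0 "{}" "\<lambda>\<phi>. g (\<phi> 0) (\<phi> 0)" V] by (simp add: lessThan_Suc)
  then show ?case
    using V by (simp add: idm_def of_bool_def if_distrib[of "\<lambda>x. x * _"] cong: if_cong)
next
  case (Suc m)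
  have "(\<Sum>\<phi>\<in>{..<Suc (Suc m)} \<rightarrow>\<^sub>E V. (\<Prod>j<Suc m. M j S (\<phi> j) (\<phi> (Suc j))) * g (\<phi> 0) (\<phi> (Suc m)))
    = (\<Sum>\<phi>\<in>{..<Suc m} \<rightarrow>\<^sub>E V. \<Sum>b\<in>V. (\<Prod>j<m. M j S (\<phi> j) (\<phi> (Suc j))) * M m S (\<phi> m) b * g (\<phi> 0) b)"
    by (subst lessThan_Suc, subst sum_PiE_insert) simp_all
  also have "\<dots> = (\<Sum>\<phi>\<in>{..<Suc m} \<rightarrow>\<^sub>E V. (\<Prod>j<m. M j S (\<phi> j) (\<phi> (Suc j))) * (\<lambda>a c. \<Sum>b\<in>V. M m S c b * g a b) (\<phi> 0) (\<phi> m))"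
    by (simp add: sum_distrib_left mult.assoc)
  also have "\<dots> = (\<Sum>a\<in>V. \<Sum>c\<in>V. P m S a c * (\<Sum>b\<in>V. M m S c b * g a b))"
    by (rule Suc.IH)
  also have "\<dots> = (\<Sum>a\<in>V. \<Sum>c\<in>V. \<Sum>b\<in>V. P m S a c * M m S c b * g a b)"
    by (simp add: sum_distrib_left mult.assoc)
  also have "\<dots> = (\<Sum>a\<in>V. \<Sum>b\<in>V. \<Sum>c\<in>V. P m S a c * M m S c b * g a b)"
    by (intro sum.cong refl sum.swap)
  finally show ?case by (simp add: mmul_def sum_distrib_right)
qed

lemma trace_eq_walk_sum:
  "mtrace V (P k S) = (\<Sum>\<phi>\<in>{..<k} \<rightarrow>\<^sub>E V. \<Prod>j<k. M j S (\<phi> j) (\<phi> (Suc j mod k)))"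
proof -
  obtain m where m: "k = Suc m" using k by (cases k) auto
  have "(\<Prod>j<k. M j S (\<phi> j) (\<phi> (Suc j mod k))) = (\<Prod>j<m. M j S (\<phi> j) (\<phi> (Suc j))) * M m S (\<phi> m) (\<phi> 0)" for \<phi>
  proof -
    have "(\<Prod>j<m. M j S (\<phi> j) (\<phi> (Suc j mod Suc m))) = (\<Prod>j<m. M j S (\<phi> j) (\<phi> (Suc j)))"
      by (intro prod.cong refl) auto
    then show ?thesis unfolding m by simp
  qed
  then have "(\<Sum>\<phi>\<in>{..<k} \<rightarrow>\<^sub>E V. \<Prod>j<k. M j S (\<phi> j) (\<phi> (Suc j mod k)))
      = (\<Sum>\<phi>\<in>{..<Suc m} \<rightarrow>\<^sub>E V. (\<Prod>j<m. M j S (\<phi> j) (\<phi> (Suc j))) * (\<lambda>a b. M m S b a) (\<phi> 0) (\<phi> m))"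
    by (simp add: m)
  also have "\<dots> = (\<Sum>a\<in>V. \<Sum>b\<in>V. P m S a b * M m S b a)" by (rule walk_sum)
  finally show ?thesis by (simp add: m mtrace_def mmul_def)
qed

end

section \<open>Colour classes as factors\<close>

lemma Suc_mod_neq:
  assumes "2 \<le> k" "j < k"
  shows "Suc j mod k \<noteq> j" "Suc j mod k < k"
  using assms by (cases "Suc j = k"; simp)+

text \<open>The pairs are directed from colour \<open>j\<close> to the next colour. The two ends
  have different colours, so the unordered edge determines the ordered pair.\<close>

definition colour_rel :: "nat \<Rightarrow> 'v set \<Rightarrow> ('v \<Rightarrow> nat) \<Rightarrow> nat \<Rightarrow> ('v \<times> 'v) set" where
  "colour_rel k V \<sigma> j = {(a, b). a \<in> V \<and> b \<in> V \<and> \<sigma> a = j \<and> \<sigma> b = Suc j mod k}"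

definition pair_set :: "'v \<times> 'v \<Rightarrow> 'v set" where
  "pair_set e = {fst e, snd e}"

text \<open>Otherwise each index would be the cyclic successor of the other, so that adding 2 modulo
  \<open>k\<close> fixes \<open>i\<close>. This fails for \<open>k = 2\<close>, where both steps of
  the cycle use the same pair of colours.\<close>

lemma cyclic_edge_inj:
  assumes "3 \<le> k" "i < k" "j < k" "{i, Suc i mod k} = {j, Suc j mod k}"
  shows "i = j"
proof (rule ccontr)
  assume "i \<noteq> j"
  then have e: "i = Suc j mod k" "j = Suc i mod k" using assms(4) by (auto simp: doubleton_eq_iff)
  then have "i = Suc (Suc i mod k) mod k" by simp
  then have "i = (i + 2) mod k" by (simp add: mod_Suc_eq)
  moreover have "(i + 2) mod k = (if i + 2 < k then i + 2 else i + 2 - k)"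
    using assms by (simp add: le_mod_geq)
  ultimately show False using assms by (simp split: if_splits)
qed

lemma walk_model_colouring:
  fixes p :: real
  assumes "3 \<le> k" "0 < p" "p \<le> 1" "finite V" "V \<noteq> {}"
  shows "walk_model p V (all_pairs V) (colour_rel k V \<sigma>) pair_set k"
proof
  fix i j assume ij: "i < k" "j < k" "i \<noteq> j"
  have "False" if "x \<in> pair_set ` colour_rel k V \<sigma> i" "x \<in> pair_set ` colour_rel k V \<sigma> j" for x
  proof -
    \<comment> \<open>The set of colours of an edge reveals which factor it belongs to; this is the
      disjointness of the factors.\<close>
    have col: "\<sigma> ` pair_set e = {l, Suc l mod k}" if "e \<in> colour_rel k V \<sigma> l" for e l
      using that by (auto simp: colour_rel_def pair_set_def)
    have "\<sigma> ` x = {i, Suc i mod k}" "\<sigma> ` x = {j, Suc j mod k}"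
      using that col by blast+
    then show False using cyclic_edge_inj[OF assms(1) ij(1,2)] ij(3) by metis
  qed
  then show "pair_set ` colour_rel k V \<sigma> i \<inter> pair_set ` colour_rel k V \<sigma> j = {}" by blast
next
  fix j assume j: "j < k"
  then have neq: "Suc j mod k \<noteq> j" using assms(1) by (intro Suc_mod_neq) auto
  show "inj_on pair_set (colour_rel k V \<sigma> j)"
    using neq by (auto simp: inj_on_def colour_rel_def pair_set_def doubleton_eq_iff)
  show "pair_set ` colour_rel k V \<sigma> j \<subseteq> all_pairs V"
    using neq by (auto simp: colour_rel_def pair_set_def all_pairs_def card_insert_if)
  show "colour_rel k V \<sigma> j \<subseteq> V \<times> V" by (auto simp: colour_rel_def)
next
  have "all_pairs V \<subseteq> Pow V" by (auto simp: all_pairs_def)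
  then show "finite (all_pairs V)" using assms(4) finite_subset by blast
qed (use assms in auto)

definition closed_walks :: "nat \<Rightarrow> 'v set \<Rightarrow> 'v set set \<Rightarrow> (nat \<Rightarrow> 'v) set" where
  "closed_walks k V S = {\<phi> \<in> {..<k} \<rightarrow>\<^sub>E V. \<forall>j<k. {\<phi> j, \<phi> (Suc j mod k)} \<in> S}"

definition cycle_embeddings :: "nat \<Rightarrow> 'v set \<Rightarrow> 'v set set \<Rightarrow> (nat \<Rightarrow> 'v) set" where
  "cycle_embeddings k V S = {\<phi> \<in> closed_walks k V S. inj_on \<phi> {..<k}}"

lemma coloured_trace:
  fixes p :: real
  assumes "3 \<le> k" "0 < p" "p \<le> 1" "finite V" "V \<noteq> {}"
  shows "mtrace V (walk_model.P V (colour_rel k V \<sigma>) pair_set k S)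
    = (\<Sum>\<phi>\<in>closed_walks k V S. of_bool (\<forall>j<k. \<sigma> (\<phi> j) = j))"
proof -
  interpret walk_model p V "all_pairs V" "colour_rel k V \<sigma>" pair_set k
    using assms by (rule walk_model_colouring)
  have fin: "finite ({..<k} \<rightarrow>\<^sub>E V)" using assms by (intro finite_PiE) auto
  have prod_bool: "(\<Prod>j<k. of_bool (b j) :: real) = of_bool (\<forall>j<k. b j)" for b
    by (induction k) (auto simp: less_Suc_eq)
  have "(\<Prod>j<k. M j S (\<phi> j) (\<phi> (Suc j mod k)))
      = of_bool (\<phi> \<in> closed_walks k V S) * of_bool (\<forall>j<k. \<sigma> (\<phi> j) = j)" if "\<phi> \<in> {..<k} \<rightarrow>\<^sub>E V" for \<phi>
  proof -
    have V: "\<phi> j \<in> V" if "j < k" for j using \<open>\<phi> \<in> {..<k} \<rightarrow>\<^sub>E V\<close> that by auto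
    have lt: "Suc j mod k < k" for j using assms by simp
    have "(\<Prod>j<k. M j S (\<phi> j) (\<phi> (Suc j mod k)))
        = (\<Prod>j<k. of_bool (\<sigma> (\<phi> j) = j \<and> \<sigma> (\<phi> (Suc j mod k)) = Suc j mod k \<and> {\<phi> j, \<phi> (Suc j mod k)} \<in> S))"
      using V lt by (intro prod.cong refl) (auto simp: M_def colour_rel_def pair_set_def)
    also have "\<dots> = of_bool (\<phi> \<in> closed_walks k V S) * of_bool (\<forall>j<k. \<sigma> (\<phi> j) = j)"
      unfolding prod_bool using that lt by (auto simp: closed_walks_def)
    finally show ?thesis .
  qed
  then have "mtrace V (P k S) = (\<Sum>\<phi>\<in>{..<k} \<rightarrow>\<^sub>E V. of_bool (\<phi> \<in> closed_walks k V S) * of_bool (\<forall>j<k. \<sigma> (\<phi> j) = j))"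
    unfolding trace_eq_walk_sum by (intro sum.cong) auto
  also have "\<dots> = (\<Sum>\<phi>\<in>closed_walks k V S. of_bool (\<phi> \<in> closed_walks k V S) * of_bool (\<forall>j<k. \<sigma> (\<phi> j) = j))"
    using fin by (intro sum.mono_neutral_right) (auto simp: closed_walks_def)
  finally show ?thesis by simp
qed

text \<open>The condition makes \<open>\<sigma>\<close> a left inverse of \<open>\<phi>\<close>,
  which is impossible unless \<open>\<phi>\<close> is injective; if it is, the colours on its image
  are forced and the others free. Summing over colourings therefore discards the walks with repeated
  vertices and gives all cycle embeddings the same weight.\<close>

lemma card_compatible_colourings:
  assumes "finite V" "\<phi> \<in> {..<k} \<rightarrow>\<^sub>E V" "1 \<le> k"
  shows "card {\<sigma> \<in> V \<rightarrow>\<^sub>E {..<k}. \<forall>j<k. \<sigma> (\<phi> j) = j} = of_bool (inj_on \<phi> {..<k}) * k ^ (card V - k)"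
proof (cases "inj_on \<phi> {..<k}")
  case True
  define F where "F v = (if v \<in> \<phi> ` {..<k} then {the_inv_into {..<k} \<phi> v} else {..<k})" for v
  have inv: "the_inv_into {..<k} \<phi> (\<phi> j) = j" if "j < k" for j
    using True that by (simp add: the_inv_into_f_f)
  have "{\<sigma> \<in> V \<rightarrow>\<^sub>E {..<k}. \<forall>j<k. \<sigma> (\<phi> j) = j} = PiE V F"
  proof (intro equalityI subsetI)
    fix \<sigma> assume "\<sigma> \<in> {\<sigma> \<in> V \<rightarrow>\<^sub>E {..<k}. \<forall>j<k. \<sigma> (\<phi> j) = j}"
    then show "\<sigma> \<in> PiE V F" by (auto simp: F_def inv PiE_def Pi_def)
  next
    fix \<sigma> assume chi: "\<sigma> \<in> PiE V F"
    have "\<sigma> (\<phi> j) = j" if "j < k" for j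
    proof -
      have "\<phi> j \<in> V" using assms that by auto
      then have "\<sigma> (\<phi> j) \<in> F (\<phi> j)" using chi by auto
      then show ?thesis using that by (simp add: F_def inv)
    qed
    moreover have "F v \<subseteq> {..<k}" for v using inv by (auto simp: F_def)
    ultimately show "\<sigma> \<in> {\<sigma> \<in> V \<rightarrow>\<^sub>E {..<k}. \<forall>j<k. \<sigma> (\<phi> j) = j}" using chi by blast
  qed
  then have "card {\<sigma> \<in> V \<rightarrow>\<^sub>E {..<k}. \<forall>j<k. \<sigma> (\<phi> j) = j} = (\<Prod>v\<in>V. card (F v))"
    using assms by (simp add: card_PiE)
  also have "\<dots> = (\<Prod>v\<in>V - \<phi> ` {..<k}. k)"
    using assms by (intro prod.mono_neutral_cong_right) (auto simp: F_def)
  also have "\<dots> = k ^ (card V - k)"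
  proof -
    have "\<phi> ` {..<k} \<subseteq> V" using assms by auto
    then have "card (V - \<phi> ` {..<k}) = card V - k"
      using True by (simp add: card_Diff_subset card_image)
    then show ?thesis by simp
  qed
  finally show ?thesis using True by simp
next
  case False
  then obtain i j where "i < k" "j < k" "\<phi> i = \<phi> j" "i \<noteq> j" by (auto simp: inj_on_def)
  then have "\<not> (\<forall>j<k. \<sigma> (\<phi> j) = j)" for \<sigma> by metis
  then have e: "{\<sigma> \<in> V \<rightarrow>\<^sub>E {..<k}. \<forall>j<k. \<sigma> (\<phi> j) = j} = {}" by blast
  show ?thesis unfolding e using False by simp
qed

lemma sum_coloured_traces:
  fixes p :: real
  assumes "3 \<le> k" "0 < p" "p \<le> 1" "finite V" "V \<noteq> {}"
  shows "(\<Sum>\<sigma>\<in>V \<rightarrow>\<^sub>E {..<k}. mtrace V (walk_model.P V (colour_rel k V \<sigma>) pair_set k S))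
    = real (card (cycle_embeddings k V S)) * real k ^ (card V - k)"
proof -
  have fin: "finite (closed_walks k V S)"
    unfolding closed_walks_def using assms by (auto intro!: finite_PiE)
  have finc: "finite (V \<rightarrow>\<^sub>E {..<k})" using assms by (intro finite_PiE) auto
  have "(\<Sum>\<sigma>\<in>V \<rightarrow>\<^sub>E {..<k}. mtrace V (walk_model.P V (colour_rel k V \<sigma>) pair_set k S))
      = (\<Sum>\<phi>\<in>closed_walks k V S. \<Sum>\<sigma>\<in>V \<rightarrow>\<^sub>E {..<k}. of_bool (\<forall>j<k. \<sigma> (\<phi> j) = j))"
    unfolding coloured_trace[OF assms] by (rule sum.swap)
  also have "\<dots> = (\<Sum>\<phi>\<in>closed_walks k V S. of_bool (inj_on \<phi> {..<k}) * real k ^ (card V - k))"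
  proof (intro sum.cong refl)
    fix \<phi> assume "\<phi> \<in> closed_walks k V S"
    then have "card {\<sigma> \<in> V \<rightarrow>\<^sub>E {..<k}. \<forall>j<k. \<sigma> (\<phi> j) = j} = of_bool (inj_on \<phi> {..<k}) * k ^ (card V - k)"
      using assms by (intro card_compatible_colourings) (auto simp: closed_walks_def)
    moreover have "(\<Sum>\<sigma>\<in>V \<rightarrow>\<^sub>E {..<k}. of_bool (\<forall>j<k. \<sigma> (\<phi> j) = j))
        = real (card {\<sigma> \<in> V \<rightarrow>\<^sub>E {..<k}. \<forall>j<k. \<sigma> (\<phi> j) = j})"
      using finc by (simp add: Int_def)
    ultimately show "(\<Sum>\<sigma>\<in>V \<rightarrow>\<^sub>E {..<k}. of_bool (\<forall>j<k. \<sigma> (\<phi> j) = j))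
        = of_bool (inj_on \<phi> {..<k}) * real k ^ (card V - k)" by simp
  qed
  also have "\<dots> = real (card (cycle_embeddings k V S)) * real k ^ (card V - k)"
    using fin by (simp add: sum_distrib_right[symmetric] cycle_embeddings_def Int_def)
  finally show ?thesis .
qed

text \<open>This is \<open>\<Phi>\<close> of the walk model in terms of \<open>k\<close>,
  \<open>n\<close> and \<open>p\<close> only; the colouring does not enter.\<close>

definition moment_scale :: "nat \<Rightarrow> nat \<Rightarrow> real \<Rightarrow> nat \<Rightarrow> real" where
  "moment_scale k n p r =
     Lp p * sqrt r * ((Lp p * sqrt n) ^ (k - 1) * sqrt n
       + (p * n + Lp p * sqrt r) * (p * n + Lp p * (sqrt n + sqrt r)) ^ (k - 2))"

lemma Lp_eq: "0 < p \<Longrightarrow> p \<le> 1 \<Longrightarrow> Lp p = 1 / sqrt (ln (2 / p))"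
proof -
  assume p: "0 < p" "p \<le> 1"
  have "Lp p = ln (2 / p) powr (- (1 / 2))" by (simp add: Lp_def)
  also have "\<dots> = 1 / sqrt (ln (2 / p))"
    using ln_two_div_ge(2)[OF p] by (subst powr_minus_divide) (simp add: powr_half_sqrt)
  finally show ?thesis .
qed

text \<open>The count is \<open>k ^ k\<close> times the average of the coloured traces, as an
  embedding is compatible with one colouring in \<open>k ^ k\<close>. The power mean inequality
  passes the uniform bound for a colouring to the average, whence the base
  \<open>10000 * real k\<close>.\<close>

lemma embeddings_moment:
  fixes p :: real
  assumes k: "3 \<le> k" and p: "0 < p" "p \<le> 1" and V: "finite V" "V \<noteq> {}" and r: "1 \<le> r"
  defines "N \<equiv> \<lambda>S. real (card (cycle_embeddings k V S))"
  shows "bexp p (all_pairs V) (\<lambda>S. (N S - bexp p (all_pairs V) N) ^ (4 * r))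
    \<le> (64 * (10000 * real k) ^ k * (real k)\<^sup>2 * moment_scale k (card V) p r) ^ (4 * r)"
\<comment> \<open>With fewer than \<open>k\<close> vertices there is no embedding at all, so the
  count is constant; the colouring argument uses \<open>card V - k\<close> as a true
  difference.\<close>
proof (cases "k \<le> card V")
  case False
  have "cycle_embeddings k V S = {}" for S
  proof -
    have "\<phi> ` {..<k} \<subseteq> V" if "\<phi> \<in> cycle_embeddings k V S" for \<phi>
      using that by (auto simp: cycle_embeddings_def closed_walks_def)
    moreover have "card (\<phi> ` {..<k}) = k" if "\<phi> \<in> cycle_embeddings k V S" for \<phi>
      using that by (simp add: cycle_embeddings_def card_image)
    ultimately show ?thesis using V False by (metis all_not_in_conv card_mono)
  qed
  then show ?thesis using r by (simp add: N_def bexp_def power_0_left zero_le_even_power)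
next
  case True
  let ?A = "all_pairs V"
  have A: "finite ?A" by (rule finite_subset[of _ "Pow V"]) (use V in \<open>auto simp: all_pairs_def\<close>)
  define f where "f \<sigma> S = mtrace V (walk_model.P V (colour_rel k V \<sigma>) pair_set k S)" for \<sigma> S
  define C where "C = V \<rightarrow>\<^sub>E {..<k}"
  define K where "K = 64 * 10000 ^ k * (real k)\<^sup>2 * moment_scale k (card V) p r"
  define d where "d = real k ^ (card V - k)"
  have d: "0 < d" using k by (simp add: d_def)
  have C: "finite C" using V by (auto simp: C_def intro: finite_PiE)
  have cardC: "real (card C) = d * real k ^ k"
    using V True by (simp add: C_def card_PiE d_def power_add[symmetric])
  let ?d = "\<lambda>\<sigma> S. f \<sigma> S - bexp p ?A (f \<sigma>)"
  have fm: "bexp p ?A (\<lambda>S. ?d \<sigma> S ^ (4 * r)) \<le> K ^ (4 * r)" for \<sigma>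
  proof -
    interpret walk_model p V ?A "colour_rel k V \<sigma>" pair_set k
      using k p V by (rule walk_model_colouring)
    have "\<Phi> r = moment_scale k (card V) p r"
      using p by (simp add: \<Phi>_def moment_scale_def op_scale_def L_def La_def n_def Lp_eq)
    then show ?thesis using trace_moment[OF r] by (simp add: f_def[abs_def] K_def)
  qed
  have Nf: "N S = 1 / d * (\<Sum>\<sigma>\<in>C. f \<sigma> S)" for S
    unfolding N_def f_def C_def using d by (simp add: sum_coloured_traces[OF k p V] flip: d_def)
  then have EN: "bexp p ?A N = 1 / d * (\<Sum>\<sigma>\<in>C. bexp p ?A (f \<sigma>))"
    unfolding Nf[abs_def] by (simp only: bexp_cmult bexp_sum)
  have pt: "(N S - bexp p ?A N) ^ (4 * r)
      \<le> 1 / d ^ (4 * r) * (real (card C) ^ (4 * r - 1) * (\<Sum>\<sigma>\<in>C. ?d \<sigma> S ^ (4 * r)))" for S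
  proof -
    have "N S - bexp p ?A N = 1 / d * (\<Sum>\<sigma>\<in>C. ?d \<sigma> S)"
      unfolding EN unfolding Nf by (simp only: sum_subtractf right_diff_distrib)
    then have "(N S - bexp p ?A N) ^ (4 * r) = 1 / d ^ (4 * r) * (\<Sum>\<sigma>\<in>C. ?d \<sigma> S) ^ (4 * r)"
      by (simp only: power_mult_distrib power_one_over)
    also have "\<dots> \<le> 1 / d ^ (4 * r) * (real (card C) ^ (4 * r - 1) * (\<Sum>\<sigma>\<in>C. ?d \<sigma> S ^ (4 * r)))"
      using C d r by (intro mult_left_mono sum_power_le_card) auto
    finally show ?thesis .
  qed
  have "bexp p ?A (\<lambda>S. (N S - bexp p ?A N) ^ (4 * r))
    \<le> bexp p ?A (\<lambda>S. 1 / d ^ (4 * r) * (real (card C) ^ (4 * r - 1) * (\<Sum>\<sigma>\<in>C. ?d \<sigma> S ^ (4 * r))))"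
    using p pt by (intro bexp_mono) auto
  also have "\<dots> = 1 / d ^ (4 * r) * (real (card C) ^ (4 * r - 1) * (\<Sum>\<sigma>\<in>C. bexp p ?A (\<lambda>S. ?d \<sigma> S ^ (4 * r))))"
    by (simp only: bexp_cmult bexp_sum)
  also have "\<dots> \<le> 1 / d ^ (4 * r) * (real (card C) ^ (4 * r - 1) * (\<Sum>\<sigma>\<in>C. K ^ (4 * r)))"
    using d by (intro mult_left_mono sum_mono fm) auto
  also have "(\<Sum>\<sigma>\<in>C. K ^ (4 * r)) = real (card C) * K ^ (4 * r)" by simp
  also have "1 / d ^ (4 * r) * (real (card C) ^ (4 * r - 1) * (real (card C) * K ^ (4 * r)))
      = 1 / d ^ (4 * r) * (real (card C) ^ Suc (4 * r - 1) * K ^ (4 * r))" by simp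
  also have "Suc (4 * r - 1) = 4 * r" using r by simp
  also have "1 / d ^ (4 * r) * (real (card C) ^ (4 * r) * K ^ (4 * r)) = (1 / d * (real (card C) * K)) ^ (4 * r)"
    by (simp only: power_mult_distrib power_one_over)
  also have "1 / d * (real (card C) * K) = 64 * (10000 * real k) ^ k * (real k)\<^sup>2 * moment_scale k (card V) p r"
    unfolding cardC K_def using d by (simp add: power_mult_distrib)
  finally show ?thesis .
qed

section \<open>Copies of the cycle as classes of labelled embeddings\<close>

lemma isomorphic_sym:
  assumes "isomorphic G H"
  shows "isomorphic H G"
proof -
  obtain \<phi> where \<phi>: "bij_betw \<phi> (verts G) (verts H)"
    "\<forall>u\<in>verts G. \<forall>v\<in>verts G. {u, v} \<in> edges G \<longleftrightarrow> {\<phi> u, \<phi> v} \<in> edges H"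
    using assms by (auto simp: isomorphic_def)
  let ?g = "the_inv_into (verts G) \<phi>"
  have g: "?g x \<in> verts G" "\<phi> (?g x) = x" if "x \<in> verts H" for x
  proof -
    have "x \<in> \<phi> ` verts G" "inj_on \<phi> (verts G)" using that \<phi>(1) by (auto simp: bij_betw_def)
    then show "?g x \<in> verts G" "\<phi> (?g x) = x"
      by (auto intro: the_inv_into_into f_the_inv_into_f)
  qed
  show ?thesis
    unfolding isomorphic_def
  proof (intro exI conjI ballI)
    show "bij_betw ?g (verts H) (verts G)" using \<phi>(1) by (rule bij_betw_the_inv_into)
    fix u v assume "u \<in> verts H" "v \<in> verts H"
    then show "({u, v} \<in> edges H) = ({?g u, ?g v} \<in> edges G)"
      using \<phi>(2) g by simp
  qed
qed

lemma isomorphic_trans: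
  assumes "isomorphic G H" "isomorphic H K"
  shows "isomorphic G K"
proof -
  obtain \<phi> \<psi> where \<phi>: "bij_betw \<phi> (verts G) (verts H)"
    "\<forall>u\<in>verts G. \<forall>v\<in>verts G. {u, v} \<in> edges G \<longleftrightarrow> {\<phi> u, \<phi> v} \<in> edges H"
    and \<psi>: "bij_betw \<psi> (verts H) (verts K)"
    "\<forall>u\<in>verts H. \<forall>v\<in>verts H. {u, v} \<in> edges H \<longleftrightarrow> {\<psi> u, \<psi> v} \<in> edges K"
    using assms by (auto simp: isomorphic_def)
  have "\<phi> u \<in> verts H" if "u \<in> verts G" for u using that \<phi>(1) by (auto simp: bij_betw_def)
  then show ?thesis
    unfolding isomorphic_def using \<phi> \<psi> bij_betw_trans[OF \<phi>(1) \<psi>(1)]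
    by (intro exI[of _ "\<psi> \<circ> \<phi>"]) simp
qed

text \<open>Isomorphisms from the standard cycle to \<open>K\<close>, taken extensional so that they
  can be counted. For \<open>K = cycle_graph k\<close> they are the automorphisms.\<close>

definition isos :: "nat \<Rightarrow> 'b graph \<Rightarrow> (nat \<Rightarrow> 'b) set" where
  "isos k K = {\<phi> \<in> {..<k} \<rightarrow>\<^sub>E verts K. bij_betw \<phi> {..<k} (verts K) \<and>
     (\<forall>u<k. \<forall>v<k. {u, v} \<in> edges (cycle_graph k) \<longleftrightarrow> {\<phi> u, \<phi> v} \<in> edges K)}"

lemma verts_cycle_graph [simp]: "verts (cycle_graph k) = {..<k}"
  by (simp add: cycle_graph_def)

lemma finite_isos: "finite (verts K) \<Longrightarrow> finite (isos k K)"
  unfolding isos_def by (rule finite_subset[of _ "{..<k} \<rightarrow>\<^sub>E verts K"]) (auto intro: finite_PiE)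

lemma isos_nonempty:
  assumes "isomorphic K (cycle_graph k)"
  shows "isos k K \<noteq> {}"
proof -
  obtain \<phi> where \<phi>: "bij_betw \<phi> {..<k} (verts K)"
    "\<forall>u\<in>{..<k}. \<forall>v\<in>{..<k}. {u, v} \<in> edges (cycle_graph k) \<longleftrightarrow> {\<phi> u, \<phi> v} \<in> edges K"
    using isomorphic_sym[OF assms] by (auto simp: isomorphic_def)
  have "restrict \<phi> {..<k} \<in> isos k K"
    using \<phi> by (auto simp: isos_def bij_betw_def cong: bij_betw_cong)
  then show ?thesis by blast
qed

text \<open>Composition with one fixed isomorphism \<open>\<psi>\<close> carries the automorphisms
  of the standard cycle bijectively onto the isomorphisms to \<open>K\<close>.\<close>

lemma card_isos:
  assumes "isomorphic K (cycle_graph k)"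
  shows "card (isos k K) = card (isos k (cycle_graph k))"
proof -
  let ?C = "cycle_graph k"
  obtain \<psi> where \<psi>: "\<psi> \<in> isos k K" using isos_nonempty[OF assms] by blast
  have b: "bij_betw \<psi> {..<k} (verts K)"
    and e: "\<And>u v. u < k \<Longrightarrow> v < k \<Longrightarrow> {u, v} \<in> edges ?C \<longleftrightarrow> {\<psi> u, \<psi> v} \<in> edges K"
    using \<psi> by (auto simp: isos_def)
  define F where "F \<alpha> = restrict (\<psi> \<circ> \<alpha>) {..<k}" for \<alpha> :: "nat \<Rightarrow> nat"
  have inj: "inj_on \<psi> {..<k}" using b by (simp add: bij_betw_def)
  let ?g = "the_inv_into {..<k} \<psi>"
  have g: "?g x < k" "\<psi> (?g x) = x" if "x \<in> verts K" for x
  proof -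
    have "x \<in> \<psi> ` {..<k}" using that b by (auto simp: bij_betw_def)
    then show "?g x < k" "\<psi> (?g x) = x"
      using the_inv_into_into[OF inj, of x "{..<k}"] f_the_inv_into_f[OF inj] by auto
  qed
  have "bij_betw F (isos k ?C) (isos k K)"
    unfolding bij_betw_def
  proof (intro conjI equalityI subsetI)
    show "inj_on F (isos k ?C)"
    proof (rule inj_onI)
      fix \<alpha> \<beta> assume ab: "\<alpha> \<in> isos k ?C" "\<beta> \<in> isos k ?C" "F \<alpha> = F \<beta>"
      have "\<alpha> i = \<beta> i" if "i < k" for i
      proof -
        have "\<psi> (\<alpha> i) = \<psi> (\<beta> i)" using fun_cong[OF ab(3), of i] that by (simp add: F_def)
        moreover have "\<alpha> i < k" "\<beta> i < k" using ab that by (auto simp: isos_def PiE_def Pi_def)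
        ultimately show ?thesis using inj by (auto dest: inj_onD)
      qed
      then show "\<alpha> = \<beta>" using ab(1,2) by (intro PiE_ext[of \<alpha> "{..<k}" "\<lambda>_. {..<k}" \<beta>]) (auto simp: isos_def)
    qed
  next
    fix \<phi> assume "\<phi> \<in> F ` isos k ?C"
    then obtain \<alpha> where \<alpha>: "\<alpha> \<in> isos k ?C" "\<phi> = F \<alpha>" by blast
    have \<alpha>k: "\<alpha> i < k" if "i < k" for i using \<alpha> that by (auto simp: isos_def PiE_def Pi_def)
    have "bij_betw (\<psi> \<circ> \<alpha>) {..<k} (verts K)"
      using \<alpha> b by (intro bij_betw_trans[of \<alpha> _ "{..<k}"]) (auto simp: isos_def)
    then have "bij_betw \<phi> {..<k} (verts K)"
      by (rule bij_betw_cong[THEN iffD1, rotated]) (simp add: \<alpha> F_def)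
    moreover have "{u, v} \<in> edges ?C \<longleftrightarrow> {\<phi> u, \<phi> v} \<in> edges K" if "u < k" "v < k" for u v
    proof -
      have "{u, v} \<in> edges ?C \<longleftrightarrow> {\<alpha> u, \<alpha> v} \<in> edges ?C"
        using \<alpha>(1) that by (auto simp: isos_def)
      then show ?thesis using that e \<alpha>k by (simp add: \<alpha> F_def)
    qed
    ultimately show "\<phi> \<in> isos k K"
      unfolding isos_def by (auto simp: bij_betw_def \<alpha> F_def)
  next
    fix \<phi> assume \<phi>: "\<phi> \<in> isos k K"
    define \<alpha> where "\<alpha> = restrict (?g \<circ> \<phi>) {..<k}"
    have \<phi>V: "\<phi> i \<in> verts K" if "i < k" for i using \<phi> that by (auto simp: isos_def PiE_def Pi_def)
    have \<alpha>: "\<alpha> i < k" "\<psi> (\<alpha> i) = \<phi> i" if "i < k" for i using that g \<phi>V by (auto simp: \<alpha>_def)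
    have "bij_betw (?g \<circ> \<phi>) {..<k} {..<k}"
      using \<phi> bij_betw_the_inv_into[OF b] by (intro bij_betw_trans[of \<phi> _ "verts K"]) (auto simp: isos_def)
    then have "bij_betw \<alpha> {..<k} {..<k}"
      by (rule bij_betw_cong[THEN iffD1, rotated]) (simp add: \<alpha>_def)
    moreover have "{u, v} \<in> edges ?C \<longleftrightarrow> {\<alpha> u, \<alpha> v} \<in> edges ?C" if "u < k" "v < k" for u v
    proof -
      have "{u, v} \<in> edges ?C \<longleftrightarrow> {\<phi> u, \<phi> v} \<in> edges K"
        using \<phi> that by (auto simp: isos_def)
      then show ?thesis using that e \<alpha> by simp
    qed
    ultimately have "\<alpha> \<in> isos k ?C"
      unfolding isos_def using \<alpha> by (auto simp: \<alpha>_def)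
    moreover have "F \<alpha> = \<phi>"
      using \<phi> \<alpha> by (intro ext) (auto simp: F_def isos_def PiE_def extensional_def)
    ultimately show "\<phi> \<in> F ` isos k ?C" by blast
  qed
  then show ?thesis by (simp add: bij_betw_same_card)
qed

text \<open>An embedding is the same as a copy of \<open>H\<close>, namely its image, together with
  an isomorphism from the standard cycle onto that copy. The classes belonging to different copies
  are disjoint and all have as many elements as there are automorphisms.\<close>

lemma card_cycle_embeddings:
  assumes H: "is_cycle k H" and V: "finite V" and S: "S \<subseteq> all_pairs V"
  shows "card (cycle_embeddings k V S) = card (isos k (cycle_graph k)) * copies H (V, S)"
proof -
  let ?C = "cycle_graph k"
  have k: "3 \<le> k" and HC: "isomorphic H (cycle_graph k)" using H by (auto simp: is_cycle_def)
  define \<K> where "\<K> = {K. subgraph K (V, S) \<and> isomorphic K H}"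
  have neq: "Suc j mod k \<noteq> j" "Suc j mod k < k" if "j < k" for j
    using Suc_mod_neq[of k j] that k by auto
  have isoC: "isomorphic K (cycle_graph k)" if "K \<in> \<K>" for K
    using that HC by (auto simp: \<K>_def intro: isomorphic_trans)
  have fin: "finite \<K>"
  proof (rule finite_subset)
    show "\<K> \<subseteq> Pow V \<times> Pow (Pow V)"
      using S by (auto simp: \<K>_def subgraph_def all_pairs_def simple_graph_def) blast
  qed (use V in auto)
  have finI: "finite (isos k K)" if "K \<in> \<K>" for K
  proof -
    have "finite (verts K)" using that V by (auto simp: \<K>_def subgraph_def intro: finite_subset)
    then show ?thesis by (rule finite_isos)
  qed
  have eq: "cycle_embeddings k V S = (\<Union>K\<in>\<K>. isos k K)"
  proof (intro equalityI subsetI)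
    fix \<phi> assume "\<phi> \<in> cycle_embeddings k V S"
    then have \<phi>: "\<phi> \<in> {..<k} \<rightarrow>\<^sub>E V" "inj_on \<phi> {..<k}" "\<And>j. j < k \<Longrightarrow> {\<phi> j, \<phi> (Suc j mod k)} \<in> S"
      by (auto simp: cycle_embeddings_def closed_walks_def)
    define K where "K = (\<phi> ` {..<k}, (`) \<phi> ` edges ?C)"
    have eK: "edges K = (\<lambda>j. {\<phi> j, \<phi> (Suc j mod k)}) ` {..<k}"
      by (auto simp: K_def cycle_graph_def image_image)
    have subK: "subgraph K (V, S)"
      unfolding subgraph_def simple_graph_def
    proof (intro conjI)
      show "edges K \<subseteq> all_pairs (verts K)"
      proof
        fix x assume "x \<in> edges K"
        then obtain j where j: "j < k" "x = {\<phi> j, \<phi> (Suc j mod k)}" by (auto simp: eK)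
        have "\<phi> j \<noteq> \<phi> (Suc j mod k)"
          using inj_on_eq_iff[OF \<phi>(2), of j "Suc j mod k"] j(1) neq[OF j(1)] by simp
        moreover have "\<phi> j \<in> verts K" "\<phi> (Suc j mod k) \<in> verts K"
          using j(1) neq(2)[OF j(1)] by (simp_all add: K_def)
        ultimately show "x \<in> all_pairs (verts K)" unfolding j(2) all_pairs_def by simp
      qed
      show "verts K \<subseteq> verts (V, S)" using \<phi>(1) by (auto simp: K_def)
      show "edges K \<subseteq> edges (V, S)" using \<phi>(3) by (auto simp: eK)
    qed
    have iso: "\<phi> \<in> isos k K"
    proof -
      have "{u, v} \<in> edges ?C \<longleftrightarrow> {\<phi> u, \<phi> v} \<in> edges K" if "u < k" "v < k" for u v
      proof
        assume "{\<phi> u, \<phi> v} \<in> edges K"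
        then obtain e where e: "e \<in> edges ?C" "\<phi> ` {u, v} = \<phi> ` e" by (auto simp: K_def)
        moreover have "e \<subseteq> {..<k}" using e(1) neq by (auto simp: cycle_graph_def)
        ultimately have "{u, v} = e" using that inj_on_image_eq_iff[OF \<phi>(2), of "{u, v}" e] by auto
        then show "{u, v} \<in> edges ?C" using e by simp
      next
        assume "{u, v} \<in> edges ?C"
        then have "\<phi> ` {u, v} \<in> edges K" unfolding K_def by (simp only: snd_conv) (rule imageI)
        then show "{\<phi> u, \<phi> v} \<in> edges K" by simp
      qed
      then show ?thesis using \<phi> by (auto simp: isos_def K_def bij_betw_def PiE_def)
    qed
    have "isomorphic (cycle_graph k) K"
      unfolding isomorphic_def using iso by (intro exI[of _ \<phi>]) (auto simp: isos_def)
    then have "isomorphic K H" using HC by (meson isomorphic_sym isomorphic_trans)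
    then have "K \<in> \<K>" using subK by (simp add: \<K>_def)
    then show "\<phi> \<in> (\<Union>K\<in>\<K>. isos k K)" using iso by (rule UN_I)
  next
    fix \<phi> assume "\<phi> \<in> (\<Union>K\<in>\<K>. isos k K)"
    then obtain K where K: "K \<in> \<K>" "\<phi> \<in> isos k K" by blast
    have "{\<phi> j, \<phi> (Suc j mod k)} \<in> S" if "j < k" for j
    proof -
      have "{j, Suc j mod k} \<in> edges ?C" using that by (auto simp: cycle_graph_def)
      then have "{\<phi> j, \<phi> (Suc j mod k)} \<in> edges K" using K(2) that neq(2)[OF that] by (auto simp: isos_def)
      then show ?thesis using K(1) by (auto simp: \<K>_def subgraph_def)
    qed
    moreover have "\<phi> \<in> {..<k} \<rightarrow>\<^sub>E V" "inj_on \<phi> {..<k}"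
      using K by (auto simp: \<K>_def subgraph_def isos_def bij_betw_def PiE_def Pi_def)
    ultimately show "\<phi> \<in> cycle_embeddings k V S" by (auto simp: cycle_embeddings_def closed_walks_def)
  qed
  \<comment> \<open>An isomorphism determines its target: the vertices are its image, and every
    edge, being a pair of vertices, is read off from an edge of the standard cycle.\<close>
  have sub: "edges K \<subseteq> edges K'" if K: "K \<in> \<K>" "\<phi> \<in> isos k K" and K': "K' \<in> \<K>" "\<phi> \<in> isos k K'" for K K' \<phi>
  proof
    fix e assume e: "e \<in> edges K"
    then have "e \<subseteq> verts K" "card e = 2" using K(1) by (auto simp: \<K>_def subgraph_def simple_graph_def all_pairs_def)
    then obtain x y where xy: "e = {x, y}" "x \<in> verts K" "y \<in> verts K" by (auto simp: card_2_iff)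
    moreover have "verts K = \<phi> ` {..<k}" using K(2) by (auto simp: isos_def bij_betw_def)
    ultimately obtain u v where uv: "u < k" "v < k" "x = \<phi> u" "y = \<phi> v" by auto
    then have "{u, v} \<in> edges ?C" using K(2) e xy(1) by (auto simp: isos_def)
    then show "e \<in> edges K'" using K'(2) uv xy(1) by (auto simp: isos_def)
  qed
  have disj: "isos k K \<inter> isos k K' = {}" if "K \<in> \<K>" "K' \<in> \<K>" "K \<noteq> K'" for K K'
  proof (rule ccontr)
    assume "isos k K \<inter> isos k K' \<noteq> {}"
    then obtain \<phi> where \<phi>: "\<phi> \<in> isos k K" "\<phi> \<in> isos k K'" by blast
    then have "verts K = verts K'" by (auto simp: isos_def bij_betw_def)
    moreover have "edges K = edges K'" using sub that \<phi> by blast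
    ultimately show False using that(3) by (simp add: prod_eq_iff)
  qed
  have "card (cycle_embeddings k V S) = (\<Sum>K\<in>\<K>. card (isos k K))"
    unfolding eq using fin finI disj by (intro card_UN_disjoint) auto
  also have "\<dots> = (\<Sum>K\<in>\<K>. card (isos k (cycle_graph k)))"
    by (intro sum.cong refl card_isos isoC)
  finally show ?thesis by (simp add: copies_def \<K>_def mult.commute)
qed

lemma card_isos_cycle_pos: "1 \<le> card (isos k (cycle_graph k))"
proof -
  have "restrict id {..<k} \<in> isos k (cycle_graph k)"
    by (auto simp: isos_def bij_betw_def inj_on_def)
  moreover have "finite (isos k (cycle_graph k))"
    by (intro finite_isos) simp
  ultimately show ?thesis by (metis card_gt_0_iff empty_iff less_eq_Suc_le One_nat_def)
qed

section \<open>The random graph as a random set of edges\<close>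

lemma expectation_Pi_bernoulli:
  assumes A: "finite A" and p: "0 \<le> p" "p \<le> 1"
  shows "measure_pmf.expectation (Pi_pmf A False (\<lambda>_. bernoulli_pmf p)) F
    = bexp p A (\<lambda>S. F (\<lambda>e. e \<in> S) :: real)"
proof -
  let ?M = "Pi_pmf A False (\<lambda>_. bernoulli_pmf p)"
  let ?h = "\<lambda>S e. e \<in> S"
  have inj: "inj_on ?h (Pow A)" by (auto simp: inj_on_def fun_eq_iff)
  have "f \<in> ?h ` Pow A" if "f \<in> set_pmf ?M" for f
  proof -
    have "f x = False" if "x \<notin> A" for x
      using set_Pi_pmf_subset[OF A, of False "\<lambda>_. bernoulli_pmf p"] \<open>f \<in> set_pmf ?M\<close> that
      by (auto simp: PiE_dflt_def)
    then have "f = ?h {x. f x}" "{x. f x} \<subseteq> A" by auto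
    then show ?thesis by blast
  qed
  then have "measure_pmf.expectation ?M F = (\<Sum>f\<in>?h ` Pow A. F f * pmf ?M f)"
    using A by (intro integral_measure_pmf_real) auto
  also have "\<dots> = (\<Sum>S\<in>Pow A. F (?h S) * pmf ?M (?h S))"
    by (simp add: sum.reindex[OF inj])
  also have "\<dots> = (\<Sum>S\<in>Pow A. p ^ card S * (1 - p) ^ card (A - S) * F (?h S))"
  proof (intro sum.cong refl)
    fix S assume S: "S \<in> Pow A"
    have "pmf ?M (?h S) = (\<Prod>e\<in>A. pmf (bernoulli_pmf p) (e \<in> S))"
      using A S by (intro pmf_Pi') auto
    also have "\<dots> = (\<Prod>e\<in>A. if e \<in> S then p else 1 - p)"
      using p by (intro prod.cong) auto
    also have "\<dots> = p ^ card S * (1 - p) ^ card (A - S)"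
      using A S by (simp add: prod.If_cases Int_absorb1 Diff_eq Collect_neg_eq)
    finally show "F (?h S) * pmf ?M (?h S) = p ^ card S * (1 - p) ^ card (A - S) * F (?h S)" by simp
  qed
  finally show ?thesis by (simp add: bexp_def)
qed

lemma finite_all_pairs: "finite V \<Longrightarrow> finite (all_pairs V)"
  by (rule finite_subset[of _ "Pow V"]) (auto simp: all_pairs_def)

lemma expectation_random_graph:
  assumes "0 \<le> p" "p \<le> 1"
  shows "measure_pmf.expectation (random_graph n p) F = bexp p (all_pairs {1..n}) (\<lambda>S. F ({1..n}, S) :: real)"
proof -
  have "measure_pmf.expectation (random_graph n p) F
      = bexp p (all_pairs {1..n}) (\<lambda>S. F ({1..n}, {e \<in> all_pairs {1..n}. e \<in> S}))"
    unfolding random_graph_def using assms by (simp add: expectation_Pi_bernoulli finite_all_pairs)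
  also have "\<dots> = bexp p (all_pairs {1..n}) (\<lambda>S. F ({1..n}, S))"
    by (intro bexp_cong arg_cong[where f = F]) auto
  finally show ?thesis .
qed

lemma prob_random_graph:
  assumes "0 \<le> p" "p \<le> 1"
  shows "measure_pmf.prob (random_graph n p) {G. Pr G} = bexp p (all_pairs {1..n}) (\<lambda>S. of_bool (Pr ({1..n}, S)))"
proof -
  have "measure_pmf.prob (random_graph n p) {G. Pr G} = measure_pmf.expectation (random_graph n p) (indicator {G. Pr G})"
    by simp
  also have "\<dots> = bexp p (all_pairs {1..n}) (\<lambda>S. indicator {G. Pr G} ({1..n}, S))"
    by (rule expectation_random_graph[OF assms])
  finally show ?thesis by (simp add: indicator_def)
qed

section \<open>Tail bounds\<close>

abbreviation embedding_count :: "nat \<Rightarrow> nat \<Rightarrow> nat set set \<Rightarrow> real" where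
  "embedding_count k n S \<equiv> real (card (cycle_embeddings k {1..n} S))"

definition moment_const :: "nat \<Rightarrow> real" where
  "moment_const k = 64 * (10000 * real k) ^ k * (real k)\<^sup>2"

lemma moment_const_ge: "1 \<le> k \<Longrightarrow> 1 \<le> moment_const k"
proof -
  assume k: "1 \<le> k"
  have "(1::real) * 1 * 1 \<le> 64 * (10000 * real k) ^ k * (real k)\<^sup>2"
    using k by (intro mult_mono one_le_power) auto
  then show ?thesis by (simp add: moment_const_def)
qed

text \<open>Markov's inequality for the power \<open>4 * r\<close>. The factor 3 in
  \<open>small\<close> exceeds \<open>exp 1\<close>, so the result decays at least like
  \<open>exp (- 4 * r)\<close>.\<close>

lemma embeddings_tail:
  fixes n :: nat
  assumes k: "3 \<le> k" and p: "0 < p" "p \<le> 1" and n: "1 \<le> n" and r: "1 \<le> r" and t: "0 < t"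
    and small: "3 * (moment_const k * moment_scale k n p r) \<le> t"
  shows "bexp p (all_pairs {1..n}) (\<lambda>S. of_bool (t \<le> \<bar>embedding_count k n S - bexp p (all_pairs {1..n}) (embedding_count k n)\<bar>))
    \<le> (1 / 3) ^ (4 * r)"
proof -
  let ?A = "all_pairs {1..n}" and ?N = "embedding_count k n"
  let ?d = "\<lambda>S. ?N S - bexp p ?A ?N"
  have scale0: "0 \<le> moment_const k * moment_scale k n p r"
    using p by (auto simp: moment_const_def moment_scale_def Lp_def intro!: mult_nonneg_nonneg add_nonneg_nonneg zero_le_power)
  have "bexp p ?A (\<lambda>S. of_bool (t \<le> \<bar>?d S\<bar>)) \<le> bexp p ?A (\<lambda>S. 1 / t ^ (4 * r) * ?d S ^ (4 * r))"
  proof (intro bexp_mono)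
    fix S
    show "of_bool (t \<le> \<bar>?d S\<bar>) \<le> 1 / t ^ (4 * r) * ?d S ^ (4 * r)"
    proof (cases "t \<le> \<bar>?d S\<bar>")
      case True
      then have "t ^ (4 * r) \<le> \<bar>?d S\<bar> ^ (4 * r)" using t by (intro power_mono) auto
      also have "\<dots> = ?d S ^ (4 * r)" by (intro power_even_abs) auto
      finally show ?thesis using True t by (simp add: field_simps)
    qed (use t in \<open>simp add: zero_le_even_power\<close>)
  qed (use p in auto)
  also have "\<dots> = 1 / t ^ (4 * r) * bexp p ?A (\<lambda>S. ?d S ^ (4 * r))" by (rule bexp_cmult)
  also have "\<dots> \<le> 1 / t ^ (4 * r) * (moment_const k * moment_scale k n p r) ^ (4 * r)"
    using embeddings_moment[OF k p, of "{1..n}" r] n r t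
    by (intro mult_left_mono) (auto simp: moment_const_def)
  also have "\<dots> = ((moment_const k * moment_scale k n p r) / t) ^ (4 * r)" by (simp add: power_divide)
  also have "\<dots> \<le> (1 / 3) ^ (4 * r)"
    using small t scale0 by (intro power_mono) (auto simp: field_simps)
  finally show ?thesis .
qed

lemma copies_embeddings:
  assumes "is_cycle k H" "S \<subseteq> all_pairs {1..n}"
  shows "real (copies H ({1..n}, S)) = embedding_count k n S / real (card (isos k (cycle_graph k)))"
  using card_cycle_embeddings[OF assms(1) _ assms(2)] card_isos_cycle_pos[of k] by (simp add: field_simps)

lemma expected_copies_embeddings:
  assumes "is_cycle k H" "0 \<le> p" "p \<le> 1"
  shows "expected_copies H n p
    = bexp p (all_pairs {1..n}) (embedding_count k n) / real (card (isos k (cycle_graph k)))"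
proof -
  have "expected_copies H n p = bexp p (all_pairs {1..n})
      (\<lambda>S. 1 / real (card (isos k (cycle_graph k))) * embedding_count k n S)"
    unfolding expected_copies_def expectation_random_graph[OF assms(2,3)]
    by (intro bexp_cong, subst copies_embeddings[OF assms(1)]) auto
  then show ?thesis by (simp only: bexp_cmult) simp
qed

text \<open>The moment order is the integer part of \<open>c * m\<close>. If that is zero, no moment
  is available, but then the right side is at least 1 thanks to its leading 2; otherwise rounding
  down loses less than the slack between \<open>4 * r\<close> and \<open>c * m / 2\<close>.\<close>

lemma tail_from_powers:
  fixes q c m :: real
  assumes q: "q \<le> 1" and c: "0 < c" and m: "0 \<le> m"
    and pow: "\<And>r. 1 \<le> r \<Longrightarrow> real r \<le> c * m \<Longrightarrow> q \<le> (1 / 3) ^ (4 * r)"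
  shows "q \<le> 2 * exp (- (1 / (2 / c)) * m)"
proof (cases "c * m < 1")
  case True
  have "exp (1 / 2 :: real) ^ 2 = exp 1" by (simp add: exp_of_nat_mult[symmetric])
  also have "\<dots> \<le> 2\<^sup>2" using exp_le by simp
  finally have "exp (1 / 2 :: real) \<le> 2" by (rule power2_le_imp_le) simp
  then have "1 \<le> 2 * exp (- (1 / 2) :: real)" by (simp add: exp_minus field_simps)
  also have "\<dots> \<le> 2 * exp (- (1 / (2 / c)) * m)" using True by simp
  finally show ?thesis using q by linarith
next
  case False
  define r where "r = nat \<lfloor>c * m\<rfloor>"
  have r: "1 \<le> r" "real r \<le> c * m" "c * m < real r + 1"
    using False by (auto simp: r_def le_nat_iff)
  have "q \<le> (1 / 3) ^ (4 * r)" using r by (intro pow) auto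
  also have "\<dots> \<le> exp (- 1) ^ (4 * r)"
    using exp_le by (intro power_mono) (auto simp: exp_minus field_simps)
  also have "\<dots> = exp (- real (4 * r))" using exp_of_nat_mult[of "4 * r" "- 1 :: real"] by simp
  also have "\<dots> \<le> exp (- (1 / (2 / c)) * m)"
    using r by simp
  also have "\<dots> \<le> 2 * exp (- (1 / (2 / c)) * m)" by simp
  finally show ?thesis .
qed

section \<open>Matching the moment scale with the exponent\<close>

lemma power_sum3_le:
  fixes x y z :: real
  assumes "0 \<le> x" "0 \<le> y" "0 \<le> z"
  shows "(x + y + z) ^ j \<le> 3 ^ j * (x ^ j + y ^ j + z ^ j)"
proof -
  define u where "u = max x (max y z)"
  have u: "x \<le> u" "y \<le> u" "z \<le> u" "u = x \<or> u = y \<or> u = z" by (auto simp: u_def max_def)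
  have "(x + y + z) ^ j \<le> (3 * u) ^ j" using u assms by (intro power_mono) auto
  also have "\<dots> = 3 ^ j * u ^ j" by (rule power_mult_distrib)
  also have "u ^ j \<le> x ^ j + y ^ j + z ^ j"
    using u(4) assms by auto
  finally show ?thesis by simp
qed

text \<open>After the first monomial, the six in the bracket have the shape
  \<open>s ^ l * L ^ d * x ^ (k - d) * w ^ (d - l)\<close>, with (l, d) in the order (1, 1), (1, k -
  1), (k - 1, k - 1), (2, 2), (2, k), (k, k). This is the shape of the terms of the exponent once
  they are solved for \<open>t\<close>.\<close>

lemma moment_scale_expand:
  fixes n r :: nat
  assumes k: "3 \<le> k" and p: "0 \<le> p"
  defines "L \<equiv> Lp p" and "w \<equiv> sqrt (real n)" and "s \<equiv> sqrt (real r)" and "x \<equiv> p * real n"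
  shows "moment_scale k n p r \<le> s * L ^ k * w ^ k + 3 ^ (k - 2) *
    (s * L * x ^ (k - 1) + s * L ^ (k - 1) * x * w ^ (k - 2) + s ^ (k - 1) * L ^ (k - 1) * x
      + s ^ 2 * L ^ 2 * x ^ (k - 2) + s ^ 2 * L ^ k * w ^ (k - 2) + s ^ k * L ^ k)"
proof -
  obtain j where j: "k = Suc (Suc j)" using k by (cases k; cases "k - 1") auto
  have pos: "0 \<le> L" "0 \<le> w" "0 \<le> s" "0 \<le> x" using p by (auto simp: L_def w_def s_def x_def Lp_def)
  have "moment_scale k n p r = L * s * ((L * w) ^ Suc j * w + (x + L * s) * (x + L * w + L * s) ^ j)"
    by (simp add: moment_scale_def j L_def w_def s_def x_def distrib_left add.assoc)
  also have "\<dots> \<le> L * s * ((L * w) ^ Suc j * w + (x + L * s) * (3 ^ j * (x ^ j + (L * w) ^ j + (L * s) ^ j)))"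
    using pos by (intro mult_left_mono add_left_mono power_sum3_le) auto
  also have "\<dots> = s * L ^ k * w ^ k + 3 ^ (k - 2) *
    (s * L * x ^ (k - 1) + s * L ^ (k - 1) * x * w ^ (k - 2) + s ^ (k - 1) * L ^ (k - 1) * x
      + s ^ 2 * L ^ 2 * x ^ (k - 2) + s ^ 2 * L ^ k * w ^ (k - 2) + s ^ k * L ^ k)"
    by (simp add: j power_mult_distrib algebra_simps power2_eq_square)
  finally show ?thesis .
qed

lemma tail_exponent_first:
  assumes "m \<le> tail_exponent k n p t" "0 \<le> m" "0 < t" "0 < p" "p \<le> 1" "1 \<le> n"
  shows "sqrt m * Lp p ^ k * sqrt (real n) ^ k \<le> t"
proof (rule power2_le_imp_le)
  have L: "0 < Lp p" using Lp_eq[of p] ln_two_div_ge[of p] assms by simp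
  have "m \<le> t\<^sup>2 / (Lp p ^ (2 * k) * real n ^ k)" using assms(1) by (simp add: tail_exponent_def)
  then have "m * (Lp p ^ (2 * k) * real n ^ k) \<le> t\<^sup>2"
    using L assms by (subst (asm) pos_le_divide_eq) auto
  then show "(sqrt m * Lp p ^ k * sqrt (real n) ^ k)\<^sup>2 \<le> t\<^sup>2"
    using assms by (simp add: power_mult_distrib power_mult[symmetric] mult.commute[of k 2] mult.assoc)
      (simp add: power_mult)
qed (use assms in auto)

text \<open>The inequality between \<open>m\<close> and the term for \<open>(l, d)\<close> is solved
  for \<open>t\<close> by raising it to the power \<open>l / 2\<close>, which clears the fractional
  exponents except for the square roots.\<close>

lemma tail_exponent_term:
  assumes "m \<le> tail_exponent k n p t" "0 < m" "0 < t" "0 < p" "p \<le> 1" "1 \<le> n"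
    and ld: "1 \<le> l" "l \<le> d" "d \<le> k" "d < k \<or> 1 < l"
  shows "sqrt m ^ l * Lp p ^ d * (p * real n) ^ (k - d) * sqrt (real n) ^ (d - l) \<le> t"
proof -
  define L where "L = Lp p"
  have L: "0 < L" using Lp_eq[of p] ln_two_div_ge[of p] assms by (simp add: L_def)
  define I where "I = {(l, d). 1 \<le> l \<and> l \<le> d \<and> d \<le> k \<and> (d < k \<or> l > 1)}"
  define F where "F = (\<lambda>(l, d). t powr (2 / real l) /
              (Lp p powr (2 * real d / real l) *
               p powr (2 * (real k - real d) / real l) *
               real n powr ((2 * real k - real d - real l) / real l)))"
  have "finite I" by (rule finite_subset[of _ "{..k} \<times> {..k}"]) (auto simp: I_def)
  moreover have "(l, d) \<in> I" using ld by (auto simp: I_def)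
  ultimately have "Min (F ` I) \<le> F (l, d)" by (intro Min_le) auto
  moreover have "tail_exponent k n p t \<le> Min (F ` I)"
    unfolding tail_exponent_def I_def F_def by (rule min.cobounded2)
  ultimately have mF: "m \<le> F (l, d)" using assms(1) by linarith
  \<comment> \<open>The denominator of the term raised to the power \<open>l / 2\<close>. Its
    exponent of \<open>n\<close> equals \<open>(k - d) + (d - l) / 2\<close>, so \<open>n\<close>
    supplies one factor for each \<open>p\<close> and leaves \<open>sqrt n\<close> to the power
    \<open>d - l\<close>.\<close>
  define W where "W = L powr real d * p powr (real k - real d) * real n powr ((2 * real k - real d - real l) / 2)"
  have W: "0 < W" using L assms by (simp add: W_def)
  have "W powr (2 / real l) = L powr (real d * (2 / real l)) * p powr ((real k - real d) * (2 / real l))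
      * real n powr ((2 * real k - real d - real l) / 2 * (2 / real l))"
    using L assms by (simp add: W_def powr_mult powr_powr)
  also have "real d * (2 / real l) = 2 * real d / real l" by simp
  also have "(real k - real d) * (2 / real l) = 2 * (real k - real d) / real l" by simp
  also have "(2 * real k - real d - real l) / 2 * (2 / real l) = (2 * real k - real d - real l) / real l"
    by (simp only: times_divide_times_eq mult.commute[of _ 2] mult_divide_mult_cancel_left_if) simp
  finally have "F (l, d) = t powr (2 / real l) / W powr (2 / real l)"
    by (simp add: F_def L_def)
  then have "m * W powr (2 / real l) \<le> t powr (2 / real l)"
    using mF W by (simp add: pos_le_divide_eq)
  then have "(m * W powr (2 / real l)) powr (real l / 2) \<le> (t powr (2 / real l)) powr (real l / 2)"
    using assms by (intro powr_mono2) auto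
  then have le: "m powr (real l / 2) * W \<le> t"
    using assms W ld by (simp add: powr_mult powr_powr)
  have root: "sqrt y powr real i = y powr (real i / 2)" if "0 < y" for y i
    using that by (simp add: powr_half_sqrt[symmetric] powr_powr)
  have "m powr (real l / 2) = sqrt m ^ l"
    using assms by (simp add: root[symmetric] powr_realpow)
  moreover have "W = L ^ d * (p * real n) ^ (k - d) * sqrt (real n) ^ (d - l)"
  proof -
    have "real n powr ((2 * real k - real d - real l) / 2) = real n powr real (k - d) * sqrt (real n) powr real (d - l)"
    proof -
      have "(2 * real k - real d - real l) / 2 = real (k - d) + real (d - l) / 2"
        using ld by (simp add: of_nat_diff field_simps)
      moreover have "real n powr (real (d - l) / 2) = sqrt (real n) powr real (d - l)"
        using assms by (intro root[symmetric]) simp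
      ultimately show ?thesis by (simp only: powr_add)
    qed
    moreover have "real k - real d = real (k - d)" using ld by (simp add: of_nat_diff)
    ultimately have "W = L powr real d * p powr real (k - d) * (real n powr real (k - d) * sqrt (real n) powr real (d - l))"
      by (simp only: W_def)
    also have "\<dots> = L ^ d * p ^ (k - d) * (real n ^ (k - d) * sqrt (real n) ^ (d - l))"
      using L assms by (simp only: powr_realpow real_sqrt_gt_0_iff)
    finally show ?thesis by (simp add: power_mult_distrib)
  qed
  ultimately show ?thesis using le by (simp add: L_def mult.assoc)
qed

lemma tail_exponent_nonneg:
  assumes "3 \<le> k"
  shows "0 \<le> tail_exponent k n p t"
proof -
  define I where "I = {(l, d). 1 \<le> l \<and> l \<le> d \<and> d \<le> k \<and> (d < k \<or> l > 1)}"
  have "finite I" by (rule finite_subset[of _ "{..k} \<times> {..k}"]) (auto simp: I_def)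
  moreover have "(1, 1) \<in> I" using assms by (auto simp: I_def)
  ultimately show ?thesis
    unfolding tail_exponent_def I_def[symmetric]
    by (intro min.boundedI Min.boundedI)
      (auto simp: Lp_def intro!: divide_nonneg_nonneg mult_nonneg_nonneg)
qed

text \<open>The choice of \<open>r\<close> gives \<open>sqrt r \<le> \<delta> * sqrt m\<close> with
  \<open>m\<close> the exponent. Every monomial of the expansion contains \<open>sqrt r\<close> at
  least once and \<open>\<delta> \<le> 1\<close>, so each one is at most
  \<open>\<delta> * t\<close>.\<close>

lemma moment_scale_le_tail:
  assumes k: "3 \<le> k" and p: "0 < p" "p \<le> 1" and n: "1 \<le> n" and t: "0 < t" and r: "1 \<le> r"
    and \<delta>: "0 < \<delta>" "\<delta> \<le> 1" and rm: "real r \<le> \<delta>\<^sup>2 * tail_exponent k n p t"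
  shows "moment_scale k n p r \<le> 3 ^ k * \<delta> * t"
proof -
  define m where "m = tail_exponent k n p t"
  have m: "0 < m" using rm r \<delta> tail_exponent_nonneg[OF k, of n p t] by (cases "m = 0") (auto simp: m_def)
  define L where "L = Lp p"
  define w where "w = sqrt (real n)"
  define s where "s = sqrt (real r)"
  define x where "x = p * real n"
  have pos: "0 \<le> L" "0 \<le> w" "0 \<le> s" "0 \<le> x" using p by (auto simp: L_def w_def s_def x_def Lp_def)
  have "s \<le> sqrt (\<delta>\<^sup>2 * m)" unfolding s_def m_def using rm by (rule real_sqrt_le_mono)
  then have s: "s \<le> \<delta> * sqrt m" using \<delta> by (simp add: real_sqrt_mult)
  have sl: "s ^ l \<le> \<delta> * sqrt m ^ l" if "1 \<le> l" for l
  proof -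
    have "s ^ l \<le> (\<delta> * sqrt m) ^ l" using s pos by (intro power_mono) auto
    also have "\<dots> = \<delta> ^ l * sqrt m ^ l" by (rule power_mult_distrib)
    also have "\<dots> \<le> \<delta> * sqrt m ^ l"
      using \<delta> that m power_decreasing[of 1 l \<delta>] by (intro mult_right_mono) auto
    finally show ?thesis .
  qed
  have gen: "s ^ l * L ^ d * x ^ (k - d) * w ^ (d - l) \<le> \<delta> * t"
    if "1 \<le> l" "l \<le> d" "d \<le> k" "d < k \<or> 1 < l" for l d
  proof -
    have "s ^ l * (L ^ d * x ^ (k - d) * w ^ (d - l)) \<le> \<delta> * sqrt m ^ l * (L ^ d * x ^ (k - d) * w ^ (d - l))"
      using pos that sl by (intro mult_right_mono mult_nonneg_nonneg) auto
    also have "\<dots> = \<delta> * (sqrt m ^ l * L ^ d * x ^ (k - d) * w ^ (d - l))" by simp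
    also have "\<dots> \<le> \<delta> * t"
      unfolding L_def x_def w_def m_def using that p n t \<delta> m
      by (intro mult_left_mono tail_exponent_term) (auto simp: m_def)
    finally show ?thesis by (simp add: mult.assoc)
  qed
  have "s * (L ^ k * w ^ k) \<le> \<delta> * sqrt m * (L ^ k * w ^ k)"
    using pos s by (intro mult_right_mono mult_nonneg_nonneg) auto
  also have "\<dots> = \<delta> * (sqrt m * L ^ k * w ^ k)" by simp
  also have "\<dots> \<le> \<delta> * t"
    unfolding L_def w_def m_def using p n t \<delta> m
    by (intro mult_left_mono tail_exponent_first) (auto simp: m_def)
  finally have T0: "s * L ^ k * w ^ k \<le> \<delta> * t" by (simp add: mult.assoc)
  have T: "s * L * x ^ (k - 1) \<le> \<delta> * t" "s * L ^ (k - 1) * x * w ^ (k - 2) \<le> \<delta> * t"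
    "s ^ (k - 1) * L ^ (k - 1) * x \<le> \<delta> * t" "s ^ 2 * L ^ 2 * x ^ (k - 2) \<le> \<delta> * t"
    "s ^ 2 * L ^ k * w ^ (k - 2) \<le> \<delta> * t" "s ^ k * L ^ k \<le> \<delta> * t"
    using gen[of 1 1] gen[of 1 "k - 1"] gen[of "k - 1" "k - 1"] gen[of 2 2] gen[of 2 k] gen[of k k] k
    by (simp_all add: numeral_2_eq_2)
  have "moment_scale k n p r \<le> s * L ^ k * w ^ k + 3 ^ (k - 2) *
    (s * L * x ^ (k - 1) + s * L ^ (k - 1) * x * w ^ (k - 2) + s ^ (k - 1) * L ^ (k - 1) * x
      + s ^ 2 * L ^ 2 * x ^ (k - 2) + s ^ 2 * L ^ k * w ^ (k - 2) + s ^ k * L ^ k)"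
    unfolding L_def w_def s_def x_def using k p by (intro moment_scale_expand) auto
  also have "\<dots> \<le> \<delta> * t + 3 ^ (k - 2) * (6 * (\<delta> * t))"
    using T0 T by (intro add_mono mult_left_mono) auto
  also have "\<dots> \<le> 3 ^ (k - 2) * (\<delta> * t) + 3 ^ (k - 2) * (6 * (\<delta> * t))"
    using \<delta> t mult_right_mono[of 1 "3 ^ (k - 2)" "\<delta> * t"] by simp
  \<comment> \<open>The seven monomials are rounded up to \<open>9 = 3\<^sup>2\<close>, which
    completes \<open>3 ^ (k - 2)\<close> to \<open>3 ^ k\<close>.\<close>
  also have "\<dots> \<le> 3 ^ (k - 2) * (9 * (\<delta> * t))"
    using \<delta> t by (simp add: algebra_simps)
  also have "\<dots> = 3 ^ k * \<delta> * t"
  proof -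
    have "k = k - 2 + 2" using k by simp
    then have "(3::real) ^ k = 3 ^ (k - 2 + 2)" by (rule arg_cong)
    then have "(3::real) ^ k = 3 ^ (k - 2) * 3\<^sup>2" by (simp only: power_add)
    then show ?thesis by simp
  qed
  finally show ?thesis .
qed

section \<open>The expected count and the dense regime\<close>

lemma bexp_subset_indicator:
  assumes "finite A" "T \<subseteq> A"
  shows "bexp p A (\<lambda>S. of_bool (T \<subseteq> S)) = p ^ card T"
proof -
  have T: "finite T" using assms finite_subset by auto
  have "of_bool (T \<subseteq> S) = (\<Prod>e\<in>T. of_bool (id e \<in> S) :: real)" for S
    using T by (induction T) auto
  then have "bexp p A (\<lambda>S. of_bool (T \<subseteq> S)) = bexp p A (\<lambda>S. \<Prod>e\<in>T. of_bool (id e \<in> S))"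
    by simp
  also have "\<dots> = (\<Prod>e\<in>T. p * of_bool True + (1 - p) * of_bool False)"
    by (rule bexp_prod_inj[OF assms(1)]) (use assms in auto)
  finally show ?thesis by simp
qed

text \<open>Vertices are chosen from \<open>k\<close> consecutive disjoint blocks of length
  \<open>q = n div k\<close>, which makes every such map injective. Its edges, at most
  \<open>k\<close> of them, are all present with probability at least \<open>p ^ k\<close>, and
  \<open>q\<close> is at least \<open>n / (2 * k)\<close> because \<open>k \<le> n\<close>.\<close>

lemma expected_embeddings_ge:
  fixes n :: nat
  assumes k: "3 \<le> k" "k \<le> n" and p: "0 < p" "p \<le> 1"
  shows "(p * real n / (2 * real k)) ^ k \<le> bexp p (all_pairs {1..n}) (embedding_count k n)"
proof -
  let ?A = "all_pairs {1..n}"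
  have A: "finite ?A" by (simp add: finite_all_pairs)
  define T where "T \<phi> = (\<lambda>j. {\<phi> j, \<phi> (Suc j mod k)}) ` {..<k}" for \<phi> :: "nat \<Rightarrow> nat"
  define q where "q = n div k"
  define W where "W = (\<Pi>\<^sub>E j\<in>{..<k}. {j * q + 1..(j + 1) * q})"
  have W: "\<phi> \<in> {..<k} \<rightarrow>\<^sub>E {1..n}" "inj_on \<phi> {..<k}" if "\<phi> \<in> W" for \<phi>
  proof -
    have b: "j * q + 1 \<le> \<phi> j" "\<phi> j \<le> (j + 1) * q" if "j < k" for j
      using PiE_mem[OF \<open>\<phi> \<in> W\<close>[unfolded W_def], of j] that by auto
    have le: "(i + 1) * q \<le> j * q" if "i < j" for i j using that by (intro mult_right_mono) auto
    have "\<phi> j \<le> n" if "j < k" for j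
    proof -
      have "(j + 1) * q \<le> k * q" using that by (intro mult_right_mono) auto
      also have "\<dots> \<le> n" by (simp add: q_def)
      finally show ?thesis using b(2)[OF that] by linarith
    qed
    moreover have "1 \<le> \<phi> j" if "j < k" for j using b(1)[OF that] by linarith
    moreover have "\<phi> \<in> extensional {..<k}" using \<open>\<phi> \<in> W\<close> by (simp add: W_def PiE_def)
    ultimately show "\<phi> \<in> {..<k} \<rightarrow>\<^sub>E {1..n}" by (simp add: PiE_def)
    show "inj_on \<phi> {..<k}"
    proof (rule linorder_inj_onI)
      fix i j assume "i < j" "i \<in> {..<k}" "j \<in> {..<k}"
      then show "\<phi> i \<noteq> \<phi> j" using b[of i] b[of j] le[of i j] by auto
    qed auto
  qed
  have finW: "finite W" unfolding W_def by (intro finite_PiE) auto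
  have TA: "T \<phi> \<subseteq> ?A" if "\<phi> \<in> W" for \<phi>
  proof
    fix x assume "x \<in> T \<phi>"
    then obtain j where j: "j < k" "x = {\<phi> j, \<phi> (Suc j mod k)}" by (auto simp: T_def)
    have neq: "Suc j mod k \<noteq> j" "Suc j mod k < k" using Suc_mod_neq[of k j] j k by auto
    have "\<phi> j \<noteq> \<phi> (Suc j mod k)"
      using inj_on_eq_iff[OF W(2)[OF that], of j "Suc j mod k"] j(1) neq by simp
    moreover have "\<phi> i \<in> {1..n}" if "i < k" for i
      using PiE_mem[OF W(1)[OF \<open>\<phi> \<in> W\<close>], of i] that by simp
    ultimately show "x \<in> ?A" using j neq by (simp add: all_pairs_def)
  qed
  have "real n \<le> 2 * real k * real q"
  proof -
    have "n < k * (q + 1)" unfolding q_def using k by (simp add: dividend_less_times_div)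
    moreover have "1 \<le> q" unfolding q_def using k by (simp add: less_eq_Suc_le[symmetric] div_greater_zero_iff)
    ultimately have "n \<le> 2 * k * q" by (smt (verit) add.commute le_trans less_imp_le mult.commute mult.left_commute mult_2 mult_le_mono2 nat_add_left_cancel_le)
    then show ?thesis by (metis of_nat_le_iff of_nat_mult of_nat_numeral)
  qed
  then have "real n / (2 * real k) \<le> real q" using k by (simp add: field_simps)
  then have "(p * (real n / (2 * real k))) ^ k \<le> (p * real q) ^ k"
    using p by (intro power_mono mult_left_mono) auto
  also have "\<dots> = (\<Sum>\<phi>\<in>W. p ^ k)"
    by (simp add: W_def card_PiE power_mult_distrib)
  also have "\<dots> \<le> (\<Sum>\<phi>\<in>W. p ^ card (T \<phi>))"
  proof (intro sum_mono power_decreasing)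
    show "card (T \<phi>) \<le> k" for \<phi> using card_image_le[of "{..<k}"] by (simp add: T_def)
  qed (use p in auto)
  also have "\<dots> = (\<Sum>\<phi>\<in>W. bexp p ?A (\<lambda>S. of_bool (T \<phi> \<subseteq> S)))"
    by (intro sum.cong refl bexp_subset_indicator[symmetric] A TA)
  also have "\<dots> = bexp p ?A (\<lambda>S. \<Sum>\<phi>\<in>W. of_bool (T \<phi> \<subseteq> S))" by (rule bexp_sum[symmetric])
  also have "\<dots> \<le> bexp p ?A (embedding_count k n)"
  proof (intro bexp_mono)
    fix S
    have fin: "finite (cycle_embeddings k {1..n} S)"
      unfolding cycle_embeddings_def closed_walks_def
      by (rule finite_subset[of _ "{..<k} \<rightarrow>\<^sub>E {1..n}"]) (auto intro: finite_PiE)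
    have "(\<Sum>\<phi>\<in>W. of_bool (T \<phi> \<subseteq> S)) = real (card {\<phi> \<in> W. T \<phi> \<subseteq> S})"
      using finW by (simp add: Int_def)
    also have "\<dots> \<le> embedding_count k n S"
      unfolding of_nat_le_iff using fin W
      by (intro card_mono) (auto simp: cycle_embeddings_def closed_walks_def T_def)
    finally show "(\<Sum>\<phi>\<in>W. of_bool (T \<phi> \<subseteq> S)) \<le> embedding_count k n S" .
  qed (use p in auto)
  finally show ?thesis by simp
qed

text \<open>Puts the threshold into the form that makes the pure noise term comparable with a power
  of \<open>p * n\<close>. If \<open>p\<close> is at least \<open>n powr (- a)\<close>, the bound
  \<open>ln (2 / p) \<ge> 1 / 2\<close> suffices. Otherwise
  \<open>ln (2 / p) \<ge> a * ln n \<ge> ln n / 4\<close> compensates the logarithm lost in the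
  threshold; the value 1/4 of \<open>a\<close> occurs at \<open>k = 3\<close> and explains the
  factor 4.\<close>

lemma density_lower_bound:
  fixes k n :: nat and p :: real
  assumes k: "3 \<le> k" "k \<le> n" and p: "0 < p" "p \<le> 1"
    and dens: "real n powr (- (real k - 2) / (2 * (real k - 1))) * ln (real n) powr (- 1 / 2) \<le> p"
  shows "real n \<le> (4 * real n * p\<^sup>2 * ln (2 / p)) ^ (k - 1)"
proof -
  define a where "a = (real k - 2) / (2 * (real k - 1))"
  have a: "1 / 4 \<le> a" using k by (simp add: a_def field_simps)
  have n3: "3 \<le> real n" using k by simp
  have "exp 1 \<le> real n" using exp_le n3 by linarith
  then have ln1: "1 \<le> ln (real n)" using n3 by (subst ln_ge_iff) auto
  have La: "0 < ln (2 / p)" using ln_two_div_ge[OF p] by simp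
  have exps: "(real n powr (- a))\<^sup>2 = real n powr (- 2 * a)"
    using n3 by (simp add: power2_eq_square powr_add[symmetric])
  have "real n powr (- 2 * a) \<le> 4 * (p\<^sup>2 * ln (2 / p))"
  proof (cases "real n powr (- a) \<le> p")
    case True
    have "(real n powr (- a))\<^sup>2 * (1 / 2) \<le> p\<^sup>2 * ln (2 / p)"
    proof (intro mult_mono power_mono True)
      show "1 / 2 \<le> ln (2 / p)" using ln_two_div_ge(1)[OF p] ln2_ge_two_thirds by linarith
    qed auto
    moreover have "0 \<le> (real n powr (- a))\<^sup>2" by simp
    ultimately have "(real n powr (- a))\<^sup>2 \<le> 4 * (p\<^sup>2 * ln (2 / p))" by linarith
    then show ?thesis by (simp only: exps)
  next
    case False
    have "real n powr (- a) * ln (real n) powr (- (1 / 2)) \<le> p"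
      using dens by (simp only: a_def minus_divide_left)
    also have "ln (real n) powr (- (1 / 2)) = 1 / sqrt (ln (real n))"
      using ln1 by (simp add: powr_minus_divide powr_half_sqrt)
    finally have "(real n powr (- a) * (1 / sqrt (ln (real n))))\<^sup>2 \<le> p\<^sup>2"
      using ln1 by (intro power_mono) auto
    then have p2: "real n powr (- 2 * a) * (1 / ln (real n)) \<le> p\<^sup>2"
      using ln1 unfolding power_mult_distrib exps by (simp add: power_divide)
    have "ln p < ln (real n powr (- a))" using False p n3 by (subst ln_less_cancel_iff) auto
    then have "a * ln (real n) \<le> - ln p" using n3 by (simp add: ln_powr)
    also have "\<dots> \<le> ln (2 / p)" using p by (simp add: ln_div)
    finally have "1 / 4 * ln (real n) \<le> ln (2 / p)"
      using a ln1 mult_right_mono[of "1 / 4" a "ln (real n)"] by linarith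
    then have "(real n powr (- 2 * a) * (1 / ln (real n))) * (1 / 4 * ln (real n)) \<le> p\<^sup>2 * ln (2 / p)"
      using p2 ln1 by (intro mult_mono) auto
    then show ?thesis using ln1 by simp
  qed
  then have "(real n powr (- 2 * a)) ^ (k - 1) \<le> (4 * (p\<^sup>2 * ln (2 / p))) ^ (k - 1)"
    by (intro power_mono) auto
  moreover have "(real n powr (- 2 * a)) ^ (k - 1) = real n powr (- (real k - 2))"
  proof -
    have "(real n powr (- 2 * a)) ^ (k - 1) = real n powr (- 2 * a * real (k - 1))"
      using n3 by (simp add: powr_power mult.commute)
    also have "- 2 * a * real (k - 1) = - (real k - 2)"
      using k by (simp add: a_def of_nat_diff field_simps)
    finally show ?thesis .
  qed
  ultimately have "real n ^ (k - 1) * real n powr (- (real k - 2)) \<le> real n ^ (k - 1) * (4 * (p\<^sup>2 * ln (2 / p))) ^ (k - 1)"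
    by (intro mult_left_mono) auto
  also have "\<dots> = (4 * real n * p\<^sup>2 * ln (2 / p)) ^ (k - 1)"
    unfolding power_mult_distrib[symmetric] by (simp add: mult_ac)
  also have "real n ^ (k - 1) * real n powr (- (real k - 2)) = real n"
  proof -
    have "real n ^ (k - 1) * real n powr (- (real k - 2)) = real n powr (real (k - 1) + (- (real k - 2)))"
      unfolding powr_add using n3 by (simp add: powr_realpow)
    also have "real (k - 1) + (- (real k - 2)) = 1" using k by (simp add: of_nat_diff)
    finally show ?thesis using n3 by simp
  qed
  finally show ?thesis .
qed

text \<open>Everything is measured in units of \<open>x = p * n\<close>: above the threshold
  \<open>L * w\<close> and, in its power, the pure noise term are bounded by powers of
  \<open>2 * x\<close>, and the choice of \<open>r\<close> makes \<open>L * sqrt r\<close> at most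
  \<open>\<delta> * u * x\<close>.\<close>

lemma moment_scale_le_dense:
  fixes k n r :: nat and p \<epsilon> :: real
  assumes k: "3 \<le> k" "k \<le> n" and p: "0 < p" "p \<le> 1" and \<epsilon>: "0 < \<epsilon>"
    and dens: "real n \<le> (4 * real n * p\<^sup>2 * ln (2 / p)) ^ (k - 1)"
    and \<delta>: "0 < \<delta>" "\<delta> \<le> 1"
    and r: "real r \<le> \<delta>\<^sup>2 * (min (\<epsilon>\<^sup>2) (\<epsilon> powr (2 / real k)) * (real n)\<^sup>2 * p\<^sup>2 * ln (2 / p))"
  shows "moment_scale k n p r \<le> 4 ^ k * \<delta> * \<epsilon> * (p * real n) ^ k"
proof -
  define La where "La = ln (2 / p)"
  define L where "L = Lp p"
  define w where "w = sqrt (real n)"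
  define x where "x = p * real n"
  define z where "z = L * sqrt (real r)"
  \<comment> \<open>The smaller of \<open>\<epsilon>\<close> and its \<open>k\<close>-th root, so
    that both \<open>u \<le> \<epsilon>\<close> and \<open>u ^ k \<le> \<epsilon>\<close> hold; the
    former serves small deviations, the latter large ones.\<close>
  define u where "u = sqrt (min (\<epsilon>\<^sup>2) (\<epsilon> powr (2 / real k)))"
  obtain j where j: "k = Suc (Suc j)" using k by (cases k; cases "k - 1") auto
  have La: "0 < La" using ln_two_div_ge[OF p] by (simp add: La_def)
  have n: "1 \<le> real n" using k by simp
  have x: "0 < x" using p n by (simp add: x_def)
  have Lq: "L = 1 / sqrt La" using p by (simp add: L_def La_def Lp_eq)
  have L: "0 < L" using La by (simp add: Lq)
  have u2: "u\<^sup>2 = min (\<epsilon>\<^sup>2) (\<epsilon> powr (2 / real k))" using \<epsilon> by (simp add: u_def)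
  have u0: "0 < u" using \<epsilon> by (simp add: u_def)
  have u1: "u \<le> \<epsilon>"
    by (rule power2_le_imp_le) (use u2 \<epsilon> in auto)
  have uk: "u ^ k \<le> \<epsilon>"
  proof -
    have "u\<^sup>2 \<le> (\<epsilon> powr (1 / real k))\<^sup>2"
      using u2 \<epsilon> by (simp add: power2_eq_square powr_add[symmetric])
    then have "u \<le> \<epsilon> powr (1 / real k)" by (rule power2_le_imp_le) simp
    then have "u ^ k \<le> (\<epsilon> powr (1 / real k)) ^ k" using u0 by (intro power_mono) auto
    also have "\<dots> = \<epsilon>" using \<epsilon> k by (simp add: powr_power)
    finally show ?thesis .
  qed
  have z: "0 \<le> z" "z \<le> \<delta> * u * x"
  proof -
    show "0 \<le> z" using L by (simp add: z_def)
    have "sqrt (real r) \<le> sqrt ((\<delta> * u * x)\<^sup>2 * La)"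
      using r unfolding u2[symmetric] by (intro real_sqrt_le_mono) (simp add: power_mult_distrib x_def La_def mult_ac)
    also have "\<dots> = \<delta> * u * x * sqrt La" using \<delta> u0 x by (simp add: real_sqrt_mult)
    finally have "L * sqrt (real r) \<le> L * (\<delta> * u * x * sqrt La)" using L by (intro mult_left_mono) auto
    then show "z \<le> \<delta> * u * x" using La by (simp add: z_def Lq)
  qed
  \<comment> \<open>The ratio of \<open>(2 * x)\<^sup>2\<close> to \<open>(L * w)\<^sup>2\<close>.
    The hypothesis \<open>dens\<close> bounds \<open>n\<close> by a power of \<open>D\<close>, which
    forces \<open>D \<ge> 1\<close> and pays for the extra \<open>w\<close> in the pure noise
    term.\<close>
  define D where "D = 4 * real n * p\<^sup>2 * La"
  have D0: "0 \<le> D" using La by (simp add: D_def)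
  have Dn: "real n \<le> D ^ (k - 1)" using dens by (simp add: D_def La_def)
  have D1: "1 \<le> D"
  proof (rule ccontr)
    assume "\<not> 1 \<le> D"
    then have "D ^ (k - 1) \<le> D ^ 1" using D0 k by (intro power_decreasing) auto
    then show False using Dn n \<open>\<not> 1 \<le> D\<close> by simp
  qed
  have xL: "(2 * x)\<^sup>2 = D * (L * w)\<^sup>2"
    using La n by (simp add: D_def x_def w_def Lq power_mult_distrib power_divide) (simp add: power2_eq_square)
  have y: "L * w \<le> 2 * x"
  proof (rule power2_le_imp_le)
    have "1 * (L * w)\<^sup>2 \<le> D * (L * w)\<^sup>2" using D1 by (intro mult_right_mono) auto
    then show "(L * w)\<^sup>2 \<le> (2 * x)\<^sup>2" by (simp only: xL)
  qed (use x in simp)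
  have yk: "(L * w) ^ (k - 1) * w \<le> (2 * x) ^ (k - 1)"
  proof (rule power2_le_imp_le)
    have "((L * w) ^ (k - 1) * w)\<^sup>2 = ((L * w)\<^sup>2) ^ (k - 1) * real n"
      by (simp only: power_mult_distrib[of "_ ^ _"] w_def) (simp add: power_mult[symmetric] mult.commute)
    also have "\<dots> \<le> ((L * w)\<^sup>2) ^ (k - 1) * D ^ (k - 1)" using Dn by (intro mult_left_mono) auto
    also have "\<dots> = ((2 * x)\<^sup>2) ^ (k - 1)" 
      unfolding xL power_mult_distrib[of D] by (rule mult.commute)
    also have "\<dots> = ((2 * x) ^ (k - 1))\<^sup>2" by (simp only: power_mult[symmetric] mult.commute[of 2])
    finally show "((L * w) ^ (k - 1) * w)\<^sup>2 \<le> ((2 * x) ^ (k - 1))\<^sup>2" .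
  qed (use x in simp)
  define b where "b = \<delta> * u"
  have b0: "0 < b" using \<delta> u0 by (simp add: b_def)
  have "moment_scale k n p r = z * ((L * w) ^ (k - 1) * w + (x + z) * (x + L * w + z) ^ (k - 2))"
    by (simp add: moment_scale_def z_def L_def w_def x_def distrib_left add.assoc)
  also have "\<dots> \<le> (b * x) * ((2 * x) ^ (k - 1) + (x + b * x) * (x + 2 * x + b * x) ^ (k - 2))"
  proof -
    have "z * (v ^ (k - 1) * w + (x + z) * (x + v + z) ^ (k - 2))
        \<le> (b * x) * ((2 * x) ^ (k - 1) + (x + b * x) * (x + 2 * x + b * x) ^ (k - 2))"
      if "0 \<le> v" "v \<le> 2 * x" "v ^ (k - 1) * w \<le> (2 * x) ^ (k - 1)" for v
      using that z x b0 by (intro mult_mono add_mono power_mono) (auto simp: b_def w_def)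
    then show ?thesis using y yk L by (simp add: w_def)
  qed
  also have "\<dots> \<le> (b * x) * (((3 + b) * x) ^ (k - 1) + ((3 + b) * x) * ((3 + b) * x) ^ (k - 2))"
    using b0 x by (intro mult_left_mono add_mono mult_mono power_mono) (auto simp: algebra_simps)
  also have "\<dots> = 2 * (b * (3 + b) ^ (k - 1)) * x ^ k"
  proof -
    have "(b * x) * ((a * x) ^ (k - 1) + (a * x) * (a * x) ^ (k - 2)) = 2 * (b * a ^ (k - 1)) * x ^ k" for a
      by (simp add: j power_mult_distrib mult_ac)
    then show ?thesis by this
  qed
  also have "\<dots> \<le> 2 * (\<delta> * 4 ^ (k - 1) * \<epsilon>) * x ^ k"
  proof (intro mult_right_mono mult_left_mono)
    show "b * (3 + b) ^ (k - 1) \<le> \<delta> * 4 ^ (k - 1) * \<epsilon>"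
    \<comment> \<open>For \<open>u \<le> 1\<close> the sum \<open>3 + b\<close> is at most 4 and
      \<open>b\<close> is at most \<open>\<delta> * \<epsilon>\<close>; for larger \<open>u\<close>
      it is at most \<open>4 * u\<close>, and the powers of \<open>u\<close> combine to
      \<open>u ^ k\<close>.\<close>
    proof (cases "u \<le> 1")
      case True
      then have "b \<le> 1" using \<delta> u0 mult_le_one[of \<delta> u] by (simp add: b_def)
      then have "b * (3 + b) ^ (k - 1) \<le> (\<delta> * \<epsilon>) * 4 ^ (k - 1)"
        using b0 u1 \<delta> \<epsilon> by (intro mult_mono power_mono) (auto simp: b_def)
      then show ?thesis by (simp add: mult_ac)
    next
      case False
      have "b \<le> u" using \<delta> u0 by (simp add: b_def mult_le_cancel_right1)
      then have "b * (3 + b) ^ (k - 1) \<le> b * (4 * u) ^ (k - 1)"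
        using b0 False by (intro mult_left_mono power_mono) auto
      also have "\<dots> = \<delta> * 4 ^ (k - 1) * u ^ k" by (simp add: b_def j power_mult_distrib)
      also have "\<dots> \<le> \<delta> * 4 ^ (k - 1) * \<epsilon>" using uk \<delta> by (intro mult_left_mono) auto
      finally show ?thesis .
    qed
  qed (use x in auto)
  also have "\<dots> \<le> 4 ^ k * \<delta> * \<epsilon> * x ^ k"
    using \<delta> \<epsilon> x by (simp add: j)
  finally show ?thesis by (simp add: x_def)
qed

theorem proposition5p6:
  fixes k :: nat
  assumes "3 \<le> k"
  shows "(\<exists>C>0. \<forall>(H :: 'a graph) (n :: nat) (p :: real) (t :: real).
            is_cycle k H \<and> 1 \<le> n \<and> 0 \<le> p \<and> p \<le> 1 \<and> 0 < t \<longrightarrow>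
            measure_pmf.prob (random_graph n p)
              {G. \<bar>real (copies H G) - expected_copies H n p\<bar> \<ge> t}
            \<le> tail_bound C k n p t)
       \<and> (\<exists>C>0. \<forall>(H :: 'a graph) (n :: nat) (p :: real) (\<epsilon> :: real).
            is_cycle k H \<and> k \<le> n \<and> 0 \<le> p \<and> p \<le> 1 \<and> 0 < \<epsilon> \<and>
            p \<ge> real n powr (- (real k - 2) / (2 * (real k - 1))) * ln (real n) powr (- 1 / 2) \<longrightarrow>
            measure_pmf.prob (random_graph n p)
              {G. real (copies H G) \<ge> (1 + \<epsilon>) * expected_copies H n p}
            \<le> 2 * exp (- (1 / C) * (min (\<epsilon>\<^sup>2) (\<epsilon> powr (2 / real k)) *
                                    (real n)\<^sup>2 * p\<^sup>2 * ln (2 / p))))"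
proof -
  define c where "c = real (card (isos k (cycle_graph k)))"
  have c: "1 \<le> c" using card_isos_cycle_pos[of k] by (simp add: c_def)
  have K: "1 \<le> moment_const k" using assms by (intro moment_const_ge) auto
  \<comment> \<open>Chosen so that \<open>3 * moment_const k * 3 ^ k * \<delta> = 1\<close>, which
    turns the bound of \<open>moment_scale_le_tail\<close> into the hypothesis of the tail
    estimate.\<close>
  define \<delta> where "\<delta> = 1 / (3 ^ (k + 1) * moment_const k)"
  have "1 * 1 \<le> 3 ^ (k + 1) * moment_const k" using K by (intro mult_mono one_le_power) auto
  then have \<delta>: "0 < \<delta>" "\<delta> \<le> 1" using K by (auto simp: \<delta>_def)
  \<comment> \<open>Here \<open>8 * k = 4 * (2 * k)\<close>: the 4 cancels the constant of the dense
    estimate, and \<open>2 * k\<close> is that of the lower bound for the expected count.\<close>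
  define \<gamma> where "\<gamma> = 1 / (3 * moment_const k * (8 * real k) ^ k)"
  have "1 * 1 * 1 \<le> 3 * moment_const k * (8 * real k) ^ k"
    using K assms by (intro mult_mono one_le_power) auto
  then have \<gamma>: "0 < \<gamma>" "\<gamma> \<le> 1" using K assms by (auto simp: \<gamma>_def)
  show ?thesis
  proof (intro conjI, goal_cases)
    case 1
    show ?case
    proof (intro exI[of _ "2 / \<delta>\<^sup>2"] conjI allI impI)
      fix H :: "'a graph" and n :: nat and p t :: real
      assume H: "is_cycle k H \<and> 1 \<le> n \<and> 0 \<le> p \<and> p \<le> 1 \<and> 0 < t"
      let ?A = "all_pairs {1..n}" and ?N = "embedding_count k n"
      define q where "q = measure_pmf.prob (random_graph n p)
                {G. \<bar>real (copies H G) - expected_copies H n p\<bar> \<ge> t}"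
      have q1: "q \<le> 1" unfolding q_def by (rule measure_pmf.prob_le_1)
      have qN: "q \<le> bexp p ?A (\<lambda>S. of_bool (t \<le> \<bar>?N S - bexp p ?A ?N\<bar>))"
        unfolding q_def using H
      proof (subst prob_random_graph, simp, simp, intro bexp_mono)
        fix S assume S: "S \<subseteq> ?A"
        have "real (copies H ({1..n}, S)) - expected_copies H n p = (?N S - bexp p ?A ?N) / c"
          using H S copies_embeddings[of k H S n] expected_copies_embeddings[of k H p n]
          by (simp add: c_def diff_divide_distrib)
        \<comment> \<open>Passing from embeddings to copies divides by the number \<open>c\<close>
          of automorphisms, which is at least 1 and so only shrinks the deviation.\<close>
        moreover have "\<bar>(?N S - bexp p ?A ?N) / c\<bar> \<le> \<bar>?N S - bexp p ?A ?N\<bar>"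
          using c by (simp add: abs_divide divide_le_eq mult_le_cancel_left1)
        ultimately show "of_bool (t \<le> \<bar>real (copies H ({1..n}, S)) - expected_copies H n p\<bar>)
            \<le> (of_bool (t \<le> \<bar>?N S - bexp p ?A ?N\<bar>) :: real)"
          by auto
      qed auto
      show "q \<le> tail_bound (2 / \<delta>\<^sup>2) k n p t"
      proof (cases "p = 0")
        case True
        \<comment> \<open>At \<open>p = 0\<close> the edge set is almost surely empty, so the count
          equals its mean and a deviation of \<open>t > 0\<close> has probability 0.\<close>
        have b0: "bexp 0 ?A F = F {}" for F
        proof -
          have "bexp 0 ?A F = (\<Sum>S\<in>{{}}. 0 ^ card S * (1 - 0) ^ card (?A - S) * F S)"
            unfolding bexp_def
          proof (intro sum.mono_neutral_right)
            show "\<forall>S\<in>Pow ?A - {{}}. 0 ^ card S * (1 - 0) ^ card (?A - S) * F S = 0"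
              by (auto simp: finite_all_pairs card_gt_0_iff dest: finite_subset[OF _ finite_all_pairs])
          qed (auto simp: finite_all_pairs)
          then show ?thesis by simp
        qed
        have "q \<le> of_bool (t \<le> \<bar>?N {} - ?N {}\<bar>)" using qN unfolding True b0 .
        then show ?thesis using H True by (simp add: tail_bound_def)
      next
        case False
        then have p: "0 < p" "p \<le> 1" using H by auto
        have "q \<le> 2 * exp (- (1 / (2 / \<delta>\<^sup>2)) * tail_exponent k n p t)"
        proof (rule tail_from_powers[OF q1])
          show "0 \<le> tail_exponent k n p t" by (rule tail_exponent_nonneg[OF assms])
          fix r assume r: "1 \<le> r" "real r \<le> \<delta>\<^sup>2 * tail_exponent k n p t"
          have "moment_const k * moment_scale k n p r \<le> moment_const k * (3 ^ k * \<delta> * t)"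
            using K H r p assms \<delta> by (intro mult_left_mono moment_scale_le_tail) auto
          also have "3 * \<dots> = t" using K by (simp add: \<delta>_def)
          finally show "q \<le> (1 / 3) ^ (4 * r)"
            using qN embeddings_tail[OF assms p _ r(1), of n t] H by simp
        qed (use \<delta> in simp)
        then show ?thesis using False by (simp add: tail_bound_def)
      qed
    qed (use \<delta> in simp)
  next
    case 2
    show ?case
    proof (intro exI[of _ "2 / \<gamma>\<^sup>2"] conjI allI impI)
      fix H :: "'a graph" and n :: nat and p \<epsilon> :: real
      assume H: "is_cycle k H \<and> k \<le> n \<and> 0 \<le> p \<and> p \<le> 1 \<and> 0 < \<epsilon> \<and>
              p \<ge> real n powr (- (real k - 2) / (2 * (real k - 1))) * ln (real n) powr (- 1 / 2)"
      let ?A = "all_pairs {1..n}" and ?N = "embedding_count k n"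
      let ?m = "min (\<epsilon>\<^sup>2) (\<epsilon> powr (2 / real k)) * (real n)\<^sup>2 * p\<^sup>2 * ln (2 / p)"
      define q where "q = measure_pmf.prob (random_graph n p)
                {G. real (copies H G) \<ge> (1 + \<epsilon>) * expected_copies H n p}"
      have n: "3 \<le> n" using H assms by simp
      \<comment> \<open>The density threshold is positive for \<open>n \<ge> 3\<close>, which rules
        out \<open>p = 0\<close>.\<close>
      have "0 < ln (real n)" using n by simp
      then have "0 < real n powr (- (real k - 2) / (2 * (real k - 1))) * ln (real n) powr (- 1 / 2)"
        using n by simp
      with H have p: "0 < p" "p \<le> 1" by linarith+
      define E where "E = bexp p ?A ?N"
      have E: "(p * real n / (2 * real k)) ^ k \<le> E"
        unfolding E_def using H assms p by (intro expected_embeddings_ge) auto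
      have E0: "0 < E" using n p assms by (intro less_le_trans[OF _ E]) simp
      have q1: "q \<le> 1" unfolding q_def by (rule measure_pmf.prob_le_1)
      have qN: "q \<le> bexp p ?A (\<lambda>S. of_bool (\<epsilon> * E \<le> \<bar>?N S - E\<bar>))"
        unfolding q_def using H
      proof (subst prob_random_graph, simp, simp, intro bexp_mono)
        fix S assume S: "S \<subseteq> ?A"
        have eqs: "real (copies H ({1..n}, S)) = ?N S / c" "expected_copies H n p = E / c"
          using H S copies_embeddings[of k H S n] expected_copies_embeddings[of k H p n]
          by (simp_all add: c_def E_def)
        have "(1 + \<epsilon>) * expected_copies H n p \<le> real (copies H ({1..n}, S)) \<longleftrightarrow> (1 + \<epsilon>) * E \<le> ?N S"
          unfolding eqs times_divide_eq_right using c by (simp add: divide_le_cancel)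
        then show "of_bool ((1 + \<epsilon>) * expected_copies H n p \<le> real (copies H ({1..n}, S)))
            \<le> (of_bool (\<epsilon> * E \<le> \<bar>?N S - E\<bar>) :: real)"
          by (auto simp: algebra_simps)
      qed auto
      show "q \<le> 2 * exp (- (1 / (2 / \<gamma>\<^sup>2)) * ?m)"
      proof (rule tail_from_powers[OF q1])
        show "0 \<le> ?m" using ln_two_div_ge[OF p] by (intro mult_nonneg_nonneg) auto
        fix r assume r: "1 \<le> r" "real r \<le> \<gamma>\<^sup>2 * ?m"
        have "moment_const k * moment_scale k n p r \<le> moment_const k * (4 ^ k * \<gamma> * \<epsilon> * (p * real n) ^ k)"
          using K H r p assms \<gamma>
          by (intro mult_left_mono moment_scale_le_dense density_lower_bound) auto
        also have "3 * \<dots> = \<epsilon> * (p * real n / (2 * real k)) ^ k"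
        proof -
          have "(8 * real k) ^ k = 4 ^ k * (2 * real k) ^ k"
            unfolding power_mult_distrib[of 4, symmetric] by simp
          moreover have "3 * (M * (a * (1 / (3 * M * (a * b))) * e * y)) = e * (y / b)"
            if "0 < M" "0 < a" "0 < b" for M a b e y :: real
            using that by (simp add: field_simps)
          moreover have "0 < moment_const k" "(0::real) < 4 ^ k" "0 < (2 * real k) ^ k"
            using K assms by simp_all
          ultimately show ?thesis unfolding \<gamma>_def power_divide by (simp only:)
        qed
        also have "\<dots> \<le> \<epsilon> * E" using E H by (intro mult_left_mono) auto
        finally show "q \<le> (1 / 3) ^ (4 * r)"
          using qN embeddings_tail[OF assms p _ r(1), of n "\<epsilon> * E"] H E0 n by (simp add: E_def)
      qed (use \<gamma> in simp)
    qed (use \<gamma> in simp)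
  qed
qed

end
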